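(* Let $E$ be a Polish space and let $\alpha:\mathcal{P}(E)\to(-\infty,\infty]$ be convex, not identically $\infty$, with weakly compact sub-level sets $\{\nu:\alpha(\nu)\le c\}$, $c\in\mathbb{R}$. Let $\rho_n$ be the functional associated with $\alpha$ (defined in the context). Let $\psi:E\to[0,\infty)$ be continuous. (1) If $F:\mathcal{P}_\psi(E)\to\mathbb{R}\cup\{\infty\}$ is lower semicontinuous (with respect to the $\psi$-weak topology) and bounded from below, then $$\liminf_{n\to\infty}\frac1n\rho_n(nF\circ L_n)\ge\sup_{\nu\in\mathcal{P}_\psi(E)}\big(F(\nu)-\alpha(\nu)\big).$$ (2) Suppose also that the sub-level sets of $\alpha$ are pre-compact subsets of $\mathcal{P}_\psi(E)$. If $F:\mathcal{P}_\psi(E)\to\mathbb{R}\cup\{-\infty\}$ is upper semicontinuous (with respect to the $\psi$-weak topology) and bounded from above, then $$\limsup_{n\to\infty}\frac1n\rho_n(nF\circ L_n)\le\sup_{\nu\in\mathcal{P}_\psi(E)}\big(F(\nu)-\alpha(\nu)\big).$$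
   Context: $\mathcal{P}(E)$ is the set of Borel probability measures on $E$ with the weak topology. $\mathcal{P}_\psi(E)=\{\nu\in\mathcal{P}(E):\int\psi\,d\nu<\infty\}$ carries the $\psi$-weak topology, generated by the maps $\nu\mapsto\int f\,d\nu$ with $f:E\to\mathbb{R}$ continuous, $|f|\le1+\psi$. A set is a pre-compact subset of $\mathcal{P}_\psi(E)$ if it is contained in $\mathcal{P}_\psi(E)$ and has compact closure there. $L_n:E^n\to\mathcal{P}_\psi(E)$ is $L_n(x_1,\dots,x_n)=\frac1n\sum_{i=1}^n\delta_{x_i}$. For $\nu\in\mathcal{P}(E^n)$ define $\nu_{0,1}\in\mathcal{P}(E)$ and measurable $\nu_{k-1,k}:E^{k-1}\to\mathcal{P}(E)$, $k=2,\dots,n$, by $\nu(dx_1,\dots,dx_n)=\nu_{0,1}(dx_1)\prod_{k=2}^n\nu_{k-1,k}(x_1,\dots,x_{k-1})(dx_k)$, and set $$\alpha_n(\nu)=\int_{E^n}\sum_{k=1}^n\alpha(\nu_{k-1,k}(x_1,\dots,x_{k-1}))\,\nu(dx_1,\dots,dx_n).$$ For measurable $f:E^n\to[-\infty,\infty]$, $$\rho_n(f)=\sup_{\nu\in\mathcal{P}(E^n)}\Big(\int_{E^n}f\,d\nu-\alpha_n(\nu)\Big),$$ with the convention $\infty-\infty:=-\infty$ throughout; in particular $\int f\,d\nu:=-\infty$ if $\int f^+\,d\nu=\int f^-\,d\nu=\infty$. *)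

theory Defs
  imports "HOL-Probability.Probability"
begin

text \<open>
  A Polish space is a type of class \<open>polish_space\<close>; its metric plays no role beyond
  inducing the topology. Points of \<open>E\<^sup>n\<close> are functions in \<open>space (PiM {0..<n} (\<lambda>_. borel))\<close>,
  so the coordinates are indexed by \<open>0, \<dots>, n - 1\<close>, and \<open>E\<^sup>0\<close> is the single point
  \<open>\<lambda>_. undefined\<close>.
\<close>

abbreviation powE :: "nat \<Rightarrow> (nat \<Rightarrow> 'a::topological_space) measure" where
  "powE n \<equiv> PiM {0..<n} (\<lambda>_. borel)"

definition probs :: "'a::topological_space measure set" where
  "probs = space (prob_algebra borel)"

definition probs_psi :: "('a::topological_space \<Rightarrow> real) \<Rightarrow> 'a measure set" where
  "probs_psi \<psi> = {\<nu> \<in> probs. (\<integral>\<^sup>+ x. ennreal (\<psi> x) \<partial>\<nu>) < \<infinity>}"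


text \<open>The coarsest topology on \<open>X\<close> making \<open>\<nu> \<mapsto> \<integral> f d\<nu>\<close> continuous for every \<open>f \<in> C\<close>.\<close>

definition integral_topology ::
    "'a measure set \<Rightarrow> ('a \<Rightarrow> real) set \<Rightarrow> 'a measure topology" where
  "integral_topology X C =
     topology_generated_by {{\<nu> \<in> X. (\<integral>x. f x \<partial>\<nu>) \<in> U} | f U. f \<in> C \<and> open U}"

definition weak_topology :: "'a::topological_space measure topology" where
  "weak_topology = integral_topology probs {f. continuous_on UNIV f \<and> bounded (range f)}"

definition psi_weak_topology ::
    "('a::topological_space \<Rightarrow> real) \<Rightarrow> 'a measure topology" where
  "psi_weak_topology \<psi> =
     integral_topology (probs_psi \<psi>) {f. continuous_on UNIV f \<and> (\<forall>x. \<bar>f x\<bar> \<le> 1 + \<psi> x)}"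

definition precompact_in :: "'b topology \<Rightarrow> 'b set \<Rightarrow> bool" where
  "precompact_in T S \<longleftrightarrow> S \<subseteq> topspace T \<and> compactin T (T closure_of S)"

definition lower_semicontinuous_map :: "'b topology \<Rightarrow> ('b \<Rightarrow> ereal) \<Rightarrow> bool" where
  "lower_semicontinuous_map T f \<longleftrightarrow> (\<forall>c. openin T {x \<in> topspace T. c < f x})"

definition upper_semicontinuous_map :: "'b topology \<Rightarrow> ('b \<Rightarrow> ereal) \<Rightarrow> bool" where
  "upper_semicontinuous_map T f \<longleftrightarrow> (\<forall>c. openin T {x \<in> topspace T. f x < c})"


definition mixture :: "real \<Rightarrow> 'a::topological_space measure \<Rightarrow> 'a measure \<Rightarrow> 'a measure" where
  "mixture t \<mu> \<nu> = measure_of UNIV (sets borel)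
     (\<lambda>A. ennreal t * emeasure \<mu> A + ennreal (1 - t) * emeasure \<nu> A)"

definition convex_on_probs :: "('a::topological_space measure \<Rightarrow> ereal) \<Rightarrow> bool" where
  "convex_on_probs \<alpha> \<longleftrightarrow>
     (\<forall>\<mu>\<in>probs. \<forall>\<nu>\<in>probs. \<forall>t\<in>{0<..<1}.
        \<alpha> (mixture t \<mu> \<nu>) \<le> ereal t * \<alpha> \<mu> + ereal (1 - t) * \<alpha> \<nu>)"


text \<open>The library has \<open>\<infinity> - \<infinity> = \<infinity>\<close> on \<^typ>\<open>ereal\<close>; here the convention is \<open>\<infinity> - \<infinity> = -\<infinity>\<close>.\<close>

definition eminus :: "ereal \<Rightarrow> ereal \<Rightarrow> ereal" where
  "eminus a b = (if \<bar>a\<bar> = \<infinity> \<and> a = b then -\<infinity> else a - b)"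

text \<open>\<^const>\<open>e2ennreal\<close> sends negative values to 0, so the two integrals are those of the
  positive and the negative part of \<open>f\<close>.\<close>

definition eintegral :: "'b measure \<Rightarrow> ('b \<Rightarrow> ereal) \<Rightarrow> ereal" where
  "eintegral M f =
     eminus (enn2ereal (\<integral>\<^sup>+ x. e2ennreal (f x) \<partial>M)) (enn2ereal (\<integral>\<^sup>+ x. e2ennreal (- f x) \<partial>M))"


definition empirical :: "nat \<Rightarrow> (nat \<Rightarrow> 'a::topological_space) \<Rightarrow> 'a measure" where
  "empirical n x = measure_of UNIV (sets borel)
     (\<lambda>A. (\<Sum>i<n. emeasure (return borel (x i)) A) / of_nat n)"

text \<open>
  \<open>\<kappa> k\<close> is the conditional law of coordinate \<open>k\<close> given the coordinates before it, and
  \<open>\<kappa> 0 (\<lambda>_. undefined)\<close> is the law of coordinate 0. The locale predicate says that each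
  \<open>\<kappa> k\<close> is a probability kernel from \<open>E\<^sup>k\<close> to \<open>E\<close>; \<open>Ionescu_Tulcea.C \<kappa> (\<lambda>_. borel) 0 n\<close> is the
  iterated composition of \<open>\<kappa> 0, \<dots>, \<kappa> (n - 1)\<close>. The kernels \<open>\<kappa> k\<close> with \<open>k \<ge> n\<close> do not matter.
\<close>

definition disintegrates ::
    "nat \<Rightarrow> (nat \<Rightarrow> 'a::topological_space) measure \<Rightarrow> (nat \<Rightarrow> (nat \<Rightarrow> 'a) \<Rightarrow> 'a measure) \<Rightarrow> bool" where
  "disintegrates n \<nu> \<kappa> \<longleftrightarrow>
     Ionescu_Tulcea \<kappa> (\<lambda>_. borel) \<and>
     \<nu> = Ionescu_Tulcea.C \<kappa> (\<lambda>_. borel) 0 n (\<lambda>_. undefined)"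

text \<open>A disintegration is unique only up to null sets, whence the choice operator; on a Polish
  space one exists, and the value of \<open>alpha_n\<close> does not depend on which one is chosen (for
  measurable \<open>\<alpha>\<close> bounded from below).\<close>

definition disintegration ::
    "nat \<Rightarrow> (nat \<Rightarrow> 'a::topological_space) measure \<Rightarrow> nat \<Rightarrow> (nat \<Rightarrow> 'a) \<Rightarrow> 'a measure" where
  "disintegration n \<nu> = (SOME \<kappa>. disintegrates n \<nu> \<kappa>)"

definition alpha_n ::
    "('a::topological_space measure \<Rightarrow> ereal) \<Rightarrow> nat \<Rightarrow> (nat \<Rightarrow> 'a) measure \<Rightarrow> ereal" where
  "alpha_n \<alpha> n \<nu> =
     eintegral \<nu> (\<lambda>x. \<Sum>k<n. \<alpha> (disintegration n \<nu> k (restrict x {0..<k})))"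

definition rho ::
    "('a::topological_space measure \<Rightarrow> ereal) \<Rightarrow> nat \<Rightarrow> ((nat \<Rightarrow> 'a) \<Rightarrow> ereal) \<Rightarrow> ereal" where
  "rho \<alpha> n f =
     (SUP \<nu> \<in> space (prob_algebra (powE n)). eminus (eintegral \<nu> f) (alpha_n \<alpha> n \<nu>))"

end

theory Submission
  imports Defs
begin

text \<open>
  A law \<open>\<nu>\<close> on \<open>E\<^sup>n\<close> with successive kernels \<open>\<kappa>\<^sub>0, \<dots>, \<kappa>\<^sub>n\<^sub>-\<^sub>1\<close> produces two random measures: the
  empirical measure \<open>L\<^sub>n\<close> of the coordinates and the average \<open>M\<^sub>n = (\<kappa>\<^sub>0 + \<dots> + \<kappa>\<^sub>n\<^sub>-\<^sub>1) / n\<close> of their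
  conditional laws. For a test function \<open>f\<close> the differences \<open>f(x\<^sub>k) - \<integral>f d\<kappa>\<^sub>k\<close> are martingale
  increments, so \<open>\<integral>f dL\<^sub>n\<close> and \<open>\<integral>f dM\<^sub>n\<close> agree up to small errors with high probability. For
  \<open>|f| \<le> 1 + \<psi>\<close> one truncates \<open>f\<close> at height \<open>R + 1\<close>; what is cut off is at most \<open>(\<psi> - R)\<^sup>+\<close>, and its
  mean under \<open>L\<^sub>n\<close> equals its mean under \<open>M\<^sub>n\<close>. The resulting estimate (\<open>deviation_prob_le\<close>) depends on
  \<open>\<nu>\<close> only through a bound on the mean of \<open>\<integral>(\<psi> - R)\<^sup>+ dM\<^sub>n\<close>, and serves both halves of the theorem.

  Lower bound. Test the supremum defining \<open>\<rho>\<^sub>n\<close> with the product law \<open>\<mu>\<^sup>n\<close>. Its kernels are almost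
  surely \<open>\<mu>\<close> (\<open>kernels_of_product_law\<close>), so it costs \<open>n \<alpha>(\<mu>)\<close>, and the estimate above becomes a law of
  large numbers. Lower semicontinuity keeps \<open>F(L\<^sub>n)\<close> above any \<open>c < F(\<mu>)\<close> with probability near 1,
  and on the exceptional set \<open>F\<close> is bounded below.

  Upper bound. Convexity gives \<open>\<alpha>(M\<^sub>n) \<le> (\<alpha>(\<kappa>\<^sub>0) + \<dots> + \<alpha>(\<kappa>\<^sub>n\<^sub>-\<^sub>1)) / n\<close> (\<open>avg_le\<close>), so heuristically the
  gain per coordinate is at most \<open>F(M\<^sub>n) - \<alpha>(M\<^sub>n)\<close>. Let \<open>c\<close> exceed the supremum of \<open>F - \<alpha>\<close> and let \<open>B\<close>
  bound \<open>F\<close>. Compactness of \<open>{\<alpha> \<le> B - c}\<close> yields finitely many basic neighbourhoods, each with a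
  number \<open>r\<close> such that \<open>F \<le> r\<close> and \<open>\<alpha> \<ge> r - c\<close> on it, whose halved versions cover the sublevel set
  (\<open>finite_cover_of_sublevel\<close>). Taking the least \<open>r\<close> whose halved neighbourhood contains \<open>M\<^sub>n\<close>, and
  \<open>B\<close> if there is none, gives a finitely valued envelope \<open>h\<close> with \<open>h - c \<le> \<alpha>(M\<^sub>n)\<close> always, and with
  \<open>F(L\<^sub>n) \<le> h\<close> as soon as \<open>L\<^sub>n\<close> and \<open>M\<^sub>n\<close> are close in the finitely many test functions involved.
  Integrating, the gain per coordinate is at most \<open>c\<close> plus a multiple of the probability that they
  are not close.

  That probability is uniformly small because convexity turns compactness of sublevel sets into
  linear growth: for each \<open>\<delta>\<close> there is \<open>R\<close> with \<open>\<integral>(\<psi> - R)\<^sup>+ d\<kappa> \<le> \<delta> (1 + \<alpha>(\<kappa>) - inf \<alpha>)\<close>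
  (\<open>excess_integral_le_rate\<close>). Hence either the cost of \<open>\<nu>\<close> is so large that its gain is at most \<open>c\<close>
  per coordinate anyway, or the truncation error is of order \<open>\<delta>\<close>.

  The integral of an extended-valued function is monotone for arbitrary functions, so the cost and
  \<open>F \<circ> L\<^sub>n\<close> enter only through measurable bounds.

  Finally, \<open>alpha_n\<close> speaks about a chosen disintegration, so one has to exist for every \<open>\<nu>\<close>. Regular
  conditional distributions are built on the real line from conditional distribution functions
  (\<open>real_regular_conditional\<close>) and carried over to \<open>E\<close> along a Borel injection into the reals that is
  continuous on compact sets of almost full measure (\<open>polish_measure_real_encoding\<close>).
\<close>

section \<open>Extended-valued integrals\<close>

lemma eminus_mono:
  assumes "a \<le> a'" "b' \<le> b" shows "eminus a b \<le> eminus a' b'"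
  using assms unfolding eminus_def
  by (cases a; cases a'; cases b; cases b') auto

text \<open>
  The integral of a nonnegative function is a supremum over simple functions below it, hence
  monotone for all functions. Monotonicity is how \<open>\<alpha>\<close> and \<open>F\<close> are compared with measurable bounds.
\<close>

lemma eintegral_mono:
  assumes "\<And>x. x \<in> space M \<Longrightarrow> f x \<le> g x"
  shows "eintegral M f \<le> eintegral M g"
  unfolding eintegral_def
  by (intro eminus_mono) (auto intro!: nn_integral_mono e2ennreal_mono assms simp: less_eq_ennreal.rep_eq[symmetric])

lemma eintegral_eq_integral:
  assumes "integrable M f"
  shows "eintegral M (\<lambda>x. ereal (f x)) = ereal (\<integral>x. f x \<partial>M)"
proof -
  have fin: "(\<integral>\<^sup>+x. ennreal (f x) \<partial>M) \<noteq> \<infinity>" "(\<integral>\<^sup>+x. ennreal (- f x) \<partial>M) \<noteq> \<infinity>"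
    using assms by (auto simp: real_integrable_def)
  have e: "enn2ereal z = ereal (enn2real z)" if "z \<noteq> \<infinity>" for z
    using that by (metis enn2ereal_ennreal ennreal_enn2real_if enn2real_nonneg infinity_ennreal_def)
  have "eintegral M (\<lambda>x. ereal (f x)) =
      eminus (ereal (enn2real (\<integral>\<^sup>+x. ennreal (f x) \<partial>M))) (ereal (enn2real (\<integral>\<^sup>+x. ennreal (- f x) \<partial>M)))"
    unfolding eintegral_def by (simp add: e[OF fin(1)] e[OF fin(2)])
  then show ?thesis
    unfolding real_lebesgue_integral_def[OF assms] by (simp add: eminus_def)
qed

lemma eintegral_cong_AE:
  assumes "AE x in M. f x = g x" shows "eintegral M f = eintegral M g"
proof -
  have "(\<integral>\<^sup>+ x. e2ennreal (f x) \<partial>M) = (\<integral>\<^sup>+ x. e2ennreal (g x) \<partial>M)"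
    "(\<integral>\<^sup>+ x. e2ennreal (- f x) \<partial>M) = (\<integral>\<^sup>+ x. e2ennreal (- g x) \<partial>M)"
    using assms by (auto intro!: nn_integral_cong_AE)
  then show ?thesis unfolding eintegral_def by simp
qed

text \<open>
  Positive and negative parts satisfy \<open>u + d\<^sup>+ + (u + d)\<^sup>- = (u + d)\<^sup>+ + d\<^sup>-\<close>. Integrating this identity
  is enough, since the two terms with a minus are finite even when \<open>u\<close> has infinite integral.
\<close>

lemma (in prob_space) eintegral_add_const:
  assumes [measurable]: "u \<in> borel_measurable M"
  shows "eintegral M (\<lambda>x. enn2ereal (u x) + ereal d) = enn2ereal (\<integral>\<^sup>+x. u x \<partial>M) + ereal d"
proof -
  let ?f = "\<lambda>x. enn2ereal (u x) + ereal d"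
  let ?p = "\<integral>\<^sup>+x. e2ennreal (?f x) \<partial>M" and ?q = "\<integral>\<^sup>+x. e2ennreal (- ?f x) \<partial>M"
  have q: "?q \<le> ennreal (max 0 (- d))"
  proof -
    have "?q \<le> (\<integral>\<^sup>+x. ennreal (max 0 (- d)) \<partial>M)"
    proof (rule nn_integral_mono)
      fix x
      show "e2ennreal (- ?f x) \<le> ennreal (max 0 (- d))"
      proof (cases "u x" rule: ennreal_cases)
        case (real r) then show ?thesis by (auto simp: enn2ereal_ennreal intro!: ennreal_leI)
      qed (simp add: e2ennreal_neg)
    qed
    then show ?thesis by (simp add: emeasure_space_1)
  qed
  have pt: "u x + ennreal (max 0 d) + e2ennreal (- ?f x) = e2ennreal (?f x) + ennreal (max 0 (- d))" for x
  proof (cases "u x" rule: ennreal_cases)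
    case (real r)
    have "e2ennreal (?f x) = ennreal (max 0 (r + d))" "e2ennreal (- ?f x) = ennreal (max 0 (- r - d))"
      using real by (auto simp: enn2ereal_ennreal ennreal_neg max_def)
    with real show ?thesis
      by (simp add: max_def flip: ennreal_plus)
  next
    case top then show ?thesis by (simp add: infinity_ennreal_def)
  qed
  have [measurable]: "(\<lambda>x. e2ennreal (?f x)) \<in> borel_measurable M" "(\<lambda>x. e2ennreal (- ?f x)) \<in> borel_measurable M"
    by measurable
  have "(\<integral>\<^sup>+x. u x + ennreal (max 0 d) + e2ennreal (- ?f x) \<partial>M) =
        (\<integral>\<^sup>+x. e2ennreal (?f x) + ennreal (max 0 (- d)) \<partial>M)"
    by (simp only: pt)
  then have eq: "(\<integral>\<^sup>+x. u x \<partial>M) + ennreal (max 0 d) + ?q = ?p + ennreal (max 0 (- d))"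
    by (simp add: nn_integral_add emeasure_space_1)
  obtain q where q': "0 \<le> q" "?q = ennreal q"
    using q by (cases ?q rule: ennreal_cases) (auto simp: top_unique)
  show ?thesis
  proof (cases "\<integral>\<^sup>+x. u x \<partial>M" rule: ennreal_cases)
    case (real r)
    with eq q' have "?p \<noteq> \<infinity>"
      by (metis ennreal_add_eq_top ennreal_neq_top infinity_ennreal_def)
    then obtain p where p: "0 \<le> p" "?p = ennreal p" by (cases ?p rule: ennreal_cases) auto
    have "ennreal (r + max 0 d + q) = ennreal (p + max 0 (- d))"
      using eq real p q' by (simp add: ennreal_plus del: ennreal_max_0 ennreal_max_0')
    then have "r + max 0 d + q = p + max 0 (- d)"
      using real p q' by (subst (asm) ennreal_inj) auto
    then have "p - q = r + d" by (auto simp: max_def split: if_splits)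
    then show ?thesis
      unfolding eintegral_def using p q' real by (simp add: enn2ereal_ennreal eminus_def)
  next
    case top
    with eq have "?p = \<infinity>"
      by (metis ennreal_add_eq_top ennreal_neq_top infinity_ennreal_def)
    then show ?thesis
      unfolding eintegral_def using top q' by (simp add: enn2ereal_ennreal eminus_def)
  qed
qed

text \<open>
  The basic neighbourhoods of \<open>\<mu>\<close> in an integral topology have this form.
\<close>

abbreviation integrals_close :: "('a \<Rightarrow> real) set \<Rightarrow> real \<Rightarrow> 'a measure \<Rightarrow> 'a measure \<Rightarrow> bool" where
  "integrals_close \<Phi> e \<nu> \<mu> \<equiv> \<forall>f\<in>\<Phi>. \<bar>(\<integral>x. f x \<partial>\<nu>) - (\<integral>x. f x \<partial>\<mu>)\<bar> < e"

section \<open>The weak and the \<open>\<psi>\<close>-weak topology\<close>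

lemma topspace_integral_topology:
  assumes "C \<noteq> {}" shows "topspace (integral_topology X C) = X"
proof -
  obtain f where "f \<in> C" using assms by blast
  then have "{\<nu> \<in> X. (\<integral>x. f x \<partial>\<nu>) \<in> UNIV} \<in> {{\<nu> \<in> X. (\<integral>x. f x \<partial>\<nu>) \<in> U} | f U. f \<in> C \<and> open U}"
    using open_UNIV by blast
  then show ?thesis
    unfolding integral_topology_def topology_generated_by_topspace by auto
qed

lemma openin_integral_topology_basic:
  assumes "f \<in> C" "open U"
  shows "openin (integral_topology X C) {\<nu> \<in> X. (\<integral>x. f x \<partial>\<nu>) \<in> U}"
  unfolding integral_topology_def using assms by (intro topology_generated_by_Basis) auto

lemma openin_integral_nhd:
  assumes "finite \<Phi>" "\<Phi> \<subseteq> C" "C \<noteq> {}"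
  shows "openin (integral_topology X C) {\<nu> \<in> X. \<forall>f\<in>\<Phi>. \<bar>(\<integral>x. f x \<partial>\<nu>) - v f\<bar> < e}"
  using assms(1,2)
proof (induction \<Phi>)
  case empty
  then show ?case
    using openin_topspace[of "integral_topology X C"] by (simp add: topspace_integral_topology assms(3))
next
  case (insert f \<Phi>)
  have "{\<nu> \<in> X. \<forall>g\<in>insert f \<Phi>. \<bar>(\<integral>x. g x \<partial>\<nu>) - v g\<bar> < e} =
     {\<nu> \<in> X. (\<integral>x. f x \<partial>\<nu>) \<in> ball (v f) e} \<inter> {\<nu> \<in> X. \<forall>g\<in>\<Phi>. \<bar>(\<integral>x. g x \<partial>\<nu>) - v g\<bar> < e}"
    by (auto simp: dist_real_def abs_minus_commute)
  moreover have "openin (integral_topology X C) \<dots>"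
    using insert by (intro openin_Int openin_integral_topology_basic) auto
  ultimately show ?case by simp
qed

text \<open>
  Finite intersections of subbasic sets form a basis, and a finite family of open conditions on the
  numbers \<open>\<integral>f d\<nu>\<close> contains one with a common radius \<open>e\<close>.
\<close>

lemma integral_topology_nhd_basis:
  assumes "openin (integral_topology X C) W" "\<mu> \<in> W"
  obtains \<Phi> e where "finite \<Phi>" "\<Phi> \<subseteq> C" "0 < e"
    "\<And>\<nu>. \<nu> \<in> X \<Longrightarrow> (integrals_close \<Phi> e \<nu> \<mu>) \<Longrightarrow> \<nu> \<in> W"
proof -
  have "generate_topology_on {{\<nu> \<in> X. (\<integral>x. f x \<partial>\<nu>) \<in> U} |f U. f \<in> C \<and> open U} W"
    using assms(1) unfolding integral_topology_def openin_topology_generated_by_iff .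
  then have "\<mu> \<in> W \<longrightarrow> (\<exists>\<Phi> e. finite \<Phi> \<and> \<Phi> \<subseteq> C \<and> (0::real) < e \<and>
    (\<forall>\<nu>\<in>X. (integrals_close \<Phi> e \<nu> \<mu>) \<longrightarrow> \<nu> \<in> W))"
  proof induction
    case (Int a b)
    show ?case
    proof
      assume "\<mu> \<in> a \<inter> b"
      with Int obtain \<Phi> e \<Psi> d where
        "finite \<Phi>" "\<Phi> \<subseteq> C" "(0::real) < e" "\<forall>\<nu>\<in>X. (integrals_close \<Phi> e \<nu> \<mu>) \<longrightarrow> \<nu> \<in> a"
        "finite \<Psi>" "\<Psi> \<subseteq> C" "(0::real) < d" "\<forall>\<nu>\<in>X. (integrals_close \<Psi> d \<nu> \<mu>) \<longrightarrow> \<nu> \<in> b"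
        by auto
      then show "\<exists>\<Phi> e. finite \<Phi> \<and> \<Phi> \<subseteq> C \<and> (0::real) < e \<and>
        (\<forall>\<nu>\<in>X. (integrals_close \<Phi> e \<nu> \<mu>) \<longrightarrow> \<nu> \<in> a \<inter> b)"
        by (intro exI[of _ "\<Phi> \<union> \<Psi>"] exI[of _ "min e d"]) auto
    qed
  next
    case (UN K)
    show ?case
    proof
      assume "\<mu> \<in> \<Union>K"
      then obtain k where "k \<in> K" "\<mu> \<in> k" by auto
      with UN.IH[of k] show "\<exists>\<Phi> e. finite \<Phi> \<and> \<Phi> \<subseteq> C \<and> (0::real) < e \<and>
        (\<forall>\<nu>\<in>X. (integrals_close \<Phi> e \<nu> \<mu>) \<longrightarrow> \<nu> \<in> \<Union>K)"
        by (meson UnionI)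
    qed
  next
    case (Basis s)
    then obtain f U where s: "s = {\<nu> \<in> X. (\<integral>x. f x \<partial>\<nu>) \<in> U}" "f \<in> C" "open U" by auto
    show ?case
    proof
      assume "\<mu> \<in> s"
      then obtain e where "0 < e" "\<And>y. dist y (\<integral>x. f x \<partial>\<mu>) < e \<Longrightarrow> y \<in> U"
        using s open_dist[of U] by auto
      then show "\<exists>\<Phi> e. finite \<Phi> \<and> \<Phi> \<subseteq> C \<and> (0::real) < e \<and>
        (\<forall>\<nu>\<in>X. (integrals_close \<Phi> e \<nu> \<mu>) \<longrightarrow> \<nu> \<in> s)"
        using s by (intro exI[of _ "{f}"] exI[of _ e]) (auto simp: dist_real_def)
    qed
  qed auto
  with assms(2) show ?thesis using that by auto
qed

lemma probs_iff: "\<nu> \<in> probs \<longleftrightarrow> sets \<nu> = sets borel \<and> prob_space \<nu>"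
  by (simp add: probs_def space_prob_algebra)

lemma probs_space: "\<nu> \<in> probs \<Longrightarrow> space \<nu> = UNIV"
  by (metis probs_iff sets_eq_imp_space_eq space_borel)

lemma topspace_weak: "topspace (weak_topology :: 'a::topological_space measure topology) = probs"
  unfolding weak_topology_def
proof (rule topspace_integral_topology)
  have "(\<lambda>_. 0) \<in> {f :: 'a \<Rightarrow> real. continuous_on UNIV f \<and> bounded (range f)}" by simp
  then show "{f :: 'a \<Rightarrow> real. continuous_on UNIV f \<and> bounded (range f)} \<noteq> {}" by blast
qed

lemma topspace_psi_weak:
  assumes "\<forall>x. 0 \<le> \<psi> x" shows "topspace (psi_weak_topology \<psi>) = probs_psi \<psi>"
  unfolding psi_weak_topology_def
proof (rule topspace_integral_topology)
  have "(\<lambda>_. 0) \<in> {f. continuous_on UNIV f \<and> (\<forall>x. \<bar>f x\<bar> \<le> 1 + \<psi> x)}"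
    using assms by (simp add: add_increasing)
  then show "{f. continuous_on UNIV f \<and> (\<forall>x. \<bar>f x\<bar> \<le> 1 + \<psi> x)} \<noteq> {}" by blast
qed

lemma probs_psi_subset: "probs_psi \<psi> \<subseteq> probs"
  by (auto simp: probs_psi_def)

text \<open>
  A bounded continuous function, divided by its bound, is dominated by \<open>1 \<le> 1 + \<psi>\<close> and is therefore
  one of the test functions of the \<open>\<psi>\<close>-weak topology.
\<close>

lemma openin_weak_imp_psi_weak:
  assumes "openin weak_topology W" and psi: "\<forall>x. 0 \<le> \<psi> x"
  shows "openin (psi_weak_topology \<psi>) (W \<inter> probs_psi \<psi>)"
proof -
  have "generate_topology_on {{\<nu> \<in> probs. (\<integral>x. f x \<partial>\<nu>) \<in> U} | (f :: 'a \<Rightarrow> real) U.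
      f \<in> {f. continuous_on UNIV f \<and> bounded (range f)} \<and> open U} W"
    using assms(1) unfolding weak_topology_def integral_topology_def openin_topology_generated_by_iff .
  then show ?thesis
  proof induction
    case (Int a b)
    have "(a \<inter> probs_psi \<psi>) \<inter> (b \<inter> probs_psi \<psi>) = a \<inter> b \<inter> probs_psi \<psi>" by blast
    then show ?case using openin_Int[OF Int.IH] by simp
  next
    case (UN K)
    have "\<Union>K \<inter> probs_psi \<psi> = (\<Union>k\<in>K. k \<inter> probs_psi \<psi>)" by blast
    moreover have "openin (psi_weak_topology \<psi>) (\<Union>k\<in>K. k \<inter> probs_psi \<psi>)"
      using UN.IH by (intro openin_Union) auto
    ultimately show ?case by (simp only:)
  next
    case (Basis s)
    then obtain f :: "'a \<Rightarrow> real" and U where s: "s = {\<nu> \<in> probs. (\<integral>x. f x \<partial>\<nu>) \<in> U}"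
      and f: "continuous_on UNIV f" "bounded (range f)" and U: "open U" by auto
    obtain b where b: "0 < b" "\<And>x. \<bar>f x\<bar> \<le> b" using f(2) by (auto simp: bounded_pos)
    have "s \<inter> probs_psi \<psi> = {\<nu> \<in> probs_psi \<psi>. (\<integral>x. f x / b \<partial>\<nu>) \<in> (\<lambda>t. b * t) -` U}"
      using b(1) probs_psi_subset by (auto simp: s)
    moreover have "openin (psi_weak_topology \<psi>) {\<nu> \<in> probs_psi \<psi>. (\<integral>x. f x / b \<partial>\<nu>) \<in> (\<lambda>t. b * t) -` U}"
      unfolding psi_weak_topology_def
    proof (rule openin_integral_topology_basic)
      have "\<bar>f x / b\<bar> \<le> 1 + \<psi> x" for x
      proof -
        have "\<bar>f x / b\<bar> \<le> 1" using b(1) b(2)[of x] by simp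
        then show ?thesis using psi[rule_format, of x] by linarith
      qed
      then show "(\<lambda>x. f x / b) \<in> {f. continuous_on UNIV f \<and> (\<forall>x. \<bar>f x\<bar> \<le> 1 + \<psi> x)}"
        using f(1) b(1) by (auto intro!: continuous_intros)
      show "open ((\<lambda>t. b * t) -` U)" by (intro open_vimage U continuous_intros)
    qed
    ultimately show ?case by simp
  qed simp
qed

text \<open>
  The indicator of a closed set \<open>K\<close> is the decreasing limit of the continuous functions
  \<open>max 0 (1 - n * dist(x, K))\<close>, so integrals of bounded continuous functions determine the measure of
  closed sets, and closed sets generate the Borel sets.
\<close>

lemma measure_eq_from_bounded_continuous:
  fixes \<mu> \<nu> :: "'a::metric_space measure"
  assumes \<mu>: "\<mu> \<in> probs" and \<nu>: "\<nu> \<in> probs"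
    and eq: "\<And>f :: 'a \<Rightarrow> real. continuous_on UNIV f \<Longrightarrow> bounded (range f) \<Longrightarrow> (\<integral>x. f x \<partial>\<mu>) = (\<integral>x. f x \<partial>\<nu>)"
  shows "\<mu> = \<nu>"
proof -
  have sb: "sets \<mu> = sets borel" "sets \<nu> = sets borel" and P: "prob_space \<mu>" "prob_space \<nu>"
    using \<mu> \<nu> by (auto simp: probs_iff)
  have lim: "(\<lambda>n. \<integral>x. max 0 (1 - real n * infdist x K) \<partial>N) \<longlonglongrightarrow> (\<integral>x. indicator K x \<partial>N)"
    if N: "sets N = sets borel" "prob_space N" and K: "closed K" "K \<noteq> {}" for N :: "'a measure" and K
  proof (rule integral_dominated_convergence[where w = "\<lambda>_. 1"])
    interpret prob_space N by fact
    show "integrable N (\<lambda>_. 1::real)" by simp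
    have c: "continuous_on UNIV (\<lambda>x. max 0 (1 - real n * infdist x K))" for n
      by (intro continuous_intros)
    show "(\<lambda>x. max 0 (1 - real n * infdist x K)) \<in> borel_measurable N" for n
      using borel_measurable_continuous_onI[OF c] by (simp add: measurable_cong_sets[OF N(1) refl])
    show "indicator K \<in> borel_measurable N"
      using borel_closed[OF K(1)] N(1) by (intro borel_measurable_indicator) simp
    show "AE x in N. (\<lambda>n. max 0 (1 - real n * infdist x K)) \<longlonglongrightarrow> indicator K x"
    proof (rule AE_I2)
      fix x
      show "(\<lambda>n. max 0 (1 - real n * infdist x K)) \<longlonglongrightarrow> indicator K x"
      proof (cases "x \<in> K")
        case True then show ?thesis by simp
      next
        case False
        then have pos: "0 < infdist x K"
          using in_closed_iff_infdist_zero[OF K, of x] infdist_nonneg[of x K] by auto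
        obtain m where m: "1 < real m * infdist x K"
          using reals_Archimedean3[OF pos] by blast
        have "\<forall>\<^sub>F n in sequentially. max 0 (1 - real n * infdist x K) = indicator K x"
          using eventually_ge_at_top[of m]
        proof eventually_elim
          case (elim n)
          then have "real m * infdist x K \<le> real n * infdist x K" using pos by (intro mult_right_mono) auto
          with m False show ?case by simp
        qed
        then show ?thesis by (rule tendsto_eventually)
      qed
    qed
    show "AE x in N. norm (max 0 (1 - real n * infdist x K)) \<le> 1" for n
      by (auto simp: max_def infdist_nonneg)
  qed
  show ?thesis
  proof (rule measure_eqI_generator_eq[where E = "{K. closed K}" and \<Omega> = UNIV and A = "\<lambda>_. UNIV"])
    show "Int_stable {K::'a set. closed K}" by (auto simp: Int_stable_def)
    show "sets \<mu> = sigma_sets UNIV {K. closed K}" "sets \<nu> = sigma_sets UNIV {K. closed K}"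
      using sb by (simp_all add: borel_eq_closed)
    show "emeasure \<mu> UNIV \<noteq> \<infinity>"
      using P(1) by (metis \<mu> ennreal_one_neq_top infinity_ennreal_def prob_space.emeasure_space_1 probs_space)
    fix K :: "'a set" assume "K \<in> {K. closed K}"
    then have K: "closed K" by simp
    show "emeasure \<mu> K = emeasure \<nu> K"
    proof (cases "K = {}")
      case False
      have "(\<integral>x. max 0 (1 - real n * infdist x K) \<partial>\<mu>) = (\<integral>x. max 0 (1 - real n * infdist x K) \<partial>\<nu>)" for n
        by (rule eq, intro continuous_intros)
          (auto intro!: boundedI[where B = 1] simp: max_def infdist_nonneg)
      then have "(\<lambda>n. \<integral>x. max 0 (1 - real n * infdist x K) \<partial>\<mu>) = (\<lambda>n. \<integral>x. max 0 (1 - real n * infdist x K) \<partial>\<nu>)"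
        by blast
      with lim[OF sb(1) P(1) K False] lim[OF sb(2) P(2) K False]
      have "(\<integral>x. indicator K x \<partial>\<mu>) = ((\<integral>x. indicator K x \<partial>\<nu>)::real)"
        using LIMSEQ_unique by metis
      moreover have "emeasure N K = ennreal (\<integral>x. indicator K x \<partial>N)"
        if "sets N = sets borel" "prob_space N" for N :: "'a measure"
      proof -
        interpret prob_space N by fact
        show ?thesis using borel_closed[OF K] that by (simp add: emeasure_eq_measure)
      qed
      ultimately show ?thesis using sb P by simp
    qed simp
  qed auto
qed

text \<open>
  Needed to turn compact sublevel sets into closed ones, that is, to obtain lower semicontinuity of
  \<open>\<alpha>\<close>.
\<close>

lemma Hausdorff_weak: "Hausdorff_space (weak_topology :: 'a::metric_space measure topology)"
  unfolding Hausdorff_space_def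
proof (intro allI impI)
  fix \<mu> \<nu> :: "'a measure"
  assume "\<mu> \<in> topspace weak_topology \<and> \<nu> \<in> topspace weak_topology \<and> \<mu> \<noteq> \<nu>"
  then have mn: "\<mu> \<in> probs" "\<nu> \<in> probs" "\<mu> \<noteq> \<nu>" by (auto simp: topspace_weak)
  then obtain f :: "'a \<Rightarrow> real" where f: "continuous_on UNIV f" "bounded (range f)" "(\<integral>x. f x \<partial>\<mu>) \<noteq> (\<integral>x. f x \<partial>\<nu>)"
    using measure_eq_from_bounded_continuous by blast
  then obtain U V where "open U" "open V" "(\<integral>x. f x \<partial>\<mu>) \<in> U" "(\<integral>x. f x \<partial>\<nu>) \<in> V" "U \<inter> V = {}"
    using hausdorff by metis
  then have "openin weak_topology {\<nu> \<in> probs. (\<integral>x. f x \<partial>\<nu>) \<in> U}" "openin weak_topology {\<nu> \<in> probs. (\<integral>x. f x \<partial>\<nu>) \<in> V}"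
    "\<mu> \<in> {\<nu> \<in> probs. (\<integral>x. f x \<partial>\<nu>) \<in> U}" "\<nu> \<in> {\<nu> \<in> probs. (\<integral>x. f x \<partial>\<nu>) \<in> V}"
    "disjnt {\<nu> \<in> probs. (\<integral>x. f x \<partial>\<nu>) \<in> U} {\<nu> \<in> probs. (\<integral>x. f x \<partial>\<nu>) \<in> V}"
    using f mn unfolding weak_topology_def disjnt_def
    by (auto intro!: openin_integral_topology_basic)
  then show "\<exists>U V. openin weak_topology U \<and> openin weak_topology V \<and> \<mu> \<in> U \<and> \<nu> \<in> V \<and> disjnt U V"
    by blast
qed

section \<open>Weighted sums of measures\<close>

text \<open>
  A common form for the mixtures in the definition of convexity, for empirical measures and for
  averages of kernels, so that integrals against all three are computed once.
\<close>

definition weighted_sum :: "'i set \<Rightarrow> ('i \<Rightarrow> real) \<Rightarrow> ('i \<Rightarrow> 'a::topological_space measure) \<Rightarrow> 'a measure" where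
  "weighted_sum I w M = measure_of UNIV (sets borel) (\<lambda>A. \<Sum>i\<in>I. ennreal (w i) * emeasure (M i) A)"

lemma sets_weighted_sum [simp, measurable_cong]: "sets (weighted_sum I w M) = sets borel"
  unfolding weighted_sum_def using sets.sigma_sets_eq[of borel] by (simp add: sets_measure_of_conv)

lemma space_weighted_sum [simp]: "space (weighted_sum I w M) = UNIV"
  using sets_eq_imp_space_eq[OF sets_weighted_sum] by simp

lemma emeasure_weighted_sum:
  assumes "\<And>i. i \<in> I \<Longrightarrow> sets (M i) = sets borel" "A \<in> sets borel"
  shows "emeasure (weighted_sum I w M) A = (\<Sum>i\<in>I. ennreal (w i) * emeasure (M i) A)"
  unfolding weighted_sum_def
proof (rule emeasure_measure_of_sigma)
  show "sigma_algebra UNIV (sets borel)"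
    by (metis sets.sigma_algebra_axioms space_borel)
  show "positive (sets borel) (\<lambda>A. \<Sum>i\<in>I. ennreal (w i) * emeasure (M i) A)"
    by (simp add: positive_def)
  show "countably_additive (sets borel) (\<lambda>A. \<Sum>i\<in>I. ennreal (w i) * emeasure (M i) A)"
  proof (rule countably_additiveI)
    fix X :: "nat \<Rightarrow> 'b set" assume X: "range X \<subseteq> sets borel" "disjoint_family X"
    have "(\<Sum>n. \<Sum>i\<in>I. ennreal (w i) * emeasure (M i) (X n)) = (\<Sum>i\<in>I. \<Sum>n. ennreal (w i) * emeasure (M i) (X n))"
      by (rule suminf_sum) auto
    also have "\<dots> = (\<Sum>i\<in>I. ennreal (w i) * emeasure (M i) (\<Union>n. X n))"
    proof (rule sum.cong)
      fix i assume "i \<in> I"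
      then have "range X \<subseteq> sets (M i)" using X(1) assms(1) by simp
      then show "(\<Sum>n. ennreal (w i) * emeasure (M i) (X n)) = ennreal (w i) * emeasure (M i) (\<Union>n. X n)"
        using suminf_emeasure[OF _ X(2), of "M i"] by simp
    qed simp
    finally show "(\<Sum>n. \<Sum>i\<in>I. ennreal (w i) * emeasure (M i) (X n)) = (\<Sum>i\<in>I. ennreal (w i) * emeasure (M i) (\<Union>n. X n))" .
  qed
qed (fact assms)

lemma nn_integral_weighted_sum:
  assumes M: "\<And>i. i \<in> I \<Longrightarrow> sets (M i) = sets borel" and f: "f \<in> borel_measurable borel"
  shows "(\<integral>\<^sup>+x. f x \<partial>weighted_sum I w M) = (\<Sum>i\<in>I. ennreal (w i) * (\<integral>\<^sup>+x. f x \<partial>M i))"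
  using f
proof (induction rule: borel_measurable_induct)
  case (cong f g)
  then have "f = g" by (auto simp: fun_eq_iff)
  with cong show ?case by simp
next
  case (set A)
  then show ?case using M by (simp add: emeasure_weighted_sum)
next
  case (mult u c)
  have [measurable]: "u \<in> borel_measurable (M i)" if "i \<in> I" for i
    using mult measurable_cong_sets[OF M[OF that] refl] by blast
  have [measurable]: "u \<in> borel_measurable (weighted_sum I w M)"
    using mult by simp
  show ?case using mult
    by (simp add: nn_integral_cmult sum_distrib_left mult.left_commute)
next
  case (add u v)
  have [measurable]: "u \<in> borel_measurable (M i)" "v \<in> borel_measurable (M i)" if "i \<in> I" for i
    using add measurable_cong_sets[OF M[OF that] refl] by blast+
  have [measurable]: "u \<in> borel_measurable (weighted_sum I w M)" "v \<in> borel_measurable (weighted_sum I w M)"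
    using add by simp_all
  show ?case using add
    by (simp add: nn_integral_add distrib_left sum.distrib)
next
  case (seq U)
  have [measurable]: "U n \<in> borel_measurable (M i)" if "i \<in> I" for i n
    using seq measurable_cong_sets[OF M[OF that] refl] by blast
  have [measurable]: "U n \<in> borel_measurable (weighted_sum I w M)" for n
    using seq by simp
  have inc: "incseq (\<lambda>n. ennreal (w i) * (\<integral>\<^sup>+x. U n x \<partial>M i))" for i
    using seq(3) by (auto simp: incseq_def le_fun_def intro!: mult_left_mono nn_integral_mono)
  have "(\<integral>\<^sup>+x. (SUP n. U n) x \<partial>weighted_sum I w M) = (SUP n. \<integral>\<^sup>+x. U n x \<partial>weighted_sum I w M)"
    using seq(3) by (simp add: nn_integral_monotone_convergence_SUP image_comp)
  also have "\<dots> = (SUP n. \<Sum>i\<in>I. ennreal (w i) * (\<integral>\<^sup>+x. U n x \<partial>M i))"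
    using seq by simp
  also have "\<dots> = (\<Sum>i\<in>I. SUP n. ennreal (w i) * (\<integral>\<^sup>+x. U n x \<partial>M i))"
    using inc by (intro ennreal_SUP_sum) auto
  also have "\<dots> = (\<Sum>i\<in>I. ennreal (w i) * (\<integral>\<^sup>+x. (SUP n. U n) x \<partial>M i))"
  proof (rule sum.cong)
    fix i assume "i \<in> I"
    then show "(SUP n. ennreal (w i) * (\<integral>\<^sup>+x. U n x \<partial>M i)) = ennreal (w i) * (\<integral>\<^sup>+x. (SUP n. U n) x \<partial>M i)"
      using seq(3) by (simp add: nn_integral_monotone_convergence_SUP image_comp SUP_mult_left_ennreal)
  qed simp
  finally show ?case .
qed

lemma weighted_sum_in_probs:
  assumes "finite I" "\<And>i. i \<in> I \<Longrightarrow> M i \<in> probs" "\<And>i. i \<in> I \<Longrightarrow> 0 \<le> w i" "sum w I = 1"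
  shows "weighted_sum I w M \<in> probs"
  unfolding probs_iff
proof
  have "emeasure (weighted_sum I w M) UNIV = (\<Sum>i\<in>I. ennreal (w i) * emeasure (M i) UNIV)"
    using assms by (intro emeasure_weighted_sum) (auto simp: probs_iff)
  also have "\<dots> = (\<Sum>i\<in>I. ennreal (w i))"
  proof (rule sum.cong)
    fix i assume "i \<in> I"
    then have "emeasure (M i) UNIV = 1"
      using assms(2)[of i] by (metis prob_space.emeasure_space_1 probs_iff probs_space)
    then show "ennreal (w i) * emeasure (M i) UNIV = ennreal (w i)" by simp
  qed simp
  also have "\<dots> = 1" using assms by (subst sum_ennreal) auto
  finally show "prob_space (weighted_sum I w M)" by (intro prob_spaceI) simp
qed simp

lemma integral_weighted_sum:
  fixes f :: "'a::topological_space \<Rightarrow> real"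
  assumes I: "finite I" and M: "\<And>i. i \<in> I \<Longrightarrow> sets (M i) = sets borel" and w: "\<And>i. i \<in> I \<Longrightarrow> 0 \<le> w i"
    and f: "f \<in> borel_measurable borel" "\<And>i. i \<in> I \<Longrightarrow> integrable (M i) f"
  shows "integrable (weighted_sum I w M) f" (is ?int)
    and "(\<integral>x. f x \<partial>weighted_sum I w M) = (\<Sum>i\<in>I. w i * (\<integral>x. f x \<partial>M i))" (is ?eq)
proof -
  let ?N = "weighted_sum I w M"
  have pm: "(\<integral>\<^sup>+x. ennreal (g x) \<partial>?N) = ennreal (\<Sum>i\<in>I. w i * enn2real (\<integral>\<^sup>+x. ennreal (g x) \<partial>M i))"
    if "g = f \<or> g = (\<lambda>x. - f x)" for g
  proof -
    have fin: "(\<integral>\<^sup>+x. ennreal (g x) \<partial>M i) < \<infinity>" if "i \<in> I" for i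
      using f(2)[OF that] \<open>g = f \<or> g = (\<lambda>x. - f x)\<close> by (auto simp: real_integrable_def less_top)
    have "g \<in> borel_measurable borel" using that f(1) by auto
    then have "(\<integral>\<^sup>+x. ennreal (g x) \<partial>?N) = (\<Sum>i\<in>I. ennreal (w i) * (\<integral>\<^sup>+x. ennreal (g x) \<partial>M i))"
      by (intro nn_integral_weighted_sum M) auto
    also have "\<dots> = (\<Sum>i\<in>I. ennreal (w i * enn2real (\<integral>\<^sup>+x. ennreal (g x) \<partial>M i)))"
      using fin w by (intro sum.cong) (auto simp: ennreal_mult)
    also have "\<dots> = ennreal (\<Sum>i\<in>I. w i * enn2real (\<integral>\<^sup>+x. ennreal (g x) \<partial>M i))"
      using w by (intro sum_ennreal) auto
    finally show ?thesis .
  qed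
  show int: ?int
    unfolding real_integrable_def using f(1) pm[of f] pm[of "\<lambda>x. - f x"] by simp
  have nn: "0 \<le> (\<Sum>i\<in>I. w i * enn2real (\<integral>\<^sup>+x. ennreal (g x) \<partial>M i))" for g
    using w by (intro sum_nonneg) auto
  have "(\<integral>x. f x \<partial>?N) = (\<Sum>i\<in>I. w i * enn2real (\<integral>\<^sup>+x. ennreal (f x) \<partial>M i)) - (\<Sum>i\<in>I. w i * enn2real (\<integral>\<^sup>+x. ennreal (- f x) \<partial>M i))"
    unfolding real_lebesgue_integral_def[OF int] using pm[of f] pm[of "\<lambda>x. - f x"] nn[of f] nn[of "\<lambda>x. - f x"] by simp
  also have "\<dots> = (\<Sum>i\<in>I. w i * (\<integral>x. f x \<partial>M i))"
    using f(2) by (simp add: real_lebesgue_integral_def right_diff_distrib sum_subtractf)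
  finally show ?eq .
qed

abbreviation avg :: "nat \<Rightarrow> (nat \<Rightarrow> 'a::topological_space measure) \<Rightarrow> 'a measure" where
  "avg n \<equiv> weighted_sum {..<n} (\<lambda>_. 1 / real n)"

lemma empirical_eq_avg:
  assumes "0 < n"
  shows "empirical n x = avg n (\<lambda>i. return borel (x i))"
proof -
  have "a / of_nat n = ennreal (1 / real n) * a" for a
    using assms by (simp add: divide_ennreal_def ennreal_of_nat_eq_real_of_nat inverse_ennreal inverse_eq_divide mult.commute)
  then show ?thesis
    unfolding empirical_def weighted_sum_def by (simp add: sum_distrib_left)
qed

lemma mixture_eq_weighted_sum:
  "mixture t \<mu> \<nu> = weighted_sum UNIV (\<lambda>b. if b then t else 1 - t) (\<lambda>b. if b then \<mu> else \<nu>)"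
  unfolding mixture_def weighted_sum_def by (simp add: UNIV_bool add.commute)

lemma avg_Suc_eq_mixture:
  assumes "0 < n" "\<And>i. i \<le> n \<Longrightarrow> sets (M i) = sets borel"
  shows "avg (Suc n) M = mixture (1 / real (Suc n)) (M n) (avg n M)"
proof (rule measure_eqI)
  fix A assume "A \<in> sets (avg (Suc n) M)"
  then have A: "A \<in> sets borel" by simp
  have s: "sets (if b then M n else avg n M) = sets borel" for b
    using assms(2) by simp
  have c: "ennreal (1 / real (Suc n)) = ennreal (1 - 1 / real (Suc n)) * ennreal (1 / real n)"
    using assms(1) by (subst ennreal_mult[symmetric]) (auto simp: field_simps)
  have "emeasure (mixture (1 / real (Suc n)) (M n) (avg n M)) A =
     ennreal (1 / real (Suc n)) * emeasure (M n) A + ennreal (1 - 1 / real (Suc n)) * emeasure (avg n M) A"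
    unfolding mixture_eq_weighted_sum by (subst emeasure_weighted_sum[OF s A]) (simp add: UNIV_bool add.commute)
  also have "emeasure (avg n M) A = (\<Sum>i<n. ennreal (1 / real n) * emeasure (M i) A)"
    using assms(2) A by (intro emeasure_weighted_sum) auto
  also have "ennreal (1 - 1 / real (Suc n)) * \<dots> = (\<Sum>i<n. ennreal (1 / real (Suc n)) * emeasure (M i) A)"
    unfolding c by (simp add: sum_distrib_left mult.assoc)
  also have "ennreal (1 / real (Suc n)) * emeasure (M n) A + \<dots> = emeasure (avg (Suc n) M) A"
    using assms(2) A by (subst emeasure_weighted_sum) (auto simp: add.commute)
  finally show "emeasure (avg (Suc n) M) A = emeasure (mixture (1 / real (Suc n)) (M n) (avg n M)) A" ..
qed (simp add: mixture_eq_weighted_sum)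

lemma avg_in_probs:
  assumes "0 < n" "\<And>i. i < n \<Longrightarrow> M i \<in> probs" shows "avg n M \<in> probs"
  using assms by (intro weighted_sum_in_probs) auto

section \<open>Convex rate functions\<close>

locale convex_rate =
  fixes \<alpha> :: "'a::polish_space measure \<Rightarrow> ereal"
  assumes not_minus_inf: "\<And>\<nu>. \<nu> \<in> probs \<Longrightarrow> \<alpha> \<nu> \<noteq> -\<infinity>"
    and proper: "\<exists>\<nu>\<in>probs. \<alpha> \<nu> \<noteq> \<infinity>"
    and convex: "convex_on_probs \<alpha>"
    and compact_sublevel: "\<And>c::real. compactin weak_topology {\<nu> \<in> probs. \<alpha> \<nu> \<le> ereal c}"
begin

lemma openin_superlevel: "openin weak_topology {\<nu> \<in> probs. ereal c < \<alpha> \<nu>}"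
proof -
  have "closedin weak_topology {\<nu> \<in> probs. \<alpha> \<nu> \<le> ereal c}"
    by (rule compactin_imp_closedin[OF Hausdorff_weak compact_sublevel])
  then have "openin weak_topology (topspace weak_topology - {\<nu> \<in> probs. \<alpha> \<nu> \<le> ereal c})" by blast
  moreover have "topspace weak_topology - {\<nu> \<in> probs. \<alpha> \<nu> \<le> ereal c} = {\<nu> \<in> probs. ereal c < \<alpha> \<nu>}"
    by (auto simp: topspace_weak)
  ultimately show ?thesis by simp
qed

text \<open>
  The increasing open sets \<open>{\<alpha> > -m}\<close> cover all probability measures, as \<open>\<alpha>\<close> never takes the value
  \<open>-\<infinity>\<close>. Finitely many of them, hence one, cover the compact set \<open>{\<alpha> \<le> 0}\<close>.
\<close>

lemma bounded_below: obtains a where "\<And>\<nu>. \<nu> \<in> probs \<Longrightarrow> ereal a \<le> \<alpha> \<nu>"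
proof -
  define U where "U m = {\<nu> \<in> probs. ereal (- real m) < \<alpha> \<nu>}" for m :: nat
  have cover: "\<nu> \<in> (\<Union>m. U m)" if "\<nu> \<in> probs" for \<nu>
  proof (cases "\<alpha> \<nu>")
    case (real r)
    obtain m :: nat where "- r < real m" using reals_Archimedean2 by blast
    then show ?thesis using that real by (auto simp: U_def intro!: exI[of _ m])
  qed (use that not_minus_inf in \<open>auto simp: U_def\<close>)
  have op: "openin weak_topology V" if "V \<in> range U" for V
    using that openin_superlevel unfolding U_def by blast
  have sub: "{\<nu> \<in> probs. \<alpha> \<nu> \<le> ereal 0} \<subseteq> \<Union>(range U)"
    using cover by blast
  have "\<exists>\<F>. finite \<F> \<and> \<F> \<subseteq> range U \<and> {\<nu> \<in> probs. \<alpha> \<nu> \<le> ereal 0} \<subseteq> \<Union>\<F>"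
    by (rule compactinD[OF compact_sublevel[of 0] op sub])
  then obtain \<F> where \<F>: "finite \<F>" "\<F> \<subseteq> range U" "{\<nu> \<in> probs. \<alpha> \<nu> \<le> ereal 0} \<subseteq> \<Union>\<F>" by blast
  obtain N where "finite N" "\<F> = U ` N" using finite_subset_image[OF \<F>(1,2)] by blast
  with \<F>(3) have N: "finite N" "{\<nu> \<in> probs. \<alpha> \<nu> \<le> ereal 0} \<subseteq> (\<Union>m\<in>N. U m)" by auto
  obtain b where b: "\<And>m. m \<in> N \<Longrightarrow> m \<le> b" using N(1) finite_nat_set_iff_bounded_le by auto
  have "ereal (- real b) \<le> \<alpha> \<nu>" if \<nu>: "\<nu> \<in> probs" for \<nu>
  proof (cases "\<alpha> \<nu> \<le> 0")
    case True
    then obtain m where "m \<in> N" "\<nu> \<in> U m" using N(2) \<nu> by (auto simp: zero_ereal_def)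
    then have "ereal (- real b) \<le> ereal (- real m)" "ereal (- real m) < \<alpha> \<nu>"
      using b by (auto simp: U_def)
    then show ?thesis by (meson less_imp_le order.trans)
  next
    case False
    have "ereal (- real b) \<le> 0" by (simp add: zero_ereal_def)
    with False show ?thesis by (meson linear order.trans)
  qed
  then show thesis by (rule that)
qed

lemma mixture_le:
  assumes "\<mu> \<in> probs" "\<nu> \<in> probs" "0 < t" "t < 1" "\<alpha> \<mu> \<le> ereal a" "\<alpha> \<nu> \<le> ereal b"
  shows "\<alpha> (mixture t \<mu> \<nu>) \<le> ereal (t * a + (1 - t) * b)"
proof -
  have "\<alpha> (mixture t \<mu> \<nu>) \<le> ereal t * \<alpha> \<mu> + ereal (1 - t) * \<alpha> \<nu>"
    using convex assms unfolding convex_on_probs_def by auto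
  also have "\<dots> \<le> ereal t * ereal a + ereal (1 - t) * ereal b"
    using assms by (intro add_mono ereal_mult_left_mono) auto
  finally show ?thesis by simp
qed

text \<open>
  Jensen's inequality for the uniform weights, by adding one measure at a time with weight
  \<open>1 / (n + 1)\<close>.
\<close>

lemma avg_le:
  assumes "0 < n" "\<And>i. i < n \<Longrightarrow> M i \<in> probs" "\<And>i. i < n \<Longrightarrow> \<alpha> (M i) \<le> ereal (a i)"
  shows "\<alpha> (avg n M) \<le> ereal ((\<Sum>i<n. a i) / real n)"
  using assms
proof (induction n rule: nat_induct_non_zero)
  case 1
  have "avg 1 M = M 0"
  proof (rule measure_eqI)
    have M: "sets (M 0) = sets borel" using 1(1)[of 0] by (simp add: probs_iff)
    then show "sets (avg 1 M) = sets (M 0)" by simp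
    fix A assume "A \<in> sets (avg 1 M)"
    then show "emeasure (avg 1 M) A = emeasure (M 0) A"
      using M by (subst emeasure_weighted_sum) auto
  qed
  with 1(2)[of 0] show ?case by simp
next
  case (Suc n)
  have "\<alpha> (avg (Suc n) M) = \<alpha> (mixture (1 / real (Suc n)) (M n) (avg n M))"
    using Suc.prems(1) Suc.hyps by (subst avg_Suc_eq_mixture) (auto simp: probs_iff less_Suc_eq_le)
  also have "\<dots> \<le> ereal (1 / real (Suc n) * a n + (1 - 1 / real (Suc n)) * ((\<Sum>i<n. a i) / real n))"
    using Suc by (intro mixture_le avg_in_probs) auto
  also have "1 / real (Suc n) * a n + (1 - 1 / real (Suc n)) * ((\<Sum>i<n. a i) / real n) = (\<Sum>i<Suc n. a i) / real (Suc n)"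
  proof -
    have "1 - 1 / real (Suc n) = real n / real (Suc n)" by (simp add: field_simps)
    then show ?thesis using Suc.hyps by (simp add: add_divide_distrib)
  qed
  finally show ?case .
qed

end

section \<open>Uniform integrability of \<open>\<psi>\<close> on sublevel sets\<close>

lemma continuous_imp_measurable_probs:
  assumes "continuous_on UNIV f" "\<nu> \<in> probs" shows "f \<in> borel_measurable \<nu>"
  using borel_measurable_continuous_onI[OF assms(1)] assms(2) by (simp add: probs_iff cong: measurable_cong_sets)

locale psi_growth =
  fixes \<psi> :: "'a::polish_space \<Rightarrow> real"
  assumes psi_cont: "continuous_on UNIV \<psi>" and psi_nonneg: "\<And>x. 0 \<le> \<psi> x"
begin

lemma topspace_psi: "topspace (psi_weak_topology \<psi>) = probs_psi \<psi>"
  using psi_nonneg by (intro topspace_psi_weak) simp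

lemma psi_integrable: "\<nu> \<in> probs_psi \<psi> \<Longrightarrow> integrable \<nu> \<psi>"
  unfolding probs_psi_def using psi_nonneg continuous_imp_measurable_probs[OF psi_cont]
  by (auto simp: integrable_iff_bounded)

lemma dominated_integrable:
  assumes "\<nu> \<in> probs_psi \<psi>" "continuous_on UNIV f" "\<And>x. \<bar>f x\<bar> \<le> 1 + \<psi> x"
  shows "integrable \<nu> f"
proof (rule Bochner_Integration.integrable_bound[where f = "\<lambda>x. 1 + \<psi> x"])
  have n: "\<nu> \<in> probs" using assms(1) probs_psi_subset by blast
  then interpret prob_space \<nu> by (simp add: probs_iff)
  show "integrable \<nu> (\<lambda>x. 1 + \<psi> x)" using psi_integrable[OF assms(1)] by simp
  show "f \<in> borel_measurable \<nu>" by (rule continuous_imp_measurable_probs[OF assms(2) n])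
  show "AE x in \<nu>. norm (f x) \<le> norm (1 + \<psi> x)"
    using assms(3) psi_nonneg by (auto simp: add_nonneg_nonneg)
qed

text \<open>
  The part of \<open>\<psi>\<close> above height \<open>R\<close>. It is itself a test function of the \<open>\<psi>\<close>-weak topology, which is
  what makes compactness applicable to it.
\<close>

definition excess :: "nat \<Rightarrow> 'a \<Rightarrow> real" where
  "excess R x = max 0 (\<psi> x - real R)"

abbreviation excess_integral :: "nat \<Rightarrow> 'a measure \<Rightarrow> ennreal" where
  "excess_integral R \<nu> \<equiv> \<integral>\<^sup>+x. ennreal (excess R x) \<partial>\<nu>"

lemma excess_cont: "continuous_on UNIV (excess R)"
  unfolding excess_def using psi_cont by (intro continuous_intros) auto

lemma excess_measurable [measurable]: "excess R \<in> borel_measurable borel"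
  by (rule borel_measurable_continuous_onI[OF excess_cont])

lemma excess_nonneg: "0 \<le> excess R x"
  by (simp add: excess_def)

lemma excess_le: "\<bar>excess R x\<bar> \<le> 1 + \<psi> x"
  using psi_nonneg[of x] by (auto simp: excess_def)

lemma excess_antimono: "R \<le> S \<Longrightarrow> excess S x \<le> excess R x"
  by (auto simp: excess_def max_def)

lemma integral_excess_tendsto_0:
  assumes \<nu>: "\<nu> \<in> probs_psi \<psi>"
  shows "(\<lambda>R. \<integral>x. excess R x \<partial>\<nu>) \<longlonglongrightarrow> 0"
proof -
  have n: "\<nu> \<in> probs" using \<nu> probs_psi_subset by blast
  have "(\<lambda>R. \<integral>x. excess R x \<partial>\<nu>) \<longlonglongrightarrow> (\<integral>x. 0 \<partial>\<nu>)"
  proof (rule integral_dominated_convergence[where w = \<psi>])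
    show "integrable \<nu> \<psi>" by (rule psi_integrable[OF \<nu>])
    show "(\<lambda>x. excess R x) \<in> borel_measurable \<nu>" for R
      by (rule continuous_imp_measurable_probs[OF excess_cont n])
    show "AE x in \<nu>. (\<lambda>R. excess R x) \<longlonglongrightarrow> 0"
    proof (rule AE_I2)
      fix x
      obtain m :: nat where "\<psi> x < real m" using reals_Archimedean2 by blast
      then have "excess R x = 0" if "R \<ge> m" for R using that by (simp add: excess_def)
      then show "(\<lambda>R. excess R x) \<longlonglongrightarrow> 0"
        by (intro tendsto_eventually eventually_sequentiallyI[of m]) auto
    qed
    show "AE x in \<nu>. norm (excess R x) \<le> \<psi> x" for R
      using psi_nonneg by (auto simp: excess_def)
  qed simp
  then show ?thesis by simp
qed

text \<open>
  Dini's argument: the continuous functionals \<open>\<mu> \<mapsto> \<integral>(\<psi> - R)\<^sup>+ d\<mu>\<close> decrease to 0 as \<open>R\<close> grows, hence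
  uniformly on compact sets.
\<close>

lemma compact_uniformly_integrable:
  assumes K: "compactin (psi_weak_topology \<psi>) K" and d: "0 < d"
  obtains R where "\<And>\<mu>. \<mu> \<in> K \<Longrightarrow> (\<integral>x. excess R x \<partial>\<mu>) < d"
proof -
  define U where "U R = {\<mu> \<in> probs_psi \<psi>. (\<integral>x. excess R x \<partial>\<mu>) \<in> {..<d}}" for R
  have op: "openin (psi_weak_topology \<psi>) V" if V: "V \<in> range U" for V
  proof -
    obtain R where "V = U R" using V by blast
    moreover have "openin (psi_weak_topology \<psi>) (U R)"
      unfolding U_def psi_weak_topology_def
      by (rule openin_integral_topology_basic) (use excess_cont excess_le in auto)
    ultimately show ?thesis by simp
  qed
  have KP: "K \<subseteq> probs_psi \<psi>" using compactin_subset_topspace[OF K] topspace_psi by simp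
  have sub: "K \<subseteq> \<Union>(range U)"
  proof
    fix \<mu> assume "\<mu> \<in> K"
    then have m: "\<mu> \<in> probs_psi \<psi>" using KP by blast
    have "\<forall>\<^sub>F R in sequentially. (\<integral>x. excess R x \<partial>\<mu>) < d"
      using integral_excess_tendsto_0[OF m] d by (rule order_tendstoD)
    then obtain R where "(\<integral>x. excess R x \<partial>\<mu>) < d" using eventually_sequentially by auto
    then show "\<mu> \<in> \<Union>(range U)" using m by (auto simp: U_def)
  qed
  have "\<exists>\<F>. finite \<F> \<and> \<F> \<subseteq> range U \<and> K \<subseteq> \<Union>\<F>"
    by (rule compactinD[OF K op sub])
  then obtain \<F> where \<F>: "finite \<F>" "\<F> \<subseteq> range U" "K \<subseteq> \<Union>\<F>" by blast
  obtain N where "finite N" "\<F> = U ` N" using finite_subset_image[OF \<F>(1,2)] by blast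
  with \<F>(3) have N: "finite N" "K \<subseteq> (\<Union>m\<in>N. U m)" by auto
  obtain b where b: "\<And>m. m \<in> N \<Longrightarrow> m \<le> b" using N(1) finite_nat_set_iff_bounded_le by auto
  have "(\<integral>x. excess b x \<partial>\<mu>) < d" if "\<mu> \<in> K" for \<mu>
  proof -
    obtain m where m: "m \<in> N" "\<mu> \<in> probs_psi \<psi>" "(\<integral>x. excess m x \<partial>\<mu>) < d"
      using N(2) \<open>\<mu> \<in> K\<close> by (auto simp: U_def)
    have "(\<integral>x. excess b x \<partial>\<mu>) \<le> (\<integral>x. excess m x \<partial>\<mu>)"
      using m(2) b[OF m(1)]
      by (intro integral_mono dominated_integrable excess_cont excess_le excess_antimono)
    with m(3) show ?thesis by simp
  qed
  then show thesis by (rule that)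
qed

end

text \<open>
  The additional hypothesis of the upper bound.
\<close>

locale psi_compact_rate = convex_rate \<alpha> + psi_growth \<psi> for \<alpha> :: "'a::polish_space measure \<Rightarrow> ereal" and \<psi> :: "'a \<Rightarrow> real" +
  assumes precompact_sublevel: "\<And>c::real. precompact_in (psi_weak_topology \<psi>) {\<nu> \<in> probs. \<alpha> \<nu> \<le> ereal c}"
begin

lemma finite_rate_in_probs_psi:
  assumes "\<nu> \<in> probs" "\<alpha> \<nu> \<le> ereal c" shows "\<nu> \<in> probs_psi \<psi>"
  using precompact_sublevel[of c] assms unfolding precompact_in_def topspace_psi by blast

lemma compact_sublevel_psi: "compactin (psi_weak_topology \<psi>) {\<nu> \<in> probs. \<alpha> \<nu> \<le> ereal c}"
proof -
  let ?S = "{\<nu> \<in> probs. \<alpha> \<nu> \<le> ereal c}"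
  have "openin (psi_weak_topology \<psi>) ({\<nu> \<in> probs. ereal c < \<alpha> \<nu>} \<inter> probs_psi \<psi>)"
    using psi_nonneg by (intro openin_weak_imp_psi_weak openin_superlevel) simp
  moreover have "{\<nu> \<in> probs. ereal c < \<alpha> \<nu>} \<inter> probs_psi \<psi> = topspace (psi_weak_topology \<psi>) - ?S"
    using probs_psi_subset by (auto simp: topspace_psi)
  ultimately have "closedin (psi_weak_topology \<psi>) ?S"
    using finite_rate_in_probs_psi by (auto simp: closedin_def topspace_psi)
  then have "(psi_weak_topology \<psi>) closure_of ?S = ?S" by (simp add: closure_of_closedin)
  then show ?thesis using precompact_sublevel[of c] by (simp add: precompact_in_def)
qed

text \<open>
  Mixing \<open>\<kappa>\<close> into a measure of finite rate with weight \<open>t\<close> of order \<open>1 / \<alpha>(\<kappa>)\<close> lands in a fixed sublevel set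
  by convexity. There the excess is uniformly small, and undoing the mixture costs the factor
  \<open>1 / t\<close>, which is linear in \<open>\<alpha>(\<kappa>)\<close>.
\<close>

lemma excess_integral_le_rate:
  assumes a0: "\<And>\<nu>. \<nu> \<in> probs \<Longrightarrow> ereal a0 \<le> \<alpha> \<nu>" and d: "0 < d"
  obtains R where "\<And>\<kappa> a. \<kappa> \<in> probs \<Longrightarrow> \<alpha> \<kappa> \<le> ereal a \<Longrightarrow> excess_integral R \<kappa> \<le> ennreal (d * (1 + a - a0))"
proof -
  obtain \<mu>0 where \<mu>0: "\<mu>0 \<in> probs" "\<alpha> \<mu>0 \<noteq> \<infinity>" using proper by blast
  then obtain a1 where a1: "\<alpha> \<mu>0 = ereal a1" using not_minus_inf by (cases "\<alpha> \<mu>0") auto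
  have a1_ge: "a0 \<le> a1" using a0[OF \<mu>0(1)] a1 by simp
  obtain R where R: "\<And>\<mu>. \<mu> \<in> {\<nu> \<in> probs. \<alpha> \<nu> \<le> ereal (1 + a1)} \<Longrightarrow> (\<integral>x. excess R x \<partial>\<mu>) < d / 2"
    by (rule compact_uniformly_integrable[OF compact_sublevel_psi[of "1 + a1"] half_gt_zero[OF d]]) blast
  show thesis
  proof (rule that)
    fix \<kappa> a assume \<kappa>: "\<kappa> \<in> probs" "\<alpha> \<kappa> \<le> ereal a"
    have a: "a0 \<le> a" using a0[OF \<kappa>(1)] \<kappa>(2) by (meson ereal_less_eq(3) order_trans)
    \<comment> \<open>The 2 keeps \<open>t\<close> below 1 even when \<open>a = a0\<close>; then \<open>t * (a -
      a0) \<le> 1\<close> puts the mixture into the sublevel set at height \<open>1 + a1\<close>.\<close>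
    define t where "t = 1 / (2 + a - a0)"
    have t: "0 < t" "t < 1" using a by (auto simp: t_def)
    let ?\<nu> = "mixture t \<kappa> \<mu>0"
    have \<nu>P: "?\<nu> \<in> probs"
      unfolding mixture_eq_weighted_sum using t \<kappa>(1) \<mu>0(1)
      by (intro weighted_sum_in_probs) (auto simp: UNIV_bool)
    have "\<alpha> ?\<nu> \<le> ereal (t * a + (1 - t) * a1)"
      using \<kappa> \<mu>0 t a1 by (intro mixture_le) auto
    also have "t * a + (1 - t) * a1 = t * (a - a0) + t * a0 + (1 - t) * a1" by (simp add: algebra_simps)
    also have "\<dots> \<le> 1 + t * a1 + (1 - t) * a1"
      using a t a1_ge by (intro add_mono mult_left_mono) (auto simp: t_def)
    also have "\<dots> = 1 + a1" by (simp add: algebra_simps)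
    finally have \<nu>: "\<alpha> ?\<nu> \<le> ereal (1 + a1)" by simp
    have \<nu>psi: "?\<nu> \<in> probs_psi \<psi>" by (rule finite_rate_in_probs_psi[OF \<nu>P \<nu>])
    have "excess_integral R ?\<nu> = ennreal (\<integral>x. excess R x \<partial>?\<nu>)"
      by (intro nn_integral_eq_integral dominated_integrable[OF \<nu>psi excess_cont excess_le]) (simp add: excess_nonneg)
    also have "\<dots> \<le> ennreal (d / 2)"
      using R[of ?\<nu>] \<nu> \<nu>P by (intro ennreal_leI) auto
    finally have 1: "excess_integral R ?\<nu> \<le> ennreal (d / 2)" .
    have split: "excess_integral R ?\<nu> =
        ennreal t * excess_integral R \<kappa> + ennreal (1 - t) * excess_integral R \<mu>0"
      unfolding mixture_eq_weighted_sum using \<kappa>(1) \<mu>0(1)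
      by (subst nn_integral_weighted_sum) (auto simp: UNIV_bool probs_iff add.commute)
    have "ennreal t * excess_integral R \<kappa> \<le>
        ennreal t * excess_integral R \<kappa> + ennreal (1 - t) * excess_integral R \<mu>0"
      by simp
    also have "\<dots> \<le> ennreal (d / 2)" using 1 split by simp
    finally have 2: "ennreal t * excess_integral R \<kappa> \<le> ennreal (d / 2)" .
    have "excess_integral R \<kappa> = ennreal (1 / t) * (ennreal t * excess_integral R \<kappa>)"
      using t by (simp add: mult.assoc[symmetric] ennreal_mult[symmetric])
    also have "\<dots> \<le> ennreal (1 / t) * ennreal (d / 2)" using 2 by (intro mult_left_mono) auto
    also have "\<dots> = ennreal (1 / t * (d / 2))" using t d by (subst ennreal_mult) auto
    also have "\<dots> \<le> ennreal (d * (1 + a - a0))"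
      using a d by (intro ennreal_leI) (simp add: t_def field_simps)
    finally show "excess_integral R \<kappa> \<le> ennreal (d * (1 + a - a0))" .
  qed
qed

end

section \<open>Encoding a Polish space in the real line\<close>

text \<open>
  At the first digit where two expansions differ they are apart by \<open>3\<^sup>-\<^sup>n\<close>, while all later digits
  together contribute at most half of that. Base 2 would not suffice.
\<close>

lemma ternary_expansion_unique:
  fixes a b :: "nat \<Rightarrow> real"
  assumes a: "\<And>k. a k \<in> {0, 1}" and b: "\<And>k. b k \<in> {0, 1}"
    and eq: "(\<Sum>k. (1/3)^k * a k) = (\<Sum>k. (1/3)^k * b k)"
  shows "a = b"
proof (rule ccontr)
  assume "a \<noteq> b"
  then have ex: "\<exists>k. a k \<noteq> b k" by auto
  define n where "n = (LEAST k. a k \<noteq> b k)"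
  have n: "a n \<noteq> b n" unfolding n_def using ex by (rule LeastI_ex)
  have below: "a k = b k" if "k < n" for k
    using not_less_Least[of k "\<lambda>k. a k \<noteq> b k"] that by (auto simp: n_def)
  define c where "c k = (1/3)^k * (a k - b k)" for k
  have geo: "summable (\<lambda>k. (1/3::real)^k)" by (rule summable_geometric) simp
  have bd: "\<bar>c k\<bar> \<le> (1/3)^k" for k
    using a[of k] b[of k] by (auto simp: c_def)
  have sa: "summable (\<lambda>k. (1/3)^k * a k)"
  proof (rule summable_comparison_test'[OF geo])
    show "norm ((1/3)^k * a k) \<le> (1/3)^k" for k using a[of k] by auto
  qed
  have sb: "summable (\<lambda>k. (1/3)^k * b k)"
  proof (rule summable_comparison_test'[OF geo])
    show "norm ((1/3)^k * b k) \<le> (1/3)^k" for k using b[of k] by auto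
  qed
  have sc: "summable c"
    unfolding c_def right_diff_distrib by (rule summable_diff[OF sa sb])
  have "suminf c = 0"
    unfolding c_def right_diff_distrib using suminf_diff[OF sa sb] eq by simp
  moreover have "suminf c = (\<Sum>k. c (k + Suc n)) + sum c {..<Suc n}"
    by (rule suminf_split_initial_segment[OF sc])
  moreover have "sum c {..<Suc n} = c n"
    using below by (simp add: c_def)
  ultimately have tail: "\<bar>\<Sum>k. c (k + Suc n)\<bar> = \<bar>c n\<bar>" by simp
  have sn: "\<bar>c n\<bar> = (1/3)^n"
    using a[of n] b[of n] n by (auto simp: c_def)
  have geo': "summable (\<lambda>k. (1/3::real)^(k + Suc n))" by (rule summable_ignore_initial_segment[OF geo])
  have "\<bar>\<Sum>k. c (k + Suc n)\<bar> \<le> (\<Sum>k. (1/3)^(k + Suc n))"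
    using norm_suminf_le[of "\<lambda>k. c (k + Suc n)", OF _ geo'] bd unfolding real_norm_def by blast
  also have "\<dots> = (\<Sum>k. (1/3)^k) * (1/3)^Suc n"
    using suminf_mult2[OF geo, of "(1/3)^Suc n"] by (simp add: power_add mult.assoc)
  also have "\<dots> = (1/3)^n / 2"
    by (subst suminf_geometric) auto
  finally show False using tail sn by simp
qed

lemma borel_measurable_indicator_sum:
  fixes U :: "nat \<Rightarrow> 'a::topological_space set"
  assumes "\<And>n. open (U n)"
  shows "(\<lambda>x. \<Sum>n. (1/3)^n * indicator (U n) x :: real) \<in> borel_measurable borel"
  using assms by (intro borel_measurable_suminf borel_measurable_times borel_measurable_indicator) auto

lemma finite_borel_inner_compact:
  fixes M :: "'a::polish_space measure"
  assumes M: "sets M = sets borel" "finite_measure M" and B: "B \<in> sets borel" and e: "0 < (e::real)"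
  obtains K where "compact K" "K \<subseteq> B" "emeasure M (B - K) \<le> ennreal e"
proof -
  interpret finite_measure M by fact
  have eq: "emeasure M B = (SUP K \<in> {K. K \<subseteq> B \<and> compact K}. emeasure M K)"
    by (rule inner_regular[OF M(1) _ B]) simp
  have "\<exists>K\<in>{K. K \<subseteq> B \<and> compact K}. emeasure M B < emeasure M K + ennreal e"
    using e by (intro SUP_approx_ennreal[OF _ _ eq]) (auto intro!: exI[of _ "{}"])
  then obtain K where K: "compact K" "K \<subseteq> B" "emeasure M B < emeasure M K + ennreal e" by auto
  have sK: "K \<in> sets M" "B \<in> sets M" using K(1) B by (auto simp: M(1) compact_imp_closed)
  have "emeasure M (B - K) = emeasure M B - emeasure M K"
    using sK K(2) by (intro emeasure_Diff) auto
  also have "\<dots> \<le> ennreal e"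
    using K(3) by (simp add: ennreal_minus_le_iff less_imp_le add.commute)
  finally show thesis using K that by blast
qed

text \<open>
  For each \<open>n\<close> choose compact sets \<open>A n\<close> and \<open>B n\<close> inside \<open>U n\<close> and its complement that lose little
  mass. On the intersection of the sets \<open>A n \<union> B n\<close> each \<open>U n\<close> is relatively clopen.
\<close>

lemma compact_separating_set:
  fixes M :: "'a::polish_space measure" and U :: "nat \<Rightarrow> 'a set"
  assumes M: "sets M = sets borel" "finite_measure M" and U: "\<And>n. open (U n)" and e: "0 < (e::real)"
  obtains K where "compact K" "emeasure M (- K) \<le> ennreal e" "\<And>n. continuous_on K (indicator (U n) :: 'a \<Rightarrow> real)"
proof -
  \<comment> \<open>The losses inside \<open>U n\<close> and inside its complement add up to \<open>e / 2^(n +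
    1)\<close>, with sum \<open>e\<close>.\<close>
  define d where "d n = e * (1/2)^Suc (Suc n)" for n
  have d: "0 < d n" for n using e by (simp add: d_def)
  have "\<exists>A. compact A \<and> A \<subseteq> U n \<and> emeasure M (U n - A) \<le> ennreal (d n)" for n
    using finite_borel_inner_compact[OF M, of "U n" "d n"] d U by (metis borel_open)
  then obtain A where A: "\<And>n. compact (A n)" "\<And>n. A n \<subseteq> U n" "\<And>n. emeasure M (U n - A n) \<le> ennreal (d n)"
    by metis
  have "\<exists>B. compact B \<and> B \<subseteq> - U n \<and> emeasure M (- U n - B) \<le> ennreal (d n)" for n
    using finite_borel_inner_compact[OF M, of "- U n" "d n"] d U by (metis borel_open borel_comp)
  then obtain B where B: "\<And>n. compact (B n)" "\<And>n. B n \<subseteq> - U n" "\<And>n. emeasure M (- U n - B n) \<le> ennreal (d n)"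
    by metis
  define K where "K = (\<Inter>n. A n \<union> B n)"
  have cl: "closed (A n)" "closed (B n)" for n using A(1) B(1) by (auto intro: compact_imp_closed)
  have sets: "A n \<in> sets M" "B n \<in> sets M" "U n \<in> sets M" for n
    using cl U by (auto simp: M(1))
  have "closed K" unfolding K_def using cl by (intro closed_INT) auto
  moreover have "K = (A 0 \<union> B 0) \<inter> K" by (auto simp: K_def)
  ultimately have "compact K" using A(1) B(1) by (metis compact_Int_closed compact_Un)
  moreover have "emeasure M (- K) \<le> ennreal e"
  proof -
    have "- K = (\<Union>n. (U n - A n) \<union> (- U n - B n))"
      using A(2) B(2) by (fastforce simp: K_def)
    then have "emeasure M (- K) = emeasure M (\<Union>n. (U n - A n) \<union> (- U n - B n))" by simp
    also have "\<dots> \<le> (\<Sum>n. emeasure M ((U n - A n) \<union> (- U n - B n)))"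
      using sets U cl by (intro emeasure_subadditive_countably) (auto simp: M(1))
    also have "\<dots> \<le> (\<Sum>n. ennreal (e * (1/2)^Suc n))"
    proof (rule suminf_le)
      fix n
      have "emeasure M ((U n - A n) \<union> (- U n - B n)) \<le> emeasure M (U n - A n) + emeasure M (- U n - B n)"
        using U cl by (intro emeasure_subadditive) (auto simp: M(1))
      also have "\<dots> \<le> ennreal (d n) + ennreal (d n)" using A(3) B(3) by (intro add_mono) auto
      also have "\<dots> = ennreal (e * (1/2)^Suc n)" using d[of n] e by (simp add: d_def flip: ennreal_plus)
      finally show "emeasure M ((U n - A n) \<union> (- U n - B n)) \<le> ennreal (e * (1/2)^Suc n)" .
    qed auto
    also have "\<dots> = ennreal e"
    proof (rule suminf_ennreal_eq)
      show "(\<lambda>n. e * (1/2)^Suc n) sums e" using sums_mult[OF power_half_series, of e] by simp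
    qed (use e in auto)
    finally show ?thesis .
  qed
  moreover have "continuous_on K (indicator (U n) :: 'a \<Rightarrow> real)" for n
  proof (rule continuous_on_subset)
    have a: "continuous_on (A n) (indicator (U n) :: 'a \<Rightarrow> real)"
      by (rule continuous_on_eq[of _ "\<lambda>_. 1"]) (use A(2)[of n] in auto)
    have b: "continuous_on (B n) (indicator (U n) :: 'a \<Rightarrow> real)"
      by (rule continuous_on_eq[of _ "\<lambda>_. 0"]) (use B(2)[of n] in auto)
    show "continuous_on (A n \<union> B n) (indicator (U n) :: 'a \<Rightarrow> real)"
      by (rule continuous_on_closed_Un[OF cl a b])
  qed (auto simp: K_def)
  ultimately show thesis using that by blast
qed

text \<open>
  The ternary expansion \<open>f\<close> whose digits are the indicators of a countable basis is injective and
  Borel. It is continuous on compact sets of nearly full measure, so it maps closed subsets of their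
  union to countable unions of compact sets, which makes the inverse \<open>g\<close> Borel.
\<close>

lemma polish_measure_real_encoding:
  fixes M :: "'a::polish_space measure"
  assumes M: "sets M = sets borel" "finite_measure M"
  obtains f :: "'a \<Rightarrow> real" and g :: "real \<Rightarrow> 'a"
  where "f \<in> borel_measurable borel" "g \<in> borel_measurable borel" "\<And>x. 0 \<le> f x \<and> f x < 2" "AE x in M. g (f x) = x"
proof -
  obtain \<B> :: "'a set set" where \<B>: "countable \<B>" "topological_basis \<B>" using ex_countable_basis by blast
  have ne: "\<B> \<noteq> {}" using topological_basisE[OF \<B>(2) open_UNIV, of undefined] by blast
  define U where "U = from_nat_into \<B>"
  have ran: "range U = \<B>" unfolding U_def by (rule range_from_nat_into[OF ne \<B>(1)])
  have U: "open (U n)" for n using topological_basis_open[OF \<B>(2)] ran by blast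
  define f where "f x = (\<Sum>n. (1/3)^n * indicator (U n) x :: real)" for x
  have fm: "f \<in> borel_measurable borel" unfolding f_def by (rule borel_measurable_indicator_sum[OF U])
  have geo: "summable (\<lambda>k. (1/3::real)^k)" by (rule summable_geometric) simp
  have bd: "norm ((1/3)^n * indicator (U n) x :: real) \<le> (1/3)^n" for n x by (simp add: indicator_def)
  have summ: "summable (\<lambda>n. (1/3)^n * indicator (U n) x :: real)" for x
    by (rule summable_comparison_test'[OF geo, of 0]) (rule bd)
  have f_range: "0 \<le> f x \<and> f x < 2" for x
  proof
    show "0 \<le> f x" unfolding f_def by (rule suminf_nonneg[OF summ]) simp
    have "f x \<le> (\<Sum>n. (1/3::real)^n)" unfolding f_def
      by (rule suminf_le[OF _ summ geo]) (simp add: indicator_def)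
    also have "\<dots> = 3/2" by (subst suminf_geometric) auto
    finally show "f x < 2" by simp
  qed
  have inj: "x = y" if "f x = f y" for x y
  proof (rule ccontr)
    assume "x \<noteq> y"
    then obtain V where V: "open V" "x \<in> V" "y \<notin> V" using t1_space by blast
    obtain W where W: "W \<in> \<B>" "x \<in> W" "W \<subseteq> V" using topological_basisE[OF \<B>(2) V(1,2)] by blast
    obtain n where n: "W = U n" using W(1) ran by blast
    have "(\<lambda>n. indicator (U n) x :: real) = (\<lambda>n. indicator (U n) y)"
      by (rule ternary_expansion_unique) (use that in \<open>auto simp: f_def indicator_def\<close>)
    from fun_cong[OF this, of n] W V n show False by (auto simp: indicator_def split: if_splits)
  qed
  have "\<exists>K. compact K \<and> emeasure M (- K) \<le> ennreal (1 / real (Suc m)) \<and> (\<forall>n. continuous_on K (indicator (U n) :: 'a \<Rightarrow> real))" for m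
    by (rule compact_separating_set[of M U "1 / real (Suc m)", OF M U]) auto
  then obtain K where K: "\<And>m. compact (K m)" "\<And>m. emeasure M (- K m) \<le> ennreal (1 / real (Suc m))"
    "\<And>m n. continuous_on (K m) (indicator (U n) :: 'a \<Rightarrow> real)"
    by metis
  have f_cont: "continuous_on (K m) f" for m
  proof (rule uniform_limit_theorem[OF always_eventually])
    show "uniform_limit (K m) (\<lambda>n x. \<Sum>i<n. (1/3)^i * indicator (U i) x :: real) f sequentially"
      unfolding f_def by (rule Weierstrass_m_test[OF bd geo])
    show "\<forall>n. continuous_on (K m) (\<lambda>x. \<Sum>i<n. (1/3)^i * indicator (U i) x :: real)"
      using K(3) by (intro allI continuous_intros) auto
  qed simp
  define S where "S = (\<Union>m. K m)"
  have S: "- S \<in> null_sets M"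
  proof (rule null_setsI)
    show mS: "- S \<in> sets M" 
      unfolding S_def M(1) by (intro borel_comp sets.countable_nat_UN image_subsetI borel_closed compact_imp_closed K(1))
    have le: "emeasure M (- S) \<le> ennreal (1 / real (Suc m))" for m
    proof -
      have "emeasure M (- S) \<le> emeasure M (- K m)"
      proof (rule emeasure_mono)
        show "- K m \<in> sets M" unfolding M(1) by (intro borel_comp borel_closed compact_imp_closed K(1))
      qed (auto simp: S_def)
      also note K(2)
      finally show ?thesis .
    qed
    have "(\<lambda>m. ennreal (1 / real (Suc m))) \<longlonglongrightarrow> ennreal 0"
      by (intro tendsto_ennrealI LIMSEQ_Suc lim_1_over_n)
    then have "emeasure M (- S) \<le> ennreal 0"
      by (rule LIMSEQ_le_const) (use le in auto)
    then show "emeasure M (- S) = 0" by simp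
  qed
  define g where "g r = (if r \<in> f ` S then inv_into S f r else undefined)" for r
  have gf: "g (f x) = x" if "x \<in> S" for x
  proof -
    have "inj_on f S" using inj by (auto intro: inj_onI)
    then show ?thesis using that by (simp add: g_def)
  qed
  \<comment> \<open>Images of compact sets under \<open>f\<close> are compact as \<open>f\<close> is continuous
    on each \<open>K m\<close>.\<close>
  have img: "f ` (S \<inter> C) \<in> sets borel" if "closed C" for C
  proof -
    have "compact (f ` (K m \<inter> C))" for m
      using K(1) that f_cont by (intro compact_continuous_image compact_Int_closed) (auto intro: continuous_on_subset)
    moreover have "f ` (S \<inter> C) = (\<Union>m. f ` (K m \<inter> C))" by (auto simp: S_def)
    ultimately show ?thesis
      by (simp only:) (intro sets.countable_nat_UN image_subsetI borel_closed compact_imp_closed)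
  qed
  have gm: "g \<in> borel_measurable borel"
  proof (rule measurable_sigma_sets[where \<Omega> = UNIV and A = "{C. closed C}"])
    show "sets borel = sigma_sets UNIV {C :: 'a set. closed C}" by (simp add: borel_eq_closed)
    fix C :: "'a set" assume "C \<in> {C. closed C}"
    then have C: "closed C" by simp
    have "g -` C = f ` (S \<inter> C) \<union> (if undefined \<in> C then - f ` S else {})"
    proof -
      have "r \<in> g -` C \<longleftrightarrow> r \<in> f ` (S \<inter> C) \<union> (if undefined \<in> C then - f ` S else {})" for r
      proof (cases "r \<in> f ` S")
        case True
        then obtain x where x: "x \<in> S" "r = f x" by blast
        have "f x \<in> f ` (S \<inter> C) \<longleftrightarrow> x \<in> C" using inj x(1) by blast
        then show ?thesis using x gf[OF x(1)] by auto
      qed (auto simp: g_def)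
      then show ?thesis by blast
    qed
    moreover have "f ` S \<in> sets borel" using img[of UNIV] by simp
    ultimately show "g -` C \<inter> space borel \<in> sets borel" using img[OF C] by auto
  qed auto
  have "AE x in M. g (f x) = x"
    by (rule AE_I'[OF S]) (use gf in auto)
  with fm gm f_range show thesis using that by blast
qed

section \<open>Regular conditional distributions\<close>

text \<open>
  Integrate over the set where the inequality fails.
\<close>

lemma AE_le_from_set_integrals:
  fixes u v :: "'b \<Rightarrow> ennreal"
  assumes [measurable]: "u \<in> borel_measurable M" "v \<in> borel_measurable M"
    and fin: "(\<integral>\<^sup>+x. v x \<partial>M) < \<infinity>"
    and le: "\<And>A. A \<in> sets M \<Longrightarrow> (\<integral>\<^sup>+x. u x * indicator A x \<partial>M) \<le> (\<integral>\<^sup>+x. v x * indicator A x \<partial>M)"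
  shows "AE x in M. u x \<le> v x"
proof -
  define A where "A = {x \<in> space M. v x < u x}"
  have [measurable]: "A \<in> sets M" unfolding A_def by measurable
  have vA: "(\<integral>\<^sup>+x. v x * indicator A x \<partial>M) < \<infinity>"
    by (rule le_less_trans[OF nn_integral_mono fin]) (auto simp: indicator_def)
  have "(\<integral>\<^sup>+x. u x * indicator A x - v x * indicator A x \<partial>M) = (\<integral>\<^sup>+x. u x * indicator A x \<partial>M) - (\<integral>\<^sup>+x. v x * indicator A x \<partial>M)"
    by (rule nn_integral_diff) (use vA in \<open>auto simp: A_def indicator_def\<close>)
  also have "\<dots> = 0" using le[of A] vA by (simp add: diff_eq_0_iff_ennreal)
  finally have "AE x in M. u x * indicator A x - v x * indicator A x = 0"
    by (subst (asm) nn_integral_0_iff_AE) auto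
  then show ?thesis
  proof (rule AE_mp, intro AE_I2 impI)
    fix x assume x: "x \<in> space M" "u x * indicator A x - v x * indicator A x = 0"
    show "u x \<le> v x"
    proof (rule ccontr)
      assume "\<not> u x \<le> v x"
      then have "v x < u x" "x \<in> A" using x(1) by (auto simp: A_def)
      then show False using x(2) by (auto simp: diff_eq_0_iff_ennreal)
    qed
  qed
qed

lemma emeasure_distr_restricted:
  assumes f: "f \<in> Q \<rightarrow>\<^sub>M N" and R: "R \<in> sets Q" and A: "A \<in> sets N"
  shows "emeasure (distr (density Q (indicator R)) N f) A = emeasure Q (R \<inter> (f -` A \<inter> space Q))"
proof -
  have "f \<in> density Q (indicator R) \<rightarrow>\<^sub>M N" using f by simp
  then have "emeasure (distr (density Q (indicator R)) N f) A = emeasure (density Q (indicator R)) (f -` A \<inter> space Q)"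
    using A by (subst emeasure_distr) auto
  also have "\<dots> = emeasure Q (R \<inter> (f -` A \<inter> space Q))"
    by (rule emeasure_restricted[OF R measurable_sets[OF f A]])
  finally show ?thesis .
qed

lemma emeasure_distr_fst:
  fixes Q :: "('b \<times> 'c::topological_space) measure"
  assumes Q: "sets Q = sets (M \<Otimes>\<^sub>M borel)" and A: "A \<in> sets M"
  shows "emeasure (distr Q M fst) A = emeasure Q (A \<times> UNIV)"
proof -
  have "space Q = space M \<times> UNIV" using sets_eq_imp_space_eq[OF Q] by (simp add: space_pair_measure)
  then have "fst -` A \<inter> space Q = A \<times> UNIV" using sets.sets_into_space[OF A] by auto
  moreover have "fst \<in> Q \<rightarrow>\<^sub>M M" using measurable_fst by (simp add: measurable_cong_sets[OF Q refl])
  ultimately show ?thesis using A by (subst emeasure_distr) auto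
qed

text \<open>
  The kernel must be a probability measure at every point, not merely almost everywhere, because the
  Ionescu-Tulcea construction asks for this.
\<close>

definition prob_kernel :: "'b measure \<Rightarrow> 'a measure \<Rightarrow> ('b \<Rightarrow> 'a measure) \<Rightarrow> bool" where
  "prob_kernel M N k \<longleftrightarrow> k \<in> M \<rightarrow>\<^sub>M subprob_algebra N \<and> (\<forall>x\<in>space M. prob_space (k x))"

text \<open>
  A version of the conditional probability of the event \<open>snd z \<le> q\<close> given the first coordinate, as a
  Radon-Nikodym derivative, truncated so that its values lie in the unit interval everywhere.
\<close>

lemma cond_cdf_at_rational:
  fixes Q :: "('b \<times> real) measure"
  assumes Q: "sets Q = sets (M \<Otimes>\<^sub>M borel)" "prob_space Q"
    and \<mu>: "\<mu> = distr Q M fst"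
  obtains h :: "'b \<Rightarrow> real" where "h \<in> borel_measurable M" "\<And>x. 0 \<le> h x \<and> h x \<le> 1"
    "\<And>A. A \<in> sets M \<Longrightarrow> emeasure Q (A \<times> {..q}) = (\<integral>\<^sup>+x. ennreal (h x) * indicator A x \<partial>\<mu>)"
proof -
  interpret Q: prob_space Q by fact
  note Q(1)[measurable_cong]
  have spQ: "space Q = space M \<times> UNIV" using sets_eq_imp_space_eq[OF Q(1)] by (simp add: space_pair_measure)
  have [measurable]: "fst \<in> Q \<rightarrow>\<^sub>M M" by measurable
  interpret prob_space \<mu> unfolding \<mu> by (rule Q.prob_space_distr) measurable
  have s\<mu> [measurable_cong]: "sets \<mu> = sets M" by (simp add: \<mu>)
  define N where "N = distr (density Q (indicator (space M \<times> {..q}))) M fst"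
  have R: "space M \<times> {..q} \<in> sets Q" unfolding Q(1) by measurable
  have eN: "emeasure N A = emeasure Q (A \<times> {..q})" if A: "A \<in> sets M" for A
  proof -
    have "space M \<times> {..q} \<inter> (fst -` A \<inter> space Q) = A \<times> {..q}"
      using sets.sets_into_space[OF A] by (auto simp: spQ)
    then show ?thesis unfolding N_def
      by (subst emeasure_distr_restricted[OF _ R A]) auto
  qed
  have sN: "sets N = sets \<mu>" by (simp add: N_def \<mu>)
  have e\<mu>: "emeasure \<mu> A = emeasure Q (A \<times> UNIV)" if "A \<in> sets M" for A
    unfolding \<mu> by (rule emeasure_distr_fst[OF Q(1) that])
  have le: "emeasure N A \<le> emeasure \<mu> A" if A: "A \<in> sets M" for A
  proof -
    have "A \<times> UNIV \<in> sets Q" unfolding Q(1) using A by measurable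
    then show ?thesis unfolding eN[OF A] e\<mu>[OF A] by (intro emeasure_mono) auto
  qed
  have "absolutely_continuous \<mu> N"
    unfolding absolutely_continuous_def
  proof
    fix A assume "A \<in> null_sets \<mu>"
    then have "A \<in> sets M" "emeasure \<mu> A = 0" by (auto simp: null_sets_def s\<mu>)
    then show "A \<in> null_sets N" using le[of A] by (auto simp: null_sets_def sN s\<mu>)
  qed
  then have dens: "density \<mu> (RN_deriv \<mu> N) = N" by (rule density_RN_deriv[OF _ sN])
  have [measurable]: "RN_deriv \<mu> N \<in> borel_measurable \<mu>" by simp
  have int: "(\<integral>\<^sup>+x. RN_deriv \<mu> N x * indicator A x \<partial>\<mu>) = emeasure N A" if "A \<in> sets M" for A
    using that by (subst (2) dens[symmetric]) (simp add: emeasure_density s\<mu>)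
  have AE1: "AE x in \<mu>. RN_deriv \<mu> N x \<le> 1"
  proof (rule AE_le_from_set_integrals)
    show "(\<integral>\<^sup>+x. 1 \<partial>\<mu>) < \<infinity>" by (simp add: emeasure_space_1)
    fix A assume "A \<in> sets \<mu>"
    then show "(\<integral>\<^sup>+x. RN_deriv \<mu> N x * indicator A x \<partial>\<mu>) \<le> (\<integral>\<^sup>+x. 1 * indicator A x \<partial>\<mu>)"
      using int[of A] le[of A] by (simp add: s\<mu>)
  qed auto
  define h where "h x = enn2real (min 1 (RN_deriv \<mu> N x))" for x
  have hm: "h \<in> borel_measurable M"
  proof -
    have "h \<in> borel_measurable \<mu>" unfolding h_def by measurable
    then show ?thesis by (simp add: measurable_cong_sets[OF s\<mu> refl])
  qed
  have h1: "0 \<le> h x \<and> h x \<le> 1" for x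
    unfolding h_def using enn2real_mono[of "min 1 (RN_deriv \<mu> N x)" 1] by simp
  have "emeasure Q (A \<times> {..q}) = (\<integral>\<^sup>+x. ennreal (h x) * indicator A x \<partial>\<mu>)" if A: "A \<in> sets M" for A
  proof -
    have "(\<integral>\<^sup>+x. ennreal (h x) * indicator A x \<partial>\<mu>) = (\<integral>\<^sup>+x. RN_deriv \<mu> N x * indicator A x \<partial>\<mu>)"
    proof (rule nn_integral_cong_AE)
      show "AE x in \<mu>. ennreal (h x) * indicator A x = RN_deriv \<mu> N x * indicator A x"
        using AE1
      proof eventually_elim
        case (elim x)
        then have "RN_deriv \<mu> N x < top" using ennreal_one_less_top le_less_trans by blast
        with elim show ?case by (simp add: h_def min_absorb2)
      qed
    qed
    then show ?thesis using int[OF A] eN[OF A] by simp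
  qed
  then show thesis using that hm h1 by blast
qed

definition running_sup :: "(rat \<Rightarrow> real) \<Rightarrow> rat \<Rightarrow> real" where
  "running_sup u q = (SUP p\<in>{..q}. u p)"

definition cdf_from_rationals :: "(rat \<Rightarrow> real) \<Rightarrow> real \<Rightarrow> real" where
  "cdf_from_rationals u r = (INF q\<in>{q. r < real_of_rat q}. running_sup u q)"

text \<open>
  A family of conditional probabilities of the events \<open>Y \<le> q\<close> for rational \<open>q\<close> at a single point,
  which need not even be monotone, as conditional probabilities are arbitrary on null sets. The assumed
  values below 0 and from 2 on pin the limits at \<open>\<plusminus>\<infinity>\<close>, so running suprema over \<open>p \<le> q\<close> followed by
  infima over \<open>q > r\<close> always give a distribution function.
\<close>

locale rational_cdf =
  fixes u :: "rat \<Rightarrow> real"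
  assumes u01: "\<And>q. 0 \<le> u q" "\<And>q. u q \<le> 1"
    and u0: "\<And>q. q < 0 \<Longrightarrow> u q = 0" and u1: "\<And>q. 2 \<le> q \<Longrightarrow> u q = 1"
begin

abbreviation "H \<equiv> running_sup u"
abbreviation "G \<equiv> cdf_from_rationals u"

lemma bddu: "bdd_above (u ` S)"
  using u01 by (intro bdd_aboveI[of _ 1]) auto

lemma le_H: "u q \<le> H q"
  unfolding running_sup_def using bddu by (intro cSUP_upper) auto

lemma H01: "0 \<le> H q" "H q \<le> 1"
  using le_H[of q] u01(1)[of q] u01(2) by (auto simp: running_sup_def intro!: cSUP_least)

lemma H_mono: "p \<le> q \<Longrightarrow> H p \<le> H q"
  unfolding running_sup_def using bddu by (intro cSUP_subset_mono) auto

lemma H0: "q < 0 \<Longrightarrow> H q = 0"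
  using u0 H01(1)[of q] by (intro antisym) (auto simp: running_sup_def intro!: cSUP_least)

lemma H1: "2 \<le> q \<Longrightarrow> H q = 1"
  using le_H[of q] u1[of q] H01(2)[of q] by simp

lemma H_eq: "(\<And>p q. p \<le> q \<Longrightarrow> u p \<le> u q) \<Longrightarrow> H q = u q"
  using le_H[of q] by (intro antisym) (auto simp: running_sup_def intro!: cSUP_least)

lemma ne: "{q. r < real_of_rat q} \<noteq> {}"
  using of_rat_dense[of r "r + 1"] by auto

lemma bddH: "bdd_below (H ` S)"
  using H01 by (intro bdd_belowI[of _ 0]) auto

lemma G_le: "r < real_of_rat q \<Longrightarrow> G r \<le> H q"
  unfolding cdf_from_rationals_def using bddH by (intro cINF_lower) auto

lemma G_nonneg: "0 \<le> G r"
  unfolding cdf_from_rationals_def using H01 ne by (intro cINF_greatest) auto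

lemma G_mono: "r \<le> s \<Longrightarrow> G r \<le> G s"
  unfolding cdf_from_rationals_def using bddH ne by (intro cINF_superset_mono) auto

lemma G0: assumes "r < 0" shows "G r = 0"
proof -
  obtain q where "r < real_of_rat q" "real_of_rat q < 0" using of_rat_dense[OF assms] by blast
  then show ?thesis using G_le[of r q] H0[of q] G_nonneg[of r] by simp
qed

lemma G1: assumes "2 \<le> r" shows "G r = 1"
proof -
  have "H q = 1" if "r < real_of_rat q" for q
  proof (rule H1)
    have "real_of_rat 2 < real_of_rat q" using that assms by simp
    then show "2 \<le> q" unfolding of_rat_less by simp
  qed
  then have "G r = (INF q\<in>{q. r < real_of_rat q}. 1)" unfolding cdf_from_rationals_def by (intro INF_cong) auto
  then show ?thesis using ne by simp
qed

lemma G_approx: "0 < e \<Longrightarrow> \<exists>q. r < real_of_rat q \<and> H q < G r + e"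
  using cINF_less_iff[OF ne bddH, of r "G r + e"] by (auto simp: cdf_from_rationals_def)

lemma H_tendsto_G:
  assumes "(f \<longlongrightarrow> r) \<F>" "\<forall>\<^sub>F i in \<F>. r < real_of_rat (f' i) \<and> real_of_rat (f' i) = f i"
  shows "((\<lambda>i. H (f' i)) \<longlongrightarrow> G r) \<F>"
proof (rule tendstoI)
  fix e :: real assume "0 < e"
  then obtain p where p: "r < real_of_rat p" "H p < G r + e" using G_approx by blast
  show "\<forall>\<^sub>F i in \<F>. dist (H (f' i)) (G r) < e"
    using order_tendstoD(2)[OF assms(1) p(1)] assms(2)
  proof eventually_elim
    case (elim i)
    then have "real_of_rat (f' i) < real_of_rat p" by simp
    then have "f' i \<le> p" by (simp add: of_rat_less)
    then show ?case using H_mono[of "f' i" p] G_le[of r "f' i"] elim(2) p(2) by (auto simp: dist_real_def)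
  qed
qed

lemma G_right_cont: "continuous (at_right r) G"
  unfolding continuous_within
proof (rule tendstoI)
  fix e :: real assume "0 < e"
  then obtain q where q: "r < real_of_rat q" "H q < G r + e" using G_approx by blast
  have "\<forall>\<^sub>F s in at_right r. s < real_of_rat q" using q(1) eventually_at_right by blast
  moreover have "\<forall>\<^sub>F s in at_right r. r < s" by (simp add: eventually_at_right_less)
  ultimately show "\<forall>\<^sub>F s in at_right r. dist (G s) (G r) < e"
  proof eventually_elim
    case (elim s)
    then show ?case using G_le[of s q] G_mono[of r s] q by (auto simp: dist_real_def)
  qed
qed

lemma G_bot: "(G \<longlongrightarrow> 0) at_bot"
  using G0 by (intro tendsto_eventually) (auto simp: eventually_at_bot_dense)

lemma G_top: "(G \<longlongrightarrow> 1) at_top"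
  using G1 by (intro tendsto_eventually) (auto simp: eventually_at_top_linorder)

lemma cdf_measure:
  shows "prob_space (interval_measure G)" and "emeasure (interval_measure G) {..r} = ennreal (G r)"
  using real_distribution_interval_measure[OF G_mono G_right_cont G_bot G_top]
    emeasure_interval_measure_Iic[OF G_mono G_right_cont G_bot]
  by (auto simp: real_distribution_def)

end

text \<open>
  The conditional probabilities of \<open>{..q}\<close> are almost surely increasing in the rational \<open>q\<close>, so the
  regularisation by \<open>cdf_from_rationals\<close> yields a probability measure at every point and changes the
  conditional probabilities only on a null set. Dominated convergence along \<open>q\<close> decreasing to \<open>r\<close>
  identifies the mass of \<open>{..r}\<close>.
\<close>

lemma real_regular_conditional:
  fixes Q :: "('b \<times> real) measure"
  assumes Q: "sets Q = sets (M \<Otimes>\<^sub>M borel)" "prob_space Q"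
    and \<mu>: "\<mu> = distr Q M fst"
    and range: "AE z in Q. 0 \<le> snd z \<and> snd z < 2"
  obtains k where "prob_kernel M borel k"
    "\<And>A B. A \<in> sets M \<Longrightarrow> B \<in> sets borel \<Longrightarrow> emeasure Q (A \<times> B) = (\<integral>\<^sup>+x. emeasure (k x) B * indicator A x \<partial>\<mu>)"
proof -
  interpret Q: prob_space Q by fact
  note Q(1)[measurable_cong]
  have spQ: "space Q = space M \<times> UNIV" using sets_eq_imp_space_eq[OF Q(1)] by (simp add: space_pair_measure)
  have [measurable]: "fst \<in> Q \<rightarrow>\<^sub>M M" by measurable
  interpret prob_space \<mu> unfolding \<mu> by (rule Q.prob_space_distr) measurable
  have s\<mu> [measurable_cong]: "sets \<mu> = sets M" by (simp add: \<mu>)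
  have e\<mu>: "emeasure \<mu> A = emeasure Q (A \<times> UNIV)" if "A \<in> sets M" for A
    unfolding \<mu> by (rule emeasure_distr_fst[OF Q(1) that])
  have rect: "A \<times> B \<in> sets Q" if "A \<in> sets M" "B \<in> sets borel" for A B unfolding Q(1) using that by measurable
  have ex: "\<exists>h. h \<in> borel_measurable M \<and> (\<forall>x. 0 \<le> h x \<and> h x \<le> 1) \<and>
    (\<forall>A\<in>sets M. emeasure Q (A \<times> {..real_of_rat q}) = (\<integral>\<^sup>+x. ennreal (h x) * indicator A x \<partial>\<mu>))" for q
    by (rule cond_cdf_at_rational[OF Q \<mu>, of "real_of_rat q"]) blast
  then obtain h where h: "\<And>q. h q \<in> borel_measurable M" "\<And>q x. 0 \<le> h q x \<and> h q x \<le> 1"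
    "\<And>q A. A \<in> sets M \<Longrightarrow> emeasure Q (A \<times> {..real_of_rat q}) = (\<integral>\<^sup>+x. ennreal (h q x) * indicator A x \<partial>\<mu>)"
    using choice[of "\<lambda>q h. h \<in> borel_measurable M \<and> (\<forall>x. 0 \<le> h x \<and> h x \<le> 1) \<and>
      (\<forall>A\<in>sets M. emeasure Q (A \<times> {..real_of_rat q}) = (\<integral>\<^sup>+x. ennreal (h x) * indicator A x \<partial>\<mu>))"] ex
    by blast
  \<comment> \<open>Outside the range of the second coordinate the values are prescribed, as
    \<open>rational_cdf\<close> requires.\<close>
  define u where "u q x = (if q < 0 then 0 else if 2 \<le> q then 1 else h q x)" for q x
  have um [measurable]: "u q \<in> borel_measurable M" for q
    using h(1)[of q] unfolding u_def by (cases "q < 0"; cases "2 \<le> q") auto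
  have u01: "0 \<le> u q x" "u q x \<le> 1" for q x using h(2) by (auto simp: u_def)
  have uQ: "emeasure Q (A \<times> {..real_of_rat q}) = (\<integral>\<^sup>+x. ennreal (u q x) * indicator A x \<partial>\<mu>)" if A: "A \<in> sets M" for A q
  proof -
    consider "q < 0" | "2 \<le> q" | "\<not> q < 0" "\<not> 2 \<le> q" by blast
    then show ?thesis
    proof cases
      case 1
      then obtain r where r: "real_of_rat q = r" "r < 0" by simp
      have "AE z in Q. z \<in> A \<times> {..real_of_rat q} \<longleftrightarrow> z \<in> {}"
        using range unfolding r(1)
      proof eventually_elim
        case (elim z)
        then show ?case using r(2) by (cases z) auto
      qed
      then have "emeasure Q (A \<times> {..real_of_rat q}) = emeasure Q {}"
        by (rule emeasure_eq_AE) (use rect[OF A] in auto)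
      then show ?thesis using 1 by (simp add: u_def)
    next
      case 2
      then have "real_of_rat 2 \<le> real_of_rat q" unfolding of_rat_less_eq .
      then obtain r where r: "real_of_rat q = r" "2 \<le> r" by simp
      have "AE z in Q. z \<in> A \<times> {..real_of_rat q} \<longleftrightarrow> z \<in> A \<times> UNIV"
        using range unfolding r(1)
      proof eventually_elim
        case (elim z)
        then show ?case using r(2) by (cases z) auto
      qed
      then have "emeasure Q (A \<times> {..real_of_rat q}) = emeasure Q (A \<times> UNIV)"
        by (rule emeasure_eq_AE) (use rect[OF A] in auto)
      then show ?thesis using 2 A by (simp add: u_def e\<mu> s\<mu>)
    next
      case 3
      then show ?thesis using h(3)[OF A] by (simp add: u_def)
    qed
  qed
  have mono: "AE x in \<mu>. \<forall>p q. p \<le> q \<longrightarrow> u p x \<le> u q x"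
  proof -
    have "AE x in \<mu>. u p x \<le> u q x" if pq: "p \<le> q" for p q
    proof -
      have "AE x in \<mu>. ennreal (u p x) \<le> ennreal (u q x)"
      proof (rule AE_le_from_set_integrals)
        have "(\<integral>\<^sup>+x. ennreal (u q x) \<partial>\<mu>) \<le> (\<integral>\<^sup>+x. 1 \<partial>\<mu>)" using u01 by (intro nn_integral_mono) auto
        also have "\<dots> < \<infinity>" by (simp add: emeasure_space_1)
        finally show "(\<integral>\<^sup>+x. ennreal (u q x) \<partial>\<mu>) < \<infinity>" .
        fix A assume "A \<in> sets \<mu>"
        then have A: "A \<in> sets M" by (simp add: s\<mu>)
        have "{..real_of_rat p} \<subseteq> {..real_of_rat q}" using pq by (auto simp: of_rat_less_eq intro: order_trans)
        then show "(\<integral>\<^sup>+x. ennreal (u p x) * indicator A x \<partial>\<mu>) \<le> (\<integral>\<^sup>+x. ennreal (u q x) * indicator A x \<partial>\<mu>)"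
          unfolding uQ[OF A, symmetric] by (intro emeasure_mono rect A) auto
      qed auto
      then show ?thesis using u01 by (simp add: ennreal_le_iff)
    qed
    then show ?thesis by (simp add: AE_all_countable)
  qed
  have rc: "rational_cdf (\<lambda>q. u q x)" for x
    by unfold_locales (use u01 in \<open>auto simp: u_def\<close>)
  define G where "G x = cdf_from_rationals (\<lambda>q. u q x)" for x
  have Gm [measurable]: "(\<lambda>x. G x r) \<in> borel_measurable M" for r
  proof -
    have "running_sup (\<lambda>q. u q x) q \<ge> 0" for x q by (rule rational_cdf.H01(1)[OF rc])
    then show ?thesis
      unfolding G_def cdf_from_rationals_def running_sup_def
      using rational_cdf.bddu[OF rc] by (intro borel_measurable_cINF borel_measurable_cSUP bdd_belowI[of _ 0]) auto
  qed
  have Hu: "AE x in \<mu>. \<forall>q. running_sup (\<lambda>q. u q x) q = u q x"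
    using mono by eventually_elim (auto intro!: rational_cdf.H_eq[OF rc])
  define k where "k x = interval_measure (G x)" for x
  have kI: "emeasure (k x) {..r} = ennreal (G x r)" and kP: "prob_space (k x)" for x r
    unfolding k_def G_def by (rule rational_cdf.cdf_measure[OF rc])+
  have ks: "sets (k x) = sets borel" for x by (simp add: k_def)
  have km: "k \<in> M \<rightarrow>\<^sub>M subprob_algebra borel"
  proof (rule measurable_subprob_algebra_generated[where \<Omega> = UNIV and G = "range (\<lambda>a. {..a})"])
    show "sets borel = sigma_sets UNIV (range (\<lambda>a::real. {..a}))" by (subst borel_eq_atMost) simp
    show "Int_stable (range (\<lambda>a::real. {..a}))" by (auto simp: Int_stable_def)
    show "subprob_space (k x)" for x using kP by (rule prob_space_imp_subprob_space)
    show "(\<lambda>a. emeasure (k a) UNIV) \<in> borel_measurable M"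
      using prob_space.emeasure_space_1[OF kP] by (simp add: k_def)
    show "\<And>A. A \<in> range (\<lambda>a. {..a}) \<Longrightarrow> (\<lambda>a. emeasure (k a) A) \<in> borel_measurable M"
      using kI by auto
  qed (use ks in auto)
  have pk: "prob_kernel M borel k" unfolding prob_kernel_def using km kP by auto
  have Iic: "emeasure Q (A \<times> {..r}) = (\<integral>\<^sup>+x. emeasure (k x) {..r} * indicator A x \<partial>\<mu>)" if A: "A \<in> sets M" for A r
  proof -
    have "\<exists>q. r < real_of_rat q \<and> real_of_rat q < r + 1 / real (Suc n)" for n
      by (rule of_rat_dense) simp
    then obtain q where q: "\<And>n. r < real_of_rat (q n)" "\<And>n. real_of_rat (q n) < r + 1 / real (Suc n)" by metis
    have lim_q: "(\<lambda>n. real_of_rat (q n)) \<longlonglongrightarrow> r"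
    proof (rule tendsto_sandwich)
      show "\<forall>\<^sub>F n in sequentially. r \<le> real_of_rat (q n)" "\<forall>\<^sub>F n in sequentially. real_of_rat (q n) \<le> r + 1 / real (Suc n)"
        using q less_imp_le by (auto intro!: always_eventually)
      show "(\<lambda>n. r + 1 / real (Suc n)) \<longlonglongrightarrow> r"
        using tendsto_add[OF tendsto_const[of r] LIMSEQ_Suc[OF lim_1_over_n]] by simp
    qed simp
    have lim1: "(\<lambda>n. \<integral>\<^sup>+x. ennreal (u (q n) x) * indicator A x \<partial>\<mu>) \<longlonglongrightarrow> (\<integral>\<^sup>+x. ennreal (G x r) * indicator A x \<partial>\<mu>)"
    proof (rule nn_integral_dominated_convergence[where w = "\<lambda>_. 1"])
      show "AE x in \<mu>. ennreal (u (q j) x) * indicator A x \<le> 1" for j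
        using u01 by (auto simp: indicator_def)
      show "(\<integral>\<^sup>+x. 1 \<partial>\<mu>) < \<infinity>" by (simp add: emeasure_space_1)
      show "AE x in \<mu>. (\<lambda>n. ennreal (u (q n) x) * indicator A x) \<longlonglongrightarrow> ennreal (G x r) * indicator A x"
        using Hu
      proof eventually_elim
        case (elim x)
        have "(\<lambda>n. running_sup (\<lambda>q. u q x) (q n)) \<longlonglongrightarrow> G x r"
          unfolding G_def by (rule rational_cdf.H_tendsto_G[OF rc lim_q]) (use q(1) in simp)
        then have "(\<lambda>n. ennreal (running_sup (\<lambda>q. u q x) (q n))) \<longlonglongrightarrow> ennreal (G x r)" by (rule tendsto_ennrealI)
        then show ?case using elim by (cases "x \<in> A") auto
      qed
    qed (use A in measurable)
    have lim2: "(\<lambda>n. emeasure Q (A \<times> {..real_of_rat (q n)})) \<longlonglongrightarrow> emeasure Q (A \<times> {..r})"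
    proof -
      have "(\<lambda>n. \<integral>\<^sup>+z. indicator (A \<times> {..real_of_rat (q n)}) z \<partial>Q) \<longlonglongrightarrow> (\<integral>\<^sup>+z. indicator (A \<times> {..r}) z \<partial>Q)"
      proof (rule nn_integral_dominated_convergence[where w = "\<lambda>_. 1"])
        show "(\<integral>\<^sup>+z. 1 \<partial>Q) < \<infinity>" by (simp add: Q.emeasure_space_1)
        show "AE z in Q. (\<lambda>n. indicator (A \<times> {..real_of_rat (q n)}) z) \<longlonglongrightarrow> (indicator (A \<times> {..r}) z :: ennreal)"
        proof (intro AE_I2 tendsto_eventually)
          fix z
          show "\<forall>\<^sub>F n in sequentially. indicator (A \<times> {..real_of_rat (q n)}) z = (indicator (A \<times> {..r}) z :: ennreal)"
          proof (cases "snd z \<le> r")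
            case True
            then have "snd z \<le> real_of_rat (q n)" for n using q(1)[of n] by linarith
            with True show ?thesis by (cases z) (auto simp: indicator_def)
          next
            case False
            then have "\<forall>\<^sub>F n in sequentially. real_of_rat (q n) < snd z" using order_tendstoD(2)[OF lim_q] by simp
            then show ?thesis
            proof eventually_elim
              case (elim n)
              then show ?case using False by (cases z) (auto simp: indicator_def)
            qed
          qed
        qed
      qed (use rect[OF A] in \<open>auto simp: indicator_def\<close>)
      then show ?thesis using rect[OF A] by simp
    qed
    have "(\<lambda>n. emeasure Q (A \<times> {..real_of_rat (q n)})) \<longlonglongrightarrow> (\<integral>\<^sup>+x. ennreal (G x r) * indicator A x \<partial>\<mu>)"
      using lim1 by (simp add: uQ[OF A])
    from LIMSEQ_unique[OF lim2 this] show ?thesis by (simp add: kI)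
  qed
  have "emeasure Q (A \<times> B) = (\<integral>\<^sup>+x. emeasure (k x) B * indicator A x \<partial>\<mu>)" if A: "A \<in> sets M" and B: "B \<in> sets borel" for A B
  proof -
    define m1 where "m1 = distr (density Q (indicator (A \<times> UNIV))) borel snd"
    define m2 where "m2 = density \<mu> (indicator A) \<bind> k"
    have AU: "A \<times> UNIV \<in> sets Q" by (rule rect[OF A]) simp
    have "space M \<noteq> {}" using not_empty sets_eq_imp_space_eq[OF s\<mu>] by simp
    have e1: "emeasure m1 B = emeasure Q (A \<times> B)" if B: "B \<in> sets borel" for B
    proof -
      have "A \<times> UNIV \<inter> (snd -` B \<inter> space Q) = A \<times> B"
        using sets.sets_into_space[OF A] by (auto simp: spQ)
      then show ?thesis unfolding m1_def
        by (subst emeasure_distr_restricted[OF _ AU B]) auto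
    qed
    have e2: "emeasure m2 B = (\<integral>\<^sup>+x. emeasure (k x) B * indicator A x \<partial>\<mu>)" if B: "B \<in> sets borel" for B
    proof -
      have [measurable]: "k \<in> \<mu> \<rightarrow>\<^sub>M subprob_algebra borel" using km by (simp cong: measurable_cong_sets)
      have "emeasure m2 B = (\<integral>\<^sup>+x. emeasure (k x) B \<partial>density \<mu> (indicator A))"
        unfolding m2_def using B not_empty by (intro emeasure_bind[where N = borel]) auto
      also have "\<dots> = (\<integral>\<^sup>+x. indicator A x * emeasure (k x) B \<partial>\<mu>)"
        using A B by (intro nn_integral_density) (auto simp: s\<mu>)
      finally show ?thesis by (simp add: mult.commute)
    qed
    have "m1 = m2"
    proof (rule measure_eqI_generator_eq[where \<Omega> = UNIV and E = "range (\<lambda>a. {..a})" and A = "\<lambda>n. {..real n}"])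
      show "Int_stable (range (\<lambda>a::real. {..a}))" by (auto simp: Int_stable_def)
      have sb: "sets borel = sigma_sets UNIV (range (\<lambda>a::real. {..a}))" by (subst borel_eq_atMost) simp
      show "sets m1 = sigma_sets UNIV (range (\<lambda>a. {..a}))" unfolding m1_def using sb by simp
      show "sets m2 = sigma_sets UNIV (range (\<lambda>a. {..a}))"
        unfolding m2_def sb[symmetric] using not_empty by (intro sets_bind) (auto simp: ks)
      show "\<And>X. X \<in> range (\<lambda>a. {..a}) \<Longrightarrow> emeasure m1 X = emeasure m2 X"
        using e1 e2 Iic[OF A] by auto
      show "(\<Union>i. {..real i}) = UNIV" using real_arch_simple by auto
      show "emeasure m1 {..real i} \<noteq> \<infinity>" for i using e1[of "{..real i}"] by simp
    qed auto
    then show ?thesis using e1[OF B] e2[OF B] by simp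
  qed
  then show thesis using that pk by blast
qed

text \<open>
  Encode the second coordinate in the real line, take the conditional distribution there and push
  it back with the decoding map. Agreement on rectangles extends to all integrands because
  rectangles form an intersection-stable generator.
\<close>

lemma regular_conditional:
  fixes Q :: "('b \<times> 'a::polish_space) measure"
  assumes Q: "sets Q = sets (M \<Otimes>\<^sub>M borel)" "prob_space Q"
  obtains k where "prob_kernel M borel k"
    "\<And>f. f \<in> borel_measurable (M \<Otimes>\<^sub>M borel) \<Longrightarrow> (\<integral>\<^sup>+z. f z \<partial>Q) = (\<integral>\<^sup>+x. \<integral>\<^sup>+y. f (x, y) \<partial>k x \<partial>distr Q M fst)"
proof -
  interpret Q: prob_space Q by fact
  note Q(1)[measurable_cong]
  have [measurable]: "fst \<in> Q \<rightarrow>\<^sub>M M" "snd \<in> Q \<rightarrow>\<^sub>M borel" by measurable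
  define \<mu> where "\<mu> = distr Q M fst"
  interpret \<mu>: prob_space \<mu> unfolding \<mu>_def by (rule Q.prob_space_distr) measurable
  have s\<mu> [measurable_cong]: "sets \<mu> = sets M" by (simp add: \<mu>_def)
  have sp\<mu>: "space \<mu> = space M" by (simp add: \<mu>_def)
  interpret M2: prob_space "distr Q borel snd" by (rule Q.prob_space_distr) measurable
  obtain f :: "'a \<Rightarrow> real" and g where fg [measurable]: "f \<in> borel_measurable borel" "g \<in> borel_measurable borel"
    and f_range: "\<And>x. 0 \<le> f x \<and> f x < 2" and gf: "AE y in distr Q borel snd. g (f y) = y"
    by (rule polish_measure_real_encoding[of "distr Q borel snd"]) (auto intro: M2.finite_measure_axioms)
  have gf': "AE z in Q. g (f (snd z)) = snd z"
    by (rule AE_distrD[OF _ gf]) measurable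
  define Q' where "Q' = distr Q (M \<Otimes>\<^sub>M borel) (\<lambda>z. (fst z, f (snd z)))"
  have meas: "(\<lambda>z. (fst z, f (snd z))) \<in> Q \<rightarrow>\<^sub>M M \<Otimes>\<^sub>M borel" by measurable
  have Q': "sets Q' = sets (M \<Otimes>\<^sub>M borel)" "prob_space Q'"
    unfolding Q'_def using Q.prob_space_distr[OF meas] by simp_all
  have \<mu>': "\<mu> = distr Q' M fst"
    unfolding \<mu>_def Q'_def by (subst distr_distr[OF _ meas]) (auto simp: comp_def)
  have range: "AE z in Q'. 0 \<le> snd z \<and> snd z < 2"
    unfolding Q'_def by (subst AE_distr_iff[OF meas]) (use f_range in auto)
  obtain kr where kr: "prob_kernel M borel kr"
    "\<And>A B. A \<in> sets M \<Longrightarrow> B \<in> sets borel \<Longrightarrow> emeasure Q' (A \<times> B) = (\<integral>\<^sup>+x. emeasure (kr x) B * indicator A x \<partial>\<mu>)"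
    by (rule real_regular_conditional[OF Q' \<mu>' range]) blast
  have krm [measurable]: "kr \<in> M \<rightarrow>\<^sub>M subprob_algebra borel" and krP: "\<And>x. x \<in> space M \<Longrightarrow> prob_space (kr x)"
    using kr(1) by (auto simp: prob_kernel_def)
  have krs: "sets (kr x) = sets borel" if "x \<in> space M" for x using subprob_measurableD(2)[OF krm that] .
  define k where "k x = distr (kr x) borel g" for x
  have km [measurable]: "k \<in> M \<rightarrow>\<^sub>M subprob_algebra borel"
    unfolding k_def by (rule measurable_compose[OF krm measurable_distr]) measurable
  have gk: "g \<in> kr x \<rightarrow>\<^sub>M borel" if "x \<in> space M" for x
    using fg(2) krs[OF that] by (simp cong: measurable_cong_sets)
  have pk: "prob_kernel M borel k"
    unfolding prob_kernel_def using km krP gk by (auto simp: k_def intro!: prob_space.prob_space_distr)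
  have kB: "emeasure (k x) B = emeasure (kr x) (g -` B)" if "x \<in> space M" "B \<in> sets borel" for x B
    using that gk[OF that(1)] sets_eq_imp_space_eq[OF krs[OF that(1)]] unfolding k_def by (simp add: emeasure_distr)
  have rect: "emeasure Q (A \<times> B) = (\<integral>\<^sup>+x. emeasure (k x) B * indicator A x \<partial>\<mu>)" if A: "A \<in> sets M" and B: "B \<in> sets borel" for A B
  proof -
    have gB: "g -` B \<in> sets borel" using measurable_sets[OF fg(2) B] by simp
    have "emeasure Q (A \<times> B) = emeasure Q ((\<lambda>z. (fst z, f (snd z))) -` (A \<times> g -` B) \<inter> space Q)"
    proof (rule emeasure_eq_AE)
      show "AE z in Q. z \<in> A \<times> B \<longleftrightarrow> z \<in> (\<lambda>z. (fst z, f (snd z))) -` (A \<times> g -` B) \<inter> space Q"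
        using gf' AE_space
      proof eventually_elim
        case (elim z)
        then show ?case by (cases z) auto
      qed
      show "A \<times> B \<in> sets Q" unfolding Q(1) using A B by simp
      show "(\<lambda>z. (fst z, f (snd z))) -` (A \<times> g -` B) \<inter> space Q \<in> sets Q"
        by (rule measurable_sets[OF meas]) (use A gB in simp)
    qed
    also have "\<dots> = emeasure Q' (A \<times> g -` B)"
      unfolding Q'_def by (rule emeasure_distr[OF meas, symmetric]) (use A gB in simp)
    also have "\<dots> = (\<integral>\<^sup>+x. emeasure (k x) B * indicator A x \<partial>\<mu>)"
      unfolding kr(2)[OF A gB] by (intro nn_integral_cong) (simp add: kB[OF _ B] sp\<mu>)
    finally show ?thesis .
  qed
  define J where "J = \<mu> \<bind> (\<lambda>x. distr (k x) (M \<Otimes>\<^sub>M borel) (Pair x))"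
  have Jm: "(\<lambda>x. distr (k x) (M \<Otimes>\<^sub>M borel) (Pair x)) \<in> M \<rightarrow>\<^sub>M subprob_algebra (M \<Otimes>\<^sub>M borel)"
    by (rule measurable_distr2[OF _ km]) measurable
  have Jm': "(\<lambda>x. distr (k x) (M \<Otimes>\<^sub>M borel) (Pair x)) \<in> \<mu> \<rightarrow>\<^sub>M subprob_algebra (M \<Otimes>\<^sub>M borel)"
    using Jm by (simp cong: measurable_cong_sets)
  have Pm: "Pair x \<in> k x \<rightarrow>\<^sub>M M \<Otimes>\<^sub>M borel" if "x \<in> space M" for x
    using that by (simp add: k_def)
  have nnJ: "(\<integral>\<^sup>+z. h z \<partial>J) = (\<integral>\<^sup>+x. \<integral>\<^sup>+y. h (x, y) \<partial>k x \<partial>\<mu>)" if h: "h \<in> borel_measurable (M \<Otimes>\<^sub>M borel)" for h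
    unfolding J_def nn_integral_bind[OF h Jm']
  proof (rule nn_integral_cong)
    fix x assume "x \<in> space \<mu>"
    then have x: "x \<in> space M" by (simp add: sp\<mu>)
    show "(\<integral>\<^sup>+z. h z \<partial>distr (k x) (M \<Otimes>\<^sub>M borel) (Pair x)) = (\<integral>\<^sup>+y. h (x, y) \<partial>k x)"
      by (rule nn_integral_distr[OF Pm[OF x]]) (use h in simp)
  qed
  have "Q = J"
  proof (rule measure_eqI_generator_eq[where \<Omega> = "space M \<times> space borel" and E = "{a \<times> b | a b. a \<in> sets M \<and> b \<in> sets borel}"
        and A = "\<lambda>_. space M \<times> space borel"])
    have "space M \<times> space borel \<in> {a \<times> b |a b. a \<in> sets M \<and> b \<in> sets (borel :: 'a measure)}" by blast
    then show "range (\<lambda>_ :: nat. space M \<times> space borel) \<subseteq> {a \<times> b |a b. a \<in> sets M \<and> b \<in> sets (borel :: 'a measure)}" by blast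
    show "Int_stable {a \<times> b |a b. a \<in> sets M \<and> b \<in> sets borel}" by (rule Int_stable_pair_measure_generator)
    show "{a \<times> b |a b. a \<in> sets M \<and> b \<in> sets borel} \<subseteq> Pow (space M \<times> space borel)" using sets.sets_into_space by fastforce
    show "sets Q = sigma_sets (space M \<times> space borel) {a \<times> b |a b. a \<in> sets M \<and> b \<in> sets borel}"
      using Q(1) by (simp add: sets_pair_measure)
    have "sets J = sets (M \<Otimes>\<^sub>M borel)" unfolding J_def
      by (rule sets_bind) (use \<mu>.not_empty in auto)
    then show "sets J = sigma_sets (space M \<times> space borel) {a \<times> b |a b. a \<in> sets M \<and> b \<in> sets borel}"
      by (simp add: sets_pair_measure)
    fix X assume "X \<in> {a \<times> b |a b. a \<in> sets M \<and> b \<in> sets (borel :: 'a measure)}"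
    then obtain A B where X: "X = A \<times> B" and A: "A \<in> sets M" and B: "B \<in> sets (borel :: 'a measure)" by auto
    have XM: "X \<in> sets (M \<Otimes>\<^sub>M borel)" unfolding X using A B by simp
    have "emeasure J X = (\<integral>\<^sup>+z. indicator X z \<partial>J)"
      using XM \<open>sets J = sets (M \<Otimes>\<^sub>M borel)\<close> by simp
    also have "\<dots> = (\<integral>\<^sup>+x. \<integral>\<^sup>+y. indicator X (x, y) \<partial>k x \<partial>\<mu>)"
      by (rule nnJ) (use XM in simp)
    also have "\<dots> = (\<integral>\<^sup>+x. emeasure (k x) B * indicator A x \<partial>\<mu>)"
    proof (rule nn_integral_cong)
      fix x assume "x \<in> space \<mu>"
      have "(\<integral>\<^sup>+y. indicator X (x, y) \<partial>k x) = (\<integral>\<^sup>+y. indicator A x * indicator B y \<partial>k x)"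
        unfolding X by (intro nn_integral_cong) (auto simp: indicator_def)
      also have "\<dots> = indicator A x * emeasure (k x) B"
        using B by (simp add: nn_integral_cmult k_def)
      finally show "(\<integral>\<^sup>+y. indicator X (x, y) \<partial>k x) = emeasure (k x) B * indicator A x" by (simp add: mult.commute)
    qed
    finally show "emeasure Q X = emeasure J X" using rect[OF A B] by (simp add: X)
  qed auto
  with nnJ have "(\<integral>\<^sup>+z. h z \<partial>Q) = (\<integral>\<^sup>+x. \<integral>\<^sup>+y. h (x, y) \<partial>k x \<partial>\<mu>)" if "h \<in> borel_measurable (M \<Otimes>\<^sub>M borel)" for h
    using that by simp
  with pk show thesis using that unfolding \<mu>_def by blast
qed

section \<open>Kernel chains and their martingales\<close>

text \<open>
  \<open>law n\<close> below is the law of the first \<open>n\<close> coordinates of the process with transition kernels \<open>\<kappa>\<close>.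
\<close>

locale kernel_chain = Ionescu_Tulcea \<kappa> "\<lambda>_. borel"
  for \<kappa> :: "nat \<Rightarrow> (nat \<Rightarrow> 'a::polish_space) \<Rightarrow> 'a measure"
begin

abbreviation law :: "nat \<Rightarrow> (nat \<Rightarrow> 'a) measure" where
  "law n \<equiv> C 0 n (\<lambda>_. undefined)"

lemma undefined_in_space: "(\<lambda>_. undefined) \<in> space (powE 0)"
  by (simp add: space_PiM)

lemma sets_law [simp, measurable_cong]: "sets (law n) = sets (powE n)"
  using sets_C[OF undefined_in_space, of n] by simp

lemma space_law [simp]: "space (law n) = space (powE n)"
  using space_C[OF undefined_in_space, of n] by simp

lemma prob_space_law: "prob_space (law n)"
  by (rule prob_space_C[OF undefined_in_space])

lemma kernel_in_probs: "x \<in> space (powE k) \<Longrightarrow> \<kappa> k x \<in> probs"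
  by (simp add: probs_iff sets_P prob_space_P)

lemma restrict_in_space: "x \<in> space (powE n) \<Longrightarrow> k \<le> n \<Longrightarrow> restrict x {0..<k} \<in> space (powE k)"
  by (auto simp: space_PiM PiE_iff)

lemma restrict_self: "x \<in> space (powE n) \<Longrightarrow> restrict x {0..<n} = x"
  by (auto simp: space_PiM PiE_iff extensional_restrict)

lemma restrict_update: "k \<le> (n::nat) \<Longrightarrow> restrict (x(n := y)) {0..<k} = restrict x {0..<k}"
  by (auto simp: restrict_def fun_eq_iff)

lemma measurable_kernel_restrict:
  assumes "k \<le> n"
  shows "(\<lambda>x. \<kappa> k (restrict x {0..<k})) \<in> powE n \<rightarrow>\<^sub>M subprob_algebra borel"
proof -
  have "(\<lambda>x. restrict x {0..<k}) \<in> powE n \<rightarrow>\<^sub>M powE k"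
    using assms by (intro measurable_restrict_subset) auto
  then show ?thesis using P[of k] by (rule measurable_compose)
qed

lemma measurable_nn_integral_kernel:
  assumes "k \<le> n" "g \<in> borel_measurable borel"
  shows "(\<lambda>x. \<integral>\<^sup>+y. g y \<partial>\<kappa> k (restrict x {0..<k})) \<in> borel_measurable (powE n)"
  by (rule measurable_compose[OF measurable_kernel_restrict[OF assms(1)] nn_integral_measurable_subprob_algebra[OF assms(2)]])

lemma measurable_integral_kernel:
  fixes g :: "'a \<Rightarrow> real"
  assumes "k \<le> n" "g \<in> borel_measurable borel"
  shows "(\<lambda>x. \<integral>y. g y \<partial>\<kappa> k (restrict x {0..<k})) \<in> borel_measurable (powE n)"
  by (rule measurable_compose[OF measurable_kernel_restrict[OF assms(1)] integral_measurable_subprob_algebra[OF assms(2)]])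

lemma measurable_coordinate:
  assumes "k < n" "g \<in> borel_measurable borel"
  shows "(\<lambda>x. g (x k)) \<in> borel_measurable (powE n)"
proof -
  have "(\<lambda>x. x k) \<in> powE n \<rightarrow>\<^sub>M borel"
    using assms(1) by (intro measurable_component_singleton) auto
  then show ?thesis using assms(2) by (rule measurable_compose)
qed

lemma nn_integral_law_Suc:
  assumes f: "f \<in> borel_measurable (powE (Suc n))"
  shows "(\<integral>\<^sup>+x. f x \<partial>law (Suc n)) = (\<integral>\<^sup>+x. \<integral>\<^sup>+y. f (x(n := y)) \<partial>\<kappa> n x \<partial>law n)"
proof -
  have "(\<integral>\<^sup>+x. f x \<partial>law (Suc n)) = (\<integral>\<^sup>+x. \<integral>\<^sup>+z. f z \<partial>eP n x \<partial>law n)"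
    using f measurable_eP[of n] by (simp, subst nn_integral_bind[where B = "powE (Suc n)"]) (auto cong: measurable_cong_sets)
  also have "\<dots> = (\<integral>\<^sup>+x. \<integral>\<^sup>+y. f (x(n := y)) \<partial>\<kappa> n x \<partial>law n)"
    using f by (intro nn_integral_cong nn_integral_eP) auto
  finally show ?thesis .
qed

text \<open>
  Given the past, the coordinate \<open>k\<close> has law \<open>\<kappa> k\<close>, so \<open>g (x k)\<close> and its conditional mean have the same
  mean. This transfers the excess mass from the kernels to the empirical measure.
\<close>

lemma nn_integral_law_coordinates:
  assumes g: "g \<in> borel_measurable borel"
  shows "(\<integral>\<^sup>+x. (\<Sum>k<n. g (x k)) \<partial>law n) = (\<integral>\<^sup>+x. (\<Sum>k<n. \<integral>\<^sup>+y. g y \<partial>\<kappa> k (restrict x {0..<k})) \<partial>law n)"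
proof (induction n)
  case (Suc n)
  let ?G = "\<lambda>k x. \<integral>\<^sup>+y. g y \<partial>\<kappa> k (restrict x {0..<k})"
  have [measurable]: "(\<lambda>x. \<Sum>k<n. g (x k)) \<in> borel_measurable (powE n)"
    "(\<lambda>x. \<Sum>k<Suc n. g (x k)) \<in> borel_measurable (powE (Suc n))"
    using measurable_coordinate g by (auto intro!: borel_measurable_sum)
  have G [measurable]: "(\<lambda>x. \<Sum>k<n. ?G k x) \<in> borel_measurable (powE n)"
    "(\<lambda>x. \<Sum>k<Suc n. ?G k x) \<in> borel_measurable (powE (Suc n))"
    using measurable_nn_integral_kernel[OF _ g] by (auto intro!: borel_measurable_sum)
  have Gn [measurable]: "?G n \<in> borel_measurable (powE n)"
    using measurable_nn_integral_kernel[OF _ g] by auto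
  have 1: "(\<integral>\<^sup>+x. (\<Sum>k<Suc n. g (x k)) \<partial>law (Suc n)) = (\<integral>\<^sup>+x. (\<Sum>k<n. g (x k)) + ?G n x \<partial>law n)"
  proof (subst nn_integral_law_Suc, measurable, intro nn_integral_cong)
    fix x assume "x \<in> space (law n)"
    then have x: "x \<in> space (powE n)" by simp
    interpret prob_space "\<kappa> n x" by (rule prob_space_P[OF x])
    have [measurable]: "g \<in> borel_measurable (\<kappa> n x)" using g sets_P[OF x] by (simp cong: measurable_cong_sets)
    have "(\<integral>\<^sup>+y. (\<Sum>k<Suc n. g ((x(n := y)) k)) \<partial>\<kappa> n x) = (\<integral>\<^sup>+y. (\<Sum>k<n. g (x k)) + g y \<partial>\<kappa> n x)"
      by (intro nn_integral_cong) simp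
    also have "\<dots> = (\<Sum>k<n. g (x k)) + ?G n x"
      by (simp add: nn_integral_add emeasure_space_1 restrict_self[OF x])
    finally show "(\<integral>\<^sup>+y. (\<Sum>k<Suc n. g ((x(n := y)) k)) \<partial>\<kappa> n x) = (\<Sum>k<n. g (x k)) + ?G n x" .
  qed
  have 2: "(\<integral>\<^sup>+x. (\<Sum>k<Suc n. ?G k x) \<partial>law (Suc n)) = (\<integral>\<^sup>+x. (\<Sum>k<n. ?G k x) + ?G n x \<partial>law n)"
  proof (subst nn_integral_law_Suc[OF G(2)], intro nn_integral_cong)
    fix x assume "x \<in> space (law n)"
    then have x: "x \<in> space (powE n)" by simp
    interpret prob_space "\<kappa> n x" by (rule prob_space_P[OF x])
    show "(\<integral>\<^sup>+y. (\<Sum>k<Suc n. ?G k (x(n := y))) \<partial>\<kappa> n x) = (\<Sum>k<n. ?G k x) + ?G n x"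
      by (simp add: restrict_update emeasure_space_1 del: fun_upd_apply)
  qed
  have 3: "(\<integral>\<^sup>+x. (\<Sum>k<n. g (x k)) + ?G n x \<partial>law n) = (\<integral>\<^sup>+x. (\<Sum>k<n. g (x k)) \<partial>law n) + (\<integral>\<^sup>+x. ?G n x \<partial>law n)"
    by (rule nn_integral_add) measurable
  have 4: "(\<integral>\<^sup>+x. (\<Sum>k<n. ?G k x) + ?G n x \<partial>law n) = (\<integral>\<^sup>+x. (\<Sum>k<n. ?G k x) \<partial>law n) + (\<integral>\<^sup>+x. ?G n x \<partial>law n)"
    by (rule nn_integral_add) measurable
  show ?case unfolding 1 2 3 4 Suc.IH ..
qed simp

text \<open>
  The increments are orthogonal, and each has conditional variance at most \<open>R\<^sup>2\<close>.
\<close>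

lemma martingale_second_moment:
  fixes f :: "'a \<Rightarrow> real"
  assumes f: "f \<in> borel_measurable borel" and bound: "\<And>x. \<bar>f x\<bar> \<le> R"
  shows "(\<integral>\<^sup>+x. ennreal ((\<Sum>k<n. f (x k) - (\<integral>y. f y \<partial>\<kappa> k (restrict x {0..<k})))\<^sup>2) \<partial>law n) \<le> ennreal (real n * R\<^sup>2)"
proof (induction n)
  case (Suc n)
  let ?m = "\<lambda>k x. \<integral>y. f y \<partial>\<kappa> k (restrict x {0..<k})"
  let ?D = "\<lambda>n x. \<Sum>k<n. f (x k) - ?m k x"
  have D [measurable]: "?D n \<in> borel_measurable (powE n)" for n
    using measurable_coordinate[OF _ f] measurable_integral_kernel[OF _ f]
    by (intro borel_measurable_sum borel_measurable_diff) auto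
  have "(\<integral>\<^sup>+x. ennreal ((?D (Suc n) x)\<^sup>2) \<partial>law (Suc n)) = (\<integral>\<^sup>+x. \<integral>\<^sup>+y. ennreal ((?D (Suc n) (x(n := y)))\<^sup>2) \<partial>\<kappa> n x \<partial>law n)"
    by (rule nn_integral_law_Suc) measurable
  also have "\<dots> \<le> (\<integral>\<^sup>+x. ennreal ((?D n x)\<^sup>2) + ennreal (R\<^sup>2) \<partial>law n)"
  proof (rule nn_integral_mono)
    fix x assume "x \<in> space (law n)"
    then have x: "x \<in> space (powE n)" by simp
    interpret prob_space "\<kappa> n x" by (rule prob_space_P[OF x])
    have fm [measurable]: "f \<in> borel_measurable (\<kappa> n x)" using f sets_P[OF x] by (simp cong: measurable_cong_sets)
    have sq: "(f y)\<^sup>2 \<le> R\<^sup>2" for y using bound[of y] by (metis abs_ge_zero power2_abs power_mono)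
    have int: "integrable (\<kappa> n x) f" "integrable (\<kappa> n x) (\<lambda>y. (f y)\<^sup>2)"
      by (rule integrable_const_bound[where B = R], use bound in simp, measurable)
        (rule integrable_const_bound[where B = "R\<^sup>2"], use sq in simp, measurable)
    define m where "m = (\<integral>y. f y \<partial>\<kappa> n x)"
    define d where "d = ?D n x"
    have Dy: "?D (Suc n) (x(n := y)) = d + (f y - m)" for y
      by (simp add: d_def m_def restrict_update restrict_self[OF x])
    have expand: "(d + (f y - m))\<^sup>2 = (d - m)\<^sup>2 + 2 * (d - m) * f y + (f y)\<^sup>2" for y
      by (simp add: power2_eq_square algebra_simps)
    have "(\<integral>\<^sup>+y. ennreal ((?D (Suc n) (x(n := y)))\<^sup>2) \<partial>\<kappa> n x) = (\<integral>\<^sup>+y. ennreal ((d - m)\<^sup>2 + 2 * (d - m) * f y + (f y)\<^sup>2) \<partial>\<kappa> n x)"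
      by (simp only: Dy expand)
    also have "\<dots> = ennreal (\<integral>y. (d - m)\<^sup>2 + 2 * (d - m) * f y + (f y)\<^sup>2 \<partial>\<kappa> n x)"
    proof (rule nn_integral_eq_integral)
      show "AE y in \<kappa> n x. 0 \<le> (d - m)\<^sup>2 + 2 * (d - m) * f y + (f y)\<^sup>2"
        unfolding expand[symmetric] by simp
    qed (use int in auto)
    also have "\<dots> \<le> ennreal (d\<^sup>2 + R\<^sup>2)"
    proof (rule ennreal_leI)
      have "(\<integral>y. (d - m)\<^sup>2 + 2 * (d - m) * f y + (f y)\<^sup>2 \<partial>\<kappa> n x) = (d - m)\<^sup>2 + 2 * (d - m) * m + (\<integral>y. (f y)\<^sup>2 \<partial>\<kappa> n x)"
        using int by (simp add: m_def prob_space)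
      moreover have "(\<integral>y. (f y)\<^sup>2 \<partial>\<kappa> n x) \<le> (\<integral>y. R\<^sup>2 \<partial>\<kappa> n x)"
        using int sq by (intro integral_mono) auto
      moreover have "(d - m)\<^sup>2 + 2 * (d - m) * m = d\<^sup>2 - m\<^sup>2" by (simp add: power2_eq_square algebra_simps)
      moreover have "(\<integral>y. R\<^sup>2 \<partial>\<kappa> n x) = R\<^sup>2" by (simp add: prob_space)
      moreover have "0 \<le> m\<^sup>2" by simp
      ultimately show "(\<integral>y. (d - m)\<^sup>2 + 2 * (d - m) * f y + (f y)\<^sup>2 \<partial>\<kappa> n x) \<le> d\<^sup>2 + R\<^sup>2" by linarith
    qed
    also have "\<dots> = ennreal ((?D n x)\<^sup>2) + ennreal (R\<^sup>2)" by (simp add: d_def)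
    finally show "(\<integral>\<^sup>+y. ennreal ((?D (Suc n) (x(n := y)))\<^sup>2) \<partial>\<kappa> n x) \<le> ennreal ((?D n x)\<^sup>2) + ennreal (R\<^sup>2)" .
  qed
  also have "\<dots> = (\<integral>\<^sup>+x. ennreal ((?D n x)\<^sup>2) \<partial>law n) + ennreal (R\<^sup>2)"
    using prob_space.emeasure_space_1[OF prob_space_law[of n]] by (simp add: nn_integral_add)
  also have "\<dots> \<le> ennreal (real n * R\<^sup>2) + ennreal (R\<^sup>2)"
    by (rule add_right_mono[OF Suc.IH])
  also have "\<dots> = ennreal (real (Suc n) * R\<^sup>2)"
    by (simp add: algebra_simps flip: ennreal_plus)
  finally show ?case .
qed simp

end

lemma markov_real:
  assumes [measurable]: "u \<in> borel_measurable M" and u: "(\<integral>\<^sup>+x. u x \<partial>M) \<le> ennreal a" and c: "0 < c" and a: "0 \<le> a"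
  shows "emeasure M {x \<in> space M. ennreal c \<le> u x} \<le> ennreal (a / c)"
proof -
  have "emeasure M {x \<in> space M. ennreal c \<le> u x} \<le> emeasure M ({x \<in> space M. 1 \<le> ennreal (1 / c) * u x})"
  proof (rule emeasure_mono)
    show "{x \<in> space M. ennreal c \<le> u x} \<subseteq> {x \<in> space M. 1 \<le> ennreal (1 / c) * u x}"
    proof safe
      fix x assume "ennreal c \<le> u x"
      then have "ennreal (1 / c) * ennreal c \<le> ennreal (1 / c) * u x" by (rule mult_left_mono) simp
      then show "1 \<le> ennreal (1 / c) * u x" using c by (simp flip: ennreal_mult)
    qed
  qed measurable
  also have "\<dots> \<le> ennreal (1 / c) * (\<integral>\<^sup>+x. u x * indicator (space M) x \<partial>M)"
    by (rule nn_integral_Markov_inequality) auto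
  also have "\<dots> = ennreal (1 / c) * (\<integral>\<^sup>+x. u x \<partial>M)" by (simp cong: nn_integral_cong)
  also have "\<dots> \<le> ennreal (1 / c) * ennreal a" by (rule mult_left_mono[OF u]) simp
  also have "\<dots> = ennreal (a / c)" using a c by (simp flip: ennreal_mult)
  finally show ?thesis .
qed

locale psi_chain = kernel_chain \<kappa> + psi_growth \<psi>
  for \<kappa> :: "nat \<Rightarrow> (nat \<Rightarrow> 'a::polish_space) \<Rightarrow> 'a measure" and \<psi> :: "'a \<Rightarrow> real"
begin

text \<open>
  The difference between the integrals of \<open>f\<close> against the empirical measure and against the averaged
  kernels.
\<close>

definition deviation :: "nat \<Rightarrow> ('a \<Rightarrow> real) \<Rightarrow> (nat \<Rightarrow> 'a) \<Rightarrow> real" where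
  "deviation n f x = (\<Sum>k<n. f (x k)) / real n - (\<Sum>k<n. \<integral>y. f y \<partial>\<kappa> k (restrict x {0..<k})) / real n"

lemma measurable_deviation [measurable]:
  assumes "continuous_on UNIV f" shows "deviation n f \<in> borel_measurable (powE n)"
proof -
  have f: "f \<in> borel_measurable borel" by (rule borel_measurable_continuous_onI[OF assms])
  show ?thesis unfolding deviation_def
    using measurable_coordinate[OF _ f] measurable_integral_kernel[OF _ f]
    by (intro borel_measurable_sum borel_measurable_diff borel_measurable_divide) auto
qed

lemma in_probs_psi_if_excess_finite:
  assumes "\<nu> \<in> probs" "excess_integral R \<nu> < \<infinity>"
  shows "\<nu> \<in> probs_psi \<psi>"
proof -
  interpret prob_space \<nu> using assms(1) by (simp add: probs_iff)
  have [measurable]: "excess R \<in> borel_measurable \<nu>"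
    by (rule continuous_imp_measurable_probs[OF excess_cont assms(1)])
  have "(\<integral>\<^sup>+x. ennreal (\<psi> x) \<partial>\<nu>) \<le> (\<integral>\<^sup>+x. ennreal (real R) + ennreal (excess R x) \<partial>\<nu>)"
    by (intro nn_integral_mono) (auto simp: excess_def max_def ennreal_leI simp flip: ennreal_plus)
  also have "\<dots> < \<infinity>"
    using assms(2) by (simp add: nn_integral_add emeasure_space_1 less_top)
  finally show ?thesis using assms(1) by (simp add: probs_psi_def)
qed

text \<open>
  Split \<open>f = g + (f - g)\<close>, where \<open>g\<close> is \<open>f\<close> truncated at height \<open>R + 1\<close> and \<open>|f - g| \<le> (\<psi> - R)\<^sup>+\<close>. A
  deviation of size \<open>e\<close> forces the martingale of \<open>g\<close>, the excess under the empirical measure or the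
  excess under the kernels to contribute \<open>e / 3\<close>. The first is unlikely by Chebyshev's inequality,
  the other two by Markov's.
\<close>

lemma deviation_prob_le:
  assumes f: "continuous_on UNIV f" "\<And>x. \<bar>f x\<bar> \<le> 1 + \<psi> x" and e: "0 < e" and n: "0 < n" and \<delta>: "0 \<le> \<delta>"
    and excess: "(\<integral>\<^sup>+x. (\<Sum>k<n. excess_integral R (\<kappa> k (restrict x {0..<k}))) \<partial>law n) \<le> ennreal (real n * \<delta>)"
  shows "emeasure (law n) {x \<in> space (powE n). e \<le> \<bar>deviation n f x\<bar>}
    \<le> ennreal (9 * (real R + 1)\<^sup>2 / (real n * e\<^sup>2) + 6 * \<delta> / e)"
proof -
  define g where "g x = max (- (real R + 1)) (min (real R + 1) (f x))" for x
  have g_cont: "continuous_on UNIV g" unfolding g_def using f(1) by (intro continuous_intros)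
  have gm: "g \<in> borel_measurable borel" by (rule borel_measurable_continuous_onI[OF g_cont])
  have g_bound: "\<bar>g x\<bar> \<le> real R + 1" for x by (auto simp: g_def)
  have g_psi: "\<bar>g x\<bar> \<le> 1 + \<psi> x" for x using f(2)[of x] by (auto simp: g_def)
  have fg: "\<bar>f x - g x\<bar> \<le> excess R x" for x using f(2)[of x] by (auto simp: g_def excess_def)
  define D where "D x = (\<Sum>k<n. g (x k) - (\<integral>y. g y \<partial>\<kappa> k (restrict x {0..<k})))" for x
  define U where "U x = (\<Sum>k<n. ennreal (excess R (x k)))" for x
  define V where "V x = (\<Sum>k<n. excess_integral R (\<kappa> k (restrict x {0..<k})))" for x
  have em: "(\<lambda>y. ennreal (excess R y)) \<in> borel_measurable borel" by measurable
  have [measurable]: "D \<in> borel_measurable (powE n)" "U \<in> borel_measurable (powE n)" "V \<in> borel_measurable (powE n)"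
    using measurable_coordinate[OF _ gm] measurable_integral_kernel[OF _ gm]
      measurable_coordinate[OF _ em] measurable_nn_integral_kernel[OF _ em]
    unfolding D_def U_def V_def
    by (auto intro!: borel_measurable_sum borel_measurable_diff)
  define t where "t = real n * e / 3"
  have t: "0 < t" using n e by (simp add: t_def)
  let ?B = "{x \<in> space (powE n). e \<le> \<bar>deviation n f x\<bar>}"
  let ?B1 = "{x \<in> space (powE n). ennreal (t\<^sup>2) \<le> ennreal ((D x)\<^sup>2)}"
  let ?B2 = "{x \<in> space (powE n). ennreal t \<le> U x}"
  let ?B3 = "{x \<in> space (powE n). ennreal t \<le> V x}"
  have sub: "?B \<subseteq> ?B1 \<union> (?B2 \<union> ?B3)"
  proof (rule subsetI, rule ccontr)
    fix x assume xB: "x \<in> ?B" "x \<notin> ?B1 \<union> (?B2 \<union> ?B3)"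
    then have x: "x \<in> space (powE n)" "e \<le> \<bar>deviation n f x\<bar>" "\<not> ennreal t \<le> V x" "\<not> ennreal t \<le> U x"
      by auto
    let ?k = "\<lambda>k. \<kappa> k (restrict x {0..<k})"
    have kP: "?k k \<in> probs" if "k < n" for k
      using that x(1) by (intro kernel_in_probs restrict_in_space) auto
    have V: "V x < ennreal t" using x(3) by simp
    have "excess_integral R (?k k) < \<infinity>" if "k < n" for k
    proof -
      have "excess_integral R (?k k) \<le> V x"
        unfolding V_def using that by (intro member_le_sum) auto
      also note V
      finally show ?thesis by (rule order.strict_trans) simp
    qed
    then have kpsi: "?k k \<in> probs_psi \<psi>" if "k < n" for k
      using in_probs_psi_if_excess_finite kP that by blast
    have int: "integrable (?k k) f" "integrable (?k k) g" "integrable (?k k) (excess R)" if "k < n" for k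
      using dominated_integrable[OF kpsi[OF that]] f g_cont g_psi excess_cont excess_le by blast+
    have "V x = (\<Sum>k<n. ennreal (\<integral>y. excess R y \<partial>?k k))"
      unfolding V_def by (intro sum.cong nn_integral_eq_integral int) (auto simp: excess_nonneg)
    also have "\<dots> = ennreal (\<Sum>k<n. \<integral>y. excess R y \<partial>?k k)"
      by (intro sum_ennreal) (auto simp: excess_nonneg)
    finally have Veq: "V x = ennreal (\<Sum>k<n. \<integral>y. excess R y \<partial>?k k)" .
    have "0 \<le> (\<Sum>k<n. \<integral>y. excess R y \<partial>?k k)"
      by (intro sum_nonneg integral_nonneg) (auto simp: excess_nonneg)
    then have V': "(\<Sum>k<n. \<integral>y. excess R y \<partial>?k k) < t"
      using V unfolding Veq by (simp add: ennreal_less_iff)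
    have "U x = ennreal (\<Sum>k<n. excess R (x k))"
      unfolding U_def by (intro sum_ennreal) (auto simp: excess_nonneg)
    then have U': "(\<Sum>k<n. excess R (x k)) < t"
      using x(4) by (metis ennreal_leI not_le)
    have dev: "real n * deviation n f x = D x + (\<Sum>k<n. f (x k) - g (x k)) - (\<Sum>k<n. (\<integral>y. f y \<partial>?k k) - (\<integral>y. g y \<partial>?k k))"
      using n by (simp add: deviation_def D_def sum_subtractf right_diff_distrib)
    have "\<bar>\<Sum>k<n. f (x k) - g (x k)\<bar> \<le> (\<Sum>k<n. excess R (x k))"
      by (intro order_trans[OF sum_abs] sum_mono fg)
    moreover have "\<bar>\<Sum>k<n. (\<integral>y. f y \<partial>?k k) - (\<integral>y. g y \<partial>?k k)\<bar> \<le> (\<Sum>k<n. \<integral>y. excess R y \<partial>?k k)"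
    proof (intro order_trans[OF sum_abs] sum_mono)
      fix k assume "k \<in> {..<n}"
      then have k: "k < n" by simp
      have "\<bar>(\<integral>y. f y \<partial>?k k) - (\<integral>y. g y \<partial>?k k)\<bar> = \<bar>\<integral>y. f y - g y \<partial>?k k\<bar>"
        using int[OF k] by simp
      also have "\<dots> \<le> (\<integral>y. \<bar>f y - g y\<bar> \<partial>?k k)"
        by (rule integral_abs_bound)
      also have "\<dots> \<le> (\<integral>y. excess R y \<partial>?k k)"
        using int[OF k] fg by (intro integral_mono) auto
      finally show "\<bar>(\<integral>y. f y \<partial>?k k) - (\<integral>y. g y \<partial>?k k)\<bar> \<le> (\<integral>y. excess R y \<partial>?k k)" .
    qed
    moreover have "3 * t \<le> \<bar>real n * deviation n f x\<bar>"
      using x(2) n by (simp add: t_def abs_mult)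
    ultimately have "t \<le> \<bar>D x\<bar>" using dev U' V' by linarith
    then have "t\<^sup>2 \<le> (D x)\<^sup>2" using t by (metis abs_le_square_iff abs_of_pos)
    then have "ennreal (t\<^sup>2) \<le> ennreal ((D x)\<^sup>2)" by (rule ennreal_leI)
    then show False using xB(2) x(1) by blast
  qed
  have "emeasure (law n) ?B \<le> emeasure (law n) (?B1 \<union> (?B2 \<union> ?B3))"
    by (rule emeasure_mono[OF sub]) measurable
  also have "\<dots> \<le> emeasure (law n) ?B1 + (emeasure (law n) ?B2 + emeasure (law n) ?B3)"
  proof -
    have s: "?B1 \<in> sets (law n)" "?B2 \<in> sets (law n)" "?B3 \<in> sets (law n)" by measurable
    show ?thesis
      using emeasure_subadditive[OF s(1) sets.Un[OF s(2,3)]] emeasure_subadditive[OF s(2,3)]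
      by (meson add_left_mono order_trans)
  qed
  also have "\<dots> \<le> ennreal (real n * (real R + 1)\<^sup>2 / t\<^sup>2) + (ennreal (real n * \<delta> / t) + ennreal (real n * \<delta> / t))"
  proof (intro add_mono)
    show "emeasure (law n) ?B1 \<le> ennreal (real n * (real R + 1)\<^sup>2 / t\<^sup>2)"
      using markov_real[of "\<lambda>x. ennreal ((D x)\<^sup>2)" "law n" "real n * (real R + 1)\<^sup>2" "t\<^sup>2"]
        martingale_second_moment[OF gm g_bound, of n] t
      unfolding D_def[symmetric] by simp
    have "(\<integral>\<^sup>+x. U x \<partial>law n) \<le> ennreal (real n * \<delta>)"
      unfolding U_def nn_integral_law_coordinates[OF em] by (rule excess)
    then show "emeasure (law n) ?B2 \<le> ennreal (real n * \<delta> / t)"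
      using markov_real[of U "law n" "real n * \<delta>" t] t \<delta> by simp
    show "emeasure (law n) ?B3 \<le> ennreal (real n * \<delta> / t)"
      using markov_real[of V "law n" "real n * \<delta>" t] t \<delta> excess unfolding V_def[symmetric] by simp
  qed
  also have "\<dots> = ennreal (real n * (real R + 1)\<^sup>2 / t\<^sup>2 + (real n * \<delta> / t + real n * \<delta> / t))"
    using t \<delta> by (simp flip: ennreal_plus)
  also have "real n * (real R + 1)\<^sup>2 / t\<^sup>2 + (real n * \<delta> / t + real n * \<delta> / t) = 9 * (real R + 1)\<^sup>2 / (real n * e\<^sup>2) + 6 * \<delta> / e"
    using n e by (simp add: t_def field_simps power2_eq_square)
  finally show ?thesis .
qed

end

section \<open>Existence and uniqueness of disintegrations\<close>

text \<open>
  Allows the kernel for the last coordinate to be added to a disintegration of the first \<open>n\<close> ones.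
\<close>

lemma Ionescu_Tulcea_C_cong:
  assumes "Ionescu_Tulcea \<kappa> M" "Ionescu_Tulcea \<kappa>' M" "\<And>i. i < n \<Longrightarrow> \<kappa> i = \<kappa>' i"
  shows "Ionescu_Tulcea.C \<kappa> M 0 n x = Ionescu_Tulcea.C \<kappa>' M 0 n x"
  using assms(3)
proof (induction n)
  case (Suc n)
  interpret A: Ionescu_Tulcea \<kappa> M by fact
  interpret B: Ionescu_Tulcea \<kappa>' M by fact
  have "A.eP n = B.eP n" using Suc.prems[of n] by (intro ext) (simp add: A.eP_def B.eP_def)
  with Suc show ?case by simp
qed (simp add: Ionescu_Tulcea.C.simps[OF assms(1)] Ionescu_Tulcea.C.simps[OF assms(2)])

text \<open>
  Induction on \<open>n\<close>, splitting off the last coordinate with a regular conditional distribution given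
  the others.
\<close>

lemma disintegration_exists:
  fixes \<nu> :: "(nat \<Rightarrow> 'a::polish_space) measure"
  assumes "sets \<nu> = sets (powE n)" "prob_space \<nu>"
  shows "\<exists>\<kappa>. disintegrates n \<nu> \<kappa>"
  using assms
proof (induction n arbitrary: \<nu>)
  case 0
  interpret prob_space \<nu> by fact
  define \<kappa> :: "nat \<Rightarrow> (nat \<Rightarrow> 'a) \<Rightarrow> 'a measure" where "\<kappa> k x = return borel undefined" for k x
  have IT: "Ionescu_Tulcea \<kappa> (\<lambda>_. borel)"
  proof (rule Ionescu_Tulcea.intro)
    have p: "prob_space (return borel (undefined :: 'a))" by (rule prob_space_return) simp
    have "return borel (undefined :: 'a) \<in> space (subprob_algebra borel)"
      using p by (simp add: space_subprob_algebra prob_space_imp_subprob_space)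
    fix i
    from \<open>return borel (undefined :: 'a) \<in> space (subprob_algebra borel)\<close>
    show "\<kappa> i \<in> powE i \<rightarrow>\<^sub>M subprob_algebra borel" unfolding \<kappa>_def by (rule measurable_const)
    show "prob_space (\<kappa> i x)" if "x \<in> space (powE i)" for x unfolding \<kappa>_def by (rule p)
  qed
  interpret Ionescu_Tulcea \<kappa> "\<lambda>_. borel" by (rule IT)
  have sp: "space \<nu> = {\<lambda>_. undefined}"
    using sets_eq_imp_space_eq[OF 0(1)] by (simp add: space_PiM)
  have "\<nu> = return (powE 0) (\<lambda>_. undefined)"
  proof (rule measure_eqI)
    fix A assume "A \<in> sets \<nu>"
    then have A: "A \<in> sets (powE 0)" "A \<subseteq> {\<lambda>_. undefined}"
      using 0(1) sets.sets_into_space[of A \<nu>] sp by auto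
    then have "A = {} \<or> A = space \<nu>" using sp by auto
    then show "emeasure \<nu> A = emeasure (return (powE 0) (\<lambda>_. undefined)) A"
    proof
      assume "A = space \<nu>"
      then show ?thesis unfolding emeasure_return[OF A(1)] using emeasure_space_1 by (simp add: sp)
    qed simp
  qed (use 0 in simp)
  then have "disintegrates 0 \<nu> \<kappa>"
    unfolding disintegrates_def using Ionescu_Tulcea_axioms by simp
  then show ?case by blast
next
  case (Suc n)
  interpret \<nu>: prob_space \<nu> by fact
  note Suc.prems(1)[measurable_cong]
  have resm: "(\<lambda>x. restrict x {0..<n}) \<in> \<nu> \<rightarrow>\<^sub>M powE n"
    unfolding measurable_cong_sets[OF Suc.prems(1) refl] by (intro measurable_restrict_subset) auto
  have cm: "(\<lambda>x. x n) \<in> \<nu> \<rightarrow>\<^sub>M borel"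
    unfolding measurable_cong_sets[OF Suc.prems(1) refl] by (intro measurable_component_singleton) auto
  have "sets (distr \<nu> (powE n) (\<lambda>x. restrict x {0..<n})) = sets (powE n)" by simp
  from Suc.IH[OF this \<nu>.prob_space_distr[OF resm]]
  obtain \<kappa> where \<kappa>: "Ionescu_Tulcea \<kappa> (\<lambda>_. borel)"
    "distr \<nu> (powE n) (\<lambda>x. restrict x {0..<n}) = Ionescu_Tulcea.C \<kappa> (\<lambda>_. borel) 0 n (\<lambda>_. undefined)"
    unfolding disintegrates_def by blast
  define Q where "Q = distr \<nu> (powE n \<Otimes>\<^sub>M borel) (\<lambda>x. (restrict x {0..<n}, x n))"
  have Qm: "(\<lambda>x. (restrict x {0..<n}, x n)) \<in> \<nu> \<rightarrow>\<^sub>M powE n \<Otimes>\<^sub>M borel"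
    by (rule measurable_Pair[OF resm cm])
  have Q: "sets Q = sets (powE n \<Otimes>\<^sub>M borel)" "prob_space Q"
    unfolding Q_def using \<nu>.prob_space_distr[OF Qm] by simp_all
  have Q\<mu>: "distr Q (powE n) fst = distr \<nu> (powE n) (\<lambda>x. restrict x {0..<n})"
    unfolding Q_def by (subst distr_distr[OF _ Qm]) (auto simp: comp_def)
  obtain k where k: "prob_kernel (powE n) borel k"
    "\<And>f. f \<in> borel_measurable (powE n \<Otimes>\<^sub>M borel) \<Longrightarrow> (\<integral>\<^sup>+z. f z \<partial>Q) = (\<integral>\<^sup>+x. \<integral>\<^sup>+y. f (x, y) \<partial>k x \<partial>distr Q (powE n) fst)"
    by (rule regular_conditional[OF Q]) blast
  define \<kappa>' where "\<kappa>' = \<kappa>(n := k)"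
  interpret A: kernel_chain \<kappa> unfolding kernel_chain_def by (rule \<kappa>(1))
  have IT': "Ionescu_Tulcea \<kappa>' (\<lambda>_. borel)"
  proof (rule Ionescu_Tulcea.intro)
    fix i
    show "\<kappa>' i \<in> powE i \<rightarrow>\<^sub>M subprob_algebra borel"
      using A.P[of i] k(1) by (cases "i = n") (auto simp: \<kappa>'_def prob_kernel_def)
    show "prob_space (\<kappa>' i x)" if "x \<in> space (powE i)" for x
      using A.prob_space_P[OF that] k(1) that by (cases "i = n") (auto simp: \<kappa>'_def prob_kernel_def)
  qed
  interpret B: kernel_chain \<kappa>' unfolding kernel_chain_def by (rule IT')
  have law: "B.law n = distr Q (powE n) fst"
    unfolding Q\<mu> \<kappa>(2) by (rule Ionescu_Tulcea_C_cong[OF IT' \<kappa>(1)]) (simp add: \<kappa>'_def)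
  have "\<nu> = B.law (Suc n)"
  proof (rule measure_eqI)
    show "sets \<nu> = sets (B.law (Suc n))" by (simp only: Suc.prems(1) B.sets_law)
    fix X assume "X \<in> sets \<nu>"
    then have X: "X \<in> sets (powE (Suc n))" using Suc.prems(1) by simp
    have up: "(\<lambda>z. (fst z)(n := snd z)) \<in> powE n \<Otimes>\<^sub>M borel \<rightarrow>\<^sub>M powE (Suc n)"
      by (rule measurable_fun_upd[where J = "{0..<n}"]) (auto simp: atLeast0_lessThan_Suc)
    have fm: "(\<lambda>z. indicator X ((fst z)(n := snd z)) :: ennreal) \<in> borel_measurable (powE n \<Otimes>\<^sub>M borel)"
      by (rule measurable_compose[OF up]) (use X in simp)
    have "emeasure \<nu> X = (\<integral>\<^sup>+x. indicator X x \<partial>\<nu>)" using \<open>X \<in> sets \<nu>\<close> by simp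
    also have "\<dots> = (\<integral>\<^sup>+x. indicator X ((restrict x {0..<n})(n := x n)) \<partial>\<nu>)"
    proof (rule nn_integral_cong)
      fix x assume "x \<in> space \<nu>"
      then have "x \<in> space (powE (Suc n))" using sets_eq_imp_space_eq[OF Suc.prems(1)] by simp
      then have "(restrict x {0..<n})(n := x n) = x"
        by (auto simp: space_PiM PiE_iff extensional_def fun_eq_iff restrict_def)
      then show "indicator X x = (indicator X ((restrict x {0..<n})(n := x n)) :: ennreal)" by simp
    qed
    also have "\<dots> = (\<integral>\<^sup>+z. indicator X ((fst z)(n := snd z)) \<partial>Q)"
      unfolding Q_def by (subst nn_integral_distr[OF Qm]) (use fm in simp_all)
    also have "\<dots> = (\<integral>\<^sup>+x. \<integral>\<^sup>+y. indicator X (x(n := y)) \<partial>\<kappa>' n x \<partial>B.law n)"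
      unfolding k(2)[OF fm] law by (simp add: \<kappa>'_def)
    also have "\<dots> = (\<integral>\<^sup>+x. indicator X x \<partial>B.law (Suc n))"
      by (rule B.nn_integral_law_Suc[symmetric]) (use X in simp)
    also have "\<dots> = emeasure (B.law (Suc n)) X"
      by (rule nn_integral_indicator) (use X in \<open>simp only: B.sets_law\<close>)
    finally show "emeasure \<nu> X = emeasure (B.law (Suc n)) X" .
  qed
  then have "disintegrates (Suc n) \<nu> \<kappa>'" unfolding disintegrates_def using IT' by blast
  then show ?case by blast
qed

lemma disintegrates_disintegration:
  fixes \<nu> :: "(nat \<Rightarrow> 'a::polish_space) measure"
  assumes "\<nu> \<in> space (prob_algebra (powE n))"
  shows "disintegrates n \<nu> (disintegration n \<nu>)"
proof -
  have "\<exists>\<kappa>. disintegrates n \<nu> \<kappa>"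
    using assms by (intro disintegration_exists) (auto simp: space_prob_algebra)
  then show ?thesis unfolding disintegration_def by (rule someI_ex)
qed

text \<open>
  Countability lets a null set be discarded for each generator; stability under intersection makes
  measures agreeing on the generator equal.
\<close>

lemma countable_borel_generator:
  obtains G :: "'a::second_countable_topology set set"
  where "countable G" "Int_stable G" "\<And>A. A \<in> G \<Longrightarrow> A \<in> sets borel" "sets borel = sigma_sets UNIV G"
proof -
  obtain \<B> :: "'a set set" where \<B>: "countable \<B>" "topological_basis \<B>" using ex_countable_basis by blast
  define G where "G = Inter ` {F. finite F \<and> F \<subseteq> \<B>}"
  have op: "open A" if "A \<in> G" for A
    using that topological_basis_open[OF \<B>(2)] by (auto simp: G_def intro!: open_Inter)
  have "countable G" unfolding G_def using \<B>(1) by (intro countable_image countable_Collect_finite_subset)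
  moreover have "Int_stable G"
  proof (rule Int_stableI)
    fix a b assume "a \<in> G" "b \<in> G"
    then obtain F F' where "finite F" "F \<subseteq> \<B>" "a = \<Inter>F" "finite F'" "F' \<subseteq> \<B>" "b = \<Inter>F'" by (auto simp: G_def)
    then show "a \<inter> b \<in> G" unfolding G_def by (intro image_eqI[of _ _ "F \<union> F'"]) auto
  qed
  moreover have "sets borel = sigma_sets UNIV G"
  proof
    have "\<B> \<subseteq> G"
    proof
      fix b assume "b \<in> \<B>"
      then show "b \<in> G" unfolding G_def by (intro image_eqI[of _ _ "{b}"]) auto
    qed
    then show "sets borel \<subseteq> sigma_sets UNIV G"
      using sigma_sets_mono'[of \<B> G] by (subst borel_eq_countable_basis[OF \<B>]) simp
    show "sigma_sets UNIV G \<subseteq> sets borel"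
      using op by (intro sets.sigma_sets_subset[of G borel, simplified space_borel]) auto
  qed
  ultimately show thesis using that op by blast
qed

lemma AE_eq_probs_from_sets:
  fixes k :: "'b \<Rightarrow> 'a::second_countable_topology measure"
  assumes k: "\<And>x. x \<in> space M \<Longrightarrow> k x \<in> probs" and \<mu>: "\<mu> \<in> probs"
    and ae: "\<And>B. B \<in> sets borel \<Longrightarrow> AE x in M. emeasure (k x) B = emeasure \<mu> B"
  shows "AE x in M. k x = \<mu>"
proof -
  obtain G :: "'a set set" where G: "countable G" "Int_stable G" "\<And>A. A \<in> G \<Longrightarrow> A \<in> sets borel" "sets borel = sigma_sets UNIV G"
    by (rule countable_borel_generator) blast
  have "AE x in M. \<forall>B\<in>G. emeasure (k x) B = emeasure \<mu> B"
    using ae G(1,3) by (subst AE_ball_countable) auto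
  then show ?thesis using AE_space
  proof eventually_elim
    case (elim x)
    have kx: "sets (k x) = sets borel" "prob_space (k x)" and m: "sets \<mu> = sets borel" "prob_space \<mu>"
      using k[OF elim(2)] \<mu> by (auto simp: probs_iff)
    interpret k: prob_space "k x" by fact
    interpret m: prob_space \<mu> by fact
    show ?case
    proof (rule measure_eqI_generator_eq_countable[where \<Omega> = UNIV and E = "insert UNIV G" and A = "{UNIV}"])
      show "Int_stable (insert UNIV G)" using G(2) by (auto simp: Int_stable_def)
      have "emeasure (k x) UNIV = emeasure \<mu> UNIV"
        using k.emeasure_space_1 m.emeasure_space_1 probs_space[OF k[OF elim(2)]] probs_space[OF \<mu>] by simp
      then show "\<And>X. X \<in> insert UNIV G \<Longrightarrow> emeasure (k x) X = emeasure \<mu> X" using elim(1) by auto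
      have "sigma_sets UNIV (insert UNIV G) = sets borel"
      proof
        show "sigma_sets UNIV (insert UNIV G) \<subseteq> sets borel"
          using G(3) by (intro sets.sigma_sets_subset[of "insert UNIV G" borel, simplified space_borel]) auto
        show "sets borel \<subseteq> sigma_sets UNIV (insert UNIV G)"
          unfolding G(4) by (rule sigma_sets_mono') auto
      qed
      then show "sets (k x) = sigma_sets UNIV (insert UNIV G)" "sets \<mu> = sigma_sets UNIV (insert UNIV G)"
        using kx m by simp_all
    qed auto
  qed
qed

text \<open>
  A disintegration is unique up to null sets, and the constant kernel \<open>\<mu>\<close> is one for the product law.
  For fixed \<open>B\<close>, the integrals of \<open>\<kappa> k x B\<close> and of the constant \<open>\<mu> B\<close> over any set \<open>A\<close> both equal
  the product measure of \<open>A \<times> B\<close>.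
\<close>

lemma (in kernel_chain) kernels_of_product_law:
  assumes \<mu>: "\<mu> \<in> probs" and law: "law n = PiM {0..<n} (\<lambda>_. \<mu>)" and k: "k < n"
  shows "AE x in law n. \<kappa> k (restrict x {0..<k}) = \<mu>"
proof -
  have s\<mu>: "sets \<mu> = sets borel" and p\<mu>: "prob_space \<mu>" using \<mu> by (auto simp: probs_iff)
  interpret \<mu>: prob_space \<mu> by fact
  interpret prod: product_prob_space "\<lambda>_::nat. \<mu>" UNIV by standard
  have sP: "sets (PiM {0..<m} (\<lambda>_. \<mu>)) = sets (powE m)" for m by (intro sets_PiM_cong) (auto simp: s\<mu>)
  have resm: "(\<lambda>x. restrict x {0..<j}) \<in> law n \<rightarrow>\<^sub>M powE j" if "j \<le> n" for j
    unfolding measurable_cong_sets[OF sets_law refl] using that by (intro measurable_restrict_subset) auto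
  have d: "law j = distr (law n) (powE j) (\<lambda>x. restrict x {0..<j})" if "j \<le> n" for j
    using distr_C[OF that undefined_in_space] by simp
  have lawj: "law j = PiM {0..<j} (\<lambda>_. \<mu>)" if "j \<le> n" for j
  proof -
    have "law j = distr (PiM {0..<n} (\<lambda>_. \<mu>)) (PiM {0..<j} (\<lambda>_. \<mu>)) (\<lambda>x. restrict x {0..<j})"
      unfolding d[OF that] law by (rule distr_cong) (auto simp: sP)
    also have "\<dots> = PiM {0..<j} (\<lambda>_. \<mu>)"
      using that by (intro prod.distr_restrict[symmetric]) auto
    finally show ?thesis .
  qed
  interpret L: prob_space "law k" by (rule prob_space_law)
  have ae: "AE x in law k. emeasure (\<kappa> k x) B = emeasure \<mu> B" if B: "B \<in> sets borel" for B
  proof (rule L.density_unique_finite_measure)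
    show "(\<lambda>x. emeasure (\<kappa> k x) B) \<in> borel_measurable (law k)"
      unfolding measurable_cong_sets[OF sets_law refl]
      by (rule measurable_compose[OF P measurable_emeasure_subprob_algebra[OF B]])
    fix A assume "A \<in> sets (law k)"
    then have A: "A \<in> sets (powE k)" by simp
    define f where "f z = (indicator B (z k) * indicator A (restrict z {0..<k}) :: ennreal)" for z
    have fm: "f \<in> borel_measurable (powE (Suc k))"
    proof -
      have "(\<lambda>z. indicator B (z k) :: ennreal) \<in> borel_measurable (powE (Suc k))"
        by (rule measurable_coordinate) (use B in auto)
      moreover have "(\<lambda>z. indicator A (restrict z {0..<k}) :: ennreal) \<in> borel_measurable (powE (Suc k))"
        by (rule measurable_compose[OF measurable_restrict_subset]) (use A in auto)
      ultimately show ?thesis unfolding f_def by measurable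
    qed
    have inner: "(\<integral>\<^sup>+y. f (x(k := y)) \<partial>N) = emeasure N B * indicator A x"
      if x: "x \<in> space (powE k)" and N: "sets N = sets borel" for x N
    proof -
      have "(\<integral>\<^sup>+y. f (x(k := y)) \<partial>N) = (\<integral>\<^sup>+y. indicator A x * indicator B y \<partial>N)"
        by (intro nn_integral_cong) (simp add: f_def restrict_update restrict_self[OF x] del: fun_upd_apply, simp add: mult.commute)
      also have "\<dots> = indicator A x * emeasure N B"
        using B by (intro nn_integral_cmult_indicator) (simp add: N)
      finally show ?thesis by (simp only: mult.commute)
    qed
    have "(\<integral>\<^sup>+x. emeasure (\<kappa> k x) B * indicator A x \<partial>law k) = (\<integral>\<^sup>+x. \<integral>\<^sup>+y. f (x(k := y)) \<partial>\<kappa> k x \<partial>law k)"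
      by (intro nn_integral_cong inner[symmetric]) (simp_all add: sets_P)
    also have "\<dots> = (\<integral>\<^sup>+z. f z \<partial>law (Suc k))"
      by (rule nn_integral_law_Suc[OF fm, symmetric])
    also have "\<dots> = (\<integral>\<^sup>+z. f z \<partial>PiM (insert k {0..<k}) (\<lambda>_. \<mu>))"
      using lawj[of "Suc k"] k by (simp add: atLeast0_lessThan_Suc)
    also have "\<dots> = (\<integral>\<^sup>+x. \<integral>\<^sup>+y. f (x(k := y)) \<partial>\<mu> \<partial>PiM {0..<k} (\<lambda>_. \<mu>))"
    proof (rule prod.product_nn_integral_insert)
      have "sets (PiM (insert k {0..<k}) (\<lambda>_. \<mu>)) = sets (powE (Suc k))"
        using sP[of "Suc k"] by (simp add: atLeast0_lessThan_Suc)
      then show "f \<in> borel_measurable (PiM (insert k {0..<k}) (\<lambda>_. \<mu>))"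
        using fm by (simp cong: measurable_cong_sets)
    qed auto
    also have "\<dots> = (\<integral>\<^sup>+x. emeasure \<mu> B * indicator A x \<partial>PiM {0..<k} (\<lambda>_. \<mu>))"
      by (intro nn_integral_cong inner s\<mu>) (simp add: sets_eq_imp_space_eq[OF sP])
    also have "\<dots> = (\<integral>\<^sup>+x. emeasure \<mu> B * indicator A x \<partial>law k)"
      using lawj[of k] k by simp
    finally show "(\<integral>\<^sup>+x. emeasure (\<kappa> k x) B * indicator A x \<partial>law k) = (\<integral>\<^sup>+x. emeasure \<mu> B * indicator A x \<partial>law k)" .
  qed auto
  have "AE x in law k. \<kappa> k x = \<mu>"
    by (rule AE_eq_probs_from_sets[OF _ \<mu> ae]) (simp add: kernel_in_probs)
  then have "AE x in distr (law n) (powE k) (\<lambda>x. restrict x {0..<k}). \<kappa> k x = \<mu>"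
    unfolding d[OF less_imp_le[OF k], symmetric] .
  then show ?thesis by (rule AE_distrD[OF resm, rotated]) (use k in simp)
qed

abbreviation scaled_gain :: "('a::topological_space measure \<Rightarrow> ereal) \<Rightarrow> nat \<Rightarrow> (nat \<Rightarrow> 'a) \<Rightarrow> ereal" where
  "scaled_gain F n \<equiv> \<lambda>x. ereal (real n) * F (empirical n x)"

section \<open>Empirical measures\<close>

lemma (in psi_growth)
  fixes x :: "nat \<Rightarrow> 'a"
  assumes n: "0 < n"
  shows empirical_in_probs_psi: "empirical n x \<in> probs_psi \<psi>"
    and integral_empirical: "f \<in> borel_measurable borel \<Longrightarrow> (\<integral>y. f y \<partial>empirical n x) = (\<Sum>k<n. f (x k) :: real) / real n"
proof -
  note E = empirical_eq_avg[OF n, of x]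
  have P: "empirical n x \<in> probs"
    unfolding E by (intro avg_in_probs n) (auto simp: probs_iff intro!: prob_space_return)
  have "(\<integral>\<^sup>+y. ennreal (\<psi> y) \<partial>empirical n x) = (\<Sum>k<n. ennreal (1 / real n) * ennreal (\<psi> (x k)))"
    unfolding E using borel_measurable_continuous_onI[OF psi_cont]
    by (subst nn_integral_weighted_sum) (auto simp: nn_integral_return)
  also have "\<dots> < \<infinity>" by (simp add: ennreal_mult_less_top)
  finally show "empirical n x \<in> probs_psi \<psi>" using P by (simp add: probs_psi_def)
  assume f: "f \<in> borel_measurable borel"
  have "integrable (return borel (x i)) f" for i
    using f by (simp add: integrable_iff_bounded nn_integral_return)
  then have "(\<integral>y. f y \<partial>empirical n x) = (\<Sum>k<n. (1 / real n) * (\<integral>y. f y \<partial>return borel (x k)))"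
    unfolding E using f by (intro integral_weighted_sum(2)) auto
  also have "\<dots> = (\<Sum>k<n. f (x k)) / real n"
    using f by (simp add: integral_return sum_divide_distrib)
  finally show "(\<integral>y. f y \<partial>empirical n x) = (\<Sum>k<n. f (x k)) / real n" .
qed

lemma (in psi_chain) deviations_prob_le:
  assumes \<Phi>: "finite \<Phi>" "\<And>f. f \<in> \<Phi> \<Longrightarrow> continuous_on UNIV f" "\<And>f x. f \<in> \<Phi> \<Longrightarrow> \<bar>f x\<bar> \<le> 1 + \<psi> x"
    and e: "0 < e" and n: "0 < n" and \<delta>: "0 \<le> \<delta>"
    and excess: "(\<integral>\<^sup>+x. (\<Sum>k<n. excess_integral R (\<kappa> k (restrict x {0..<k}))) \<partial>law n) \<le> ennreal (real n * \<delta>)"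
  shows "{x \<in> space (powE n). \<exists>f\<in>\<Phi>. e \<le> \<bar>deviation n f x\<bar>} \<in> sets (powE n)"
    and "measure (law n) {x \<in> space (powE n). \<exists>f\<in>\<Phi>. e \<le> \<bar>deviation n f x\<bar>}
      \<le> real (card \<Phi>) * (9 * (real R + 1)\<^sup>2 / (real n * e\<^sup>2) + 6 * \<delta> / e)"
proof -
  let ?b = "9 * (real R + 1)\<^sup>2 / (real n * e\<^sup>2) + 6 * \<delta> / e"
  let ?B = "\<lambda>f. {x \<in> space (powE n). e \<le> \<bar>deviation n f x\<bar>}"
  have b: "0 \<le> ?b" using e n \<delta> by simp
  have eq: "{x \<in> space (powE n). \<exists>f\<in>\<Phi>. e \<le> \<bar>deviation n f x\<bar>} = (\<Union>f\<in>\<Phi>. ?B f)" by auto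
  have s: "?B f \<in> sets (powE n)" if "f \<in> \<Phi>" for f
    using measurable_deviation[OF \<Phi>(2)[OF that], of n] by measurable
  then show "{x \<in> space (powE n). \<exists>f\<in>\<Phi>. e \<le> \<bar>deviation n f x\<bar>} \<in> sets (powE n)"
    unfolding eq using \<Phi>(1) by (intro sets.finite_UN) auto
  interpret prob_space "law n" by (rule prob_space_law)
  have "measure (law n) (\<Union>f\<in>\<Phi>. ?B f) \<le> (\<Sum>f\<in>\<Phi>. measure (law n) (?B f))"
    using s \<Phi>(1) by (intro finite_measure_subadditive_finite) auto
  also have "\<dots> \<le> (\<Sum>f\<in>\<Phi>. ?b)"
  proof (rule sum_mono)
    fix f assume f: "f \<in> \<Phi>"
    show "measure (law n) (?B f) \<le> ?b"
      using deviation_prob_le[OF \<Phi>(2)[OF f] \<Phi>(3)[OF f] e n \<delta> excess] b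
      by (simp add: emeasure_eq_measure)
  qed
  finally show "measure (law n) {x \<in> space (powE n). \<exists>f\<in>\<Phi>. e \<le> \<bar>deviation n f x\<bar>} \<le> real (card \<Phi>) * ?b"
    unfolding eq by simp
qed

text \<open>
  The numerical choices behind the two limit statements: the truncation term is at most \<open>\<eta> / 2\<close> by
  the choice of \<open>\<delta>\<close>, the martingale term by the choice of \<open>n\<close>.
\<close>

lemma deviation_bound_small:
  fixes w d :: real
  assumes w: "0 \<le> w" and d: "0 < d" and \<eta>: "0 < \<eta>" and \<delta>: "\<delta> = \<eta> * d / (12 * (w + 1))"
    and n: "0 < n" and N: "w * (18 * (real R + 1)\<^sup>2) / (d\<^sup>2 * \<eta>) \<le> real n"
  shows "w * (9 * (real R + 1)\<^sup>2 / (real n * d\<^sup>2) + 6 * \<delta> / d) \<le> \<eta>"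
proof -
  have "w * (18 * (real R + 1)\<^sup>2) \<le> real n * (d\<^sup>2 * \<eta>)" using N d \<eta> by (simp add: pos_divide_le_eq)
  then have "w * (9 * (real R + 1)\<^sup>2) / (real n * d\<^sup>2) \<le> \<eta> / 2"
    using d n by (subst pos_divide_le_eq) (auto simp: algebra_simps)
  moreover have "w * (6 * \<delta> / d) = (w / (w + 1)) * (\<eta> / 2)"
  proof -
    have "d \<noteq> 0" "w + 1 \<noteq> 0" using d w by auto
    then show ?thesis by (simp add: \<delta> divide_simps)
  qed
  moreover have "(w / (w + 1)) * (\<eta> / 2) \<le> 1 * (\<eta> / 2)" using w \<eta> by (intro mult_right_mono) auto
  moreover have "w * (9 * (real R + 1)\<^sup>2 / (real n * d\<^sup>2) + 6 * \<delta> / d) =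
      w * (9 * (real R + 1)\<^sup>2) / (real n * d\<^sup>2) + w * (6 * \<delta> / d)"
    by (simp add: distrib_left)
  ultimately show ?thesis by linarith
qed

lemma disintegration_chain:
  fixes \<nu> :: "(nat \<Rightarrow> 'a::polish_space) measure"
  assumes "\<nu> \<in> space (prob_algebra (powE n))"
  shows "kernel_chain (disintegration n \<nu>)" "\<nu> = Ionescu_Tulcea.C (disintegration n \<nu>) (\<lambda>_. borel) 0 n (\<lambda>_. undefined)"
  using disintegrates_disintegration[OF assms] by (auto simp: disintegrates_def kernel_chain_def)

section \<open>The upper bound\<close>

text \<open>
  A finite cover of the sublevel set at height \<open>B - c\<close> by neighbourhoods on which \<open>F\<close> and \<open>\<alpha>\<close> are
  controlled together. Above that height the trivial bound \<open>F \<le> B\<close> already gives \<open>F - \<alpha> < c\<close>.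
\<close>

locale sublevel_cover = psi_compact_rate \<alpha> \<psi>
  for \<alpha> :: "'a::polish_space measure \<Rightarrow> ereal" and \<psi> :: "'a \<Rightarrow> real" +
  fixes F :: "'a measure \<Rightarrow> ereal" and B c :: real and J :: "'a measure set" and r :: "'a measure \<Rightarrow> real"
    and \<Phi> :: "'a measure \<Rightarrow> ('a \<Rightarrow> real) set" and e :: "'a measure \<Rightarrow> real"
  assumes F_le: "\<And>\<nu>. \<nu> \<in> probs_psi \<psi> \<Longrightarrow> F \<nu> \<le> ereal B"
    and J: "finite J" and \<Phi>_finite: "\<And>\<mu>. \<mu> \<in> J \<Longrightarrow> finite (\<Phi> \<mu>)" and e_pos: "\<And>\<mu>. \<mu> \<in> J \<Longrightarrow> 0 < e \<mu>"
    and \<Phi>_test: "\<And>\<mu> f. \<mu> \<in> J \<Longrightarrow> f \<in> \<Phi> \<mu> \<Longrightarrow> continuous_on UNIV f \<and> (\<forall>x. \<bar>f x\<bar> \<le> 1 + \<psi> x)"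
    and nhd: "\<And>\<mu> \<nu>. \<mu> \<in> J \<Longrightarrow> \<nu> \<in> probs_psi \<psi> \<Longrightarrow> (integrals_close (\<Phi> \<mu>) (e \<mu>) \<nu> \<mu>) \<Longrightarrow>
        F \<nu> \<le> ereal (r \<mu>) \<and> ereal (r \<mu> - c) \<le> \<alpha> \<nu>"
    and cover: "\<And>\<nu>. \<nu> \<in> probs \<Longrightarrow> \<alpha> \<nu> \<le> ereal (B - c) \<Longrightarrow> \<exists>\<mu>\<in>J. integrals_close (\<Phi> \<mu>) (e \<mu> / 2) \<nu> \<mu>"

context psi_compact_rate
begin

text \<open>
  At \<open>\<mu>\<close> in the sublevel set, \<open>F(\<mu>) < c + \<alpha>(\<mu>)\<close>, so a number \<open>r\<close> fits strictly in between. Upper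
  semicontinuity of \<open>F\<close> and lower semicontinuity of \<open>\<alpha>\<close> make \<open>F \<le> r\<close> and \<open>r - c \<le> \<alpha>\<close> persist on a basic
  neighbourhood. The cover uses half of each radius, so that a measure close to a covered one still
  lies in the full neighbourhood.
\<close>

lemma finite_cover_of_sublevel:
  assumes usc: "upper_semicontinuous_map (psi_weak_topology \<psi>) F"
    and F_fin: "\<And>\<nu>. \<nu> \<in> probs_psi \<psi> \<Longrightarrow> F \<nu> \<noteq> \<infinity>"
    and less: "\<And>\<nu>. \<nu> \<in> probs_psi \<psi> \<Longrightarrow> eminus (F \<nu>) (\<alpha> \<nu>) < ereal c"
    and F_le: "\<And>\<nu>. \<nu> \<in> probs_psi \<psi> \<Longrightarrow> F \<nu> \<le> ereal B"
  obtains J r \<Phi> e where "sublevel_cover \<alpha> \<psi> F B c J r \<Phi> e"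
proof -
  let ?C = "{f. continuous_on UNIV f \<and> (\<forall>x. \<bar>f x\<bar> \<le> 1 + \<psi> x)}"
  let ?K = "{\<nu> \<in> probs. \<alpha> \<nu> \<le> ereal (B - c)}"
  have Cne: "?C \<noteq> {}"
  proof -
    have "(\<lambda>_. 0) \<in> ?C" using psi_nonneg by (simp add: add_increasing)
    then show ?thesis by blast
  qed
  define good where "good \<mu> r \<Phi> e \<longleftrightarrow> finite \<Phi> \<and> \<Phi> \<subseteq> ?C \<and> 0 < e \<and>
      (\<forall>\<nu>\<in>probs_psi \<psi>. (integrals_close \<Phi> e \<nu> \<mu>) \<longrightarrow> F \<nu> \<le> ereal r \<and> ereal (r - c) \<le> \<alpha> \<nu>)"
    for \<mu> r \<Phi> and e :: real
  have "\<exists>r \<Phi> e. good \<mu> r \<Phi> e"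
    if \<mu>: "\<mu> \<in> ?K" for \<mu>
  proof -
    have \<mu>psi: "\<mu> \<in> probs_psi \<psi>" using \<mu> finite_rate_in_probs_psi by blast
    obtain a where a: "\<alpha> \<mu> = ereal a" using \<mu> not_minus_inf[of \<mu>] by (cases "\<alpha> \<mu>") auto
    have "F \<mu> < ereal (c + a)"
      using less[OF \<mu>psi] F_fin[OF \<mu>psi] a by (cases "F \<mu>") (auto simp: eminus_def)
    then obtain r where r: "F \<mu> < ereal r" "ereal r < ereal (c + a)" using ereal_dense2 by blast
    define W where "W = {\<nu> \<in> probs_psi \<psi>. F \<nu> < ereal r} \<inter> ({\<nu> \<in> probs. ereal (r - c) < \<alpha> \<nu>} \<inter> probs_psi \<psi>)"
    have "openin (psi_weak_topology \<psi>) {\<nu> \<in> probs_psi \<psi>. F \<nu> < ereal r}"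
      using usc unfolding upper_semicontinuous_map_def topspace_psi by blast
    moreover have "openin (psi_weak_topology \<psi>) ({\<nu> \<in> probs. ereal (r - c) < \<alpha> \<nu>} \<inter> probs_psi \<psi>)"
      using psi_nonneg by (intro openin_weak_imp_psi_weak openin_superlevel) simp
    ultimately have "openin (psi_weak_topology \<psi>) W" unfolding W_def by (rule openin_Int)
    then have W: "openin (integral_topology (probs_psi \<psi>) ?C) W" by (simp add: psi_weak_topology_def)
    have "\<mu> \<in> W" using \<mu> \<mu>psi r a by (auto simp: W_def)
    from integral_topology_nhd_basis[OF W this]
    obtain \<Phi> and e :: real where \<Phi>: "finite \<Phi>" "\<Phi> \<subseteq> ?C" "0 < e"
      "\<And>\<nu>. \<nu> \<in> probs_psi \<psi> \<Longrightarrow> (integrals_close \<Phi> e \<nu> \<mu>) \<Longrightarrow> \<nu> \<in> W"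
      by blast
    have "\<forall>\<nu>\<in>probs_psi \<psi>. (integrals_close \<Phi> e \<nu> \<mu>) \<longrightarrow> F \<nu> \<le> ereal r \<and> ereal (r - c) \<le> \<alpha> \<nu>"
      using \<Phi>(4) unfolding W_def by (auto intro: less_imp_le)
    with \<Phi>(1-3) have "good \<mu> r \<Phi> e" by (simp add: good_def)
    then show ?thesis by blast
  qed
  then obtain r \<Phi> e where good: "\<And>\<mu>. \<mu> \<in> ?K \<Longrightarrow> good \<mu> (r \<mu>) (\<Phi> \<mu>) (e \<mu>)" by metis
  have *: "finite (\<Phi> \<mu>) \<and> \<Phi> \<mu> \<subseteq> ?C \<and> 0 < e \<mu> \<and>
      (\<forall>\<nu>\<in>probs_psi \<psi>. (integrals_close (\<Phi> \<mu>) (e \<mu>) \<nu> \<mu>) \<longrightarrow> F \<nu> \<le> ereal (r \<mu>) \<and> ereal (r \<mu> - c) \<le> \<alpha> \<nu>)"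
    if "\<mu> \<in> ?K" for \<mu>
    using good[OF that] unfolding good_def .
  define U where "U \<mu> = {\<nu> \<in> probs_psi \<psi>. integrals_close (\<Phi> \<mu>) (e \<mu> / 2) \<nu> \<mu>}" for \<mu>
  have op: "openin (psi_weak_topology \<psi>) V" if V: "V \<in> U ` ?K" for V
  proof -
    obtain \<mu> where \<mu>: "V = U \<mu>" "\<mu> \<in> ?K" using V by blast
    show ?thesis unfolding \<mu>(1) U_def psi_weak_topology_def
      using *[OF \<mu>(2)] by (intro openin_integral_nhd[OF _ _ Cne]) auto
  qed
  have sub: "?K \<subseteq> \<Union>(U ` ?K)"
  proof
    fix \<mu> assume \<mu>: "\<mu> \<in> ?K"
    then have "\<mu> \<in> U \<mu>" using *[OF \<mu>] finite_rate_in_probs_psi by (auto simp: U_def)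
    then show "\<mu> \<in> \<Union>(U ` ?K)" using \<mu> by blast
  qed
  have "\<exists>\<F>. finite \<F> \<and> \<F> \<subseteq> U ` ?K \<and> ?K \<subseteq> \<Union>\<F>"
    by (rule compactinD[OF compact_sublevel_psi op sub])
  then obtain \<F> where \<F>: "finite \<F>" "\<F> \<subseteq> U ` ?K" "?K \<subseteq> \<Union>\<F>" by blast
  obtain J where J: "finite J" "J \<subseteq> ?K" "\<F> = U ` J" using finite_subset_image[OF \<F>(1,2)] by blast
  have "sublevel_cover \<alpha> \<psi> F B c J r \<Phi> e"
  proof (unfold_locales)
    fix \<nu> assume "\<nu> \<in> probs" "\<alpha> \<nu> \<le> ereal (B - c)"
    then obtain \<mu> where "\<mu> \<in> J" "\<nu> \<in> U \<mu>" using \<F>(3) J(3) by auto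
    then show "\<exists>\<mu>\<in>J. integrals_close (\<Phi> \<mu>) (e \<mu> / 2) \<nu> \<mu>" by (auto simp: U_def)
  next
    fix \<mu> f assume "\<mu> \<in> J" "f \<in> \<Phi> \<mu>"
    then show "continuous_on UNIV f \<and> (\<forall>x. \<bar>f x\<bar> \<le> 1 + \<psi> x)" using *[of \<mu>] J(2) by blast
  next
    fix \<mu> \<nu> assume "\<mu> \<in> J" "\<nu> \<in> probs_psi \<psi>" "integrals_close (\<Phi> \<mu>) (e \<mu>) \<nu> \<mu>"
    then show "F \<nu> \<le> ereal (r \<mu>) \<and> ereal (r \<mu> - c) \<le> \<alpha> \<nu>" using *[of \<mu>] J(2) by blast
  qed (use J * F_le in blast)+
  then show thesis by (rule that)
qed

end

context sublevel_cover
begin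

definition tests :: "('a \<Rightarrow> real) set" where "tests = (\<Union>\<mu>\<in>J. \<Phi> \<mu>)"

lemma tests: "finite tests" "\<And>f. f \<in> tests \<Longrightarrow> continuous_on UNIV f" "\<And>f x. f \<in> tests \<Longrightarrow> \<bar>f x\<bar> \<le> 1 + \<psi> x"
  using J \<Phi>_finite \<Phi>_test by (auto simp: tests_def)

text \<open>
  At most half of every radius in the cover; the entry 1 is for an empty cover.
\<close>

definition tolerance :: real where "tolerance = Min (insert 1 ((\<lambda>\<mu>. e \<mu> / 2) ` J))"

lemma tolerance_pos: "0 < tolerance"
  using J e_pos by (auto simp: tolerance_def)

lemma tolerance_le: "\<mu> \<in> J \<Longrightarrow> tolerance \<le> e \<mu> / 2"
  unfolding tolerance_def by (rule Min_le) (use J in auto)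

definition floor_value :: real where "floor_value = Min (insert B (r ` J))"

lemma floor_value_le: "floor_value \<le> B" "\<mu> \<in> J \<Longrightarrow> floor_value \<le> r \<mu>"
  unfolding floor_value_def by (rule Min_le; use J in auto)+

end

locale covered_chain = sublevel_cover \<alpha> \<psi> F B c J r \<Phi> e + psi_chain \<kappa> \<psi>
  for \<alpha> :: "'a::polish_space measure \<Rightarrow> ereal" and \<psi> F B c J r \<Phi> e and \<kappa> :: "nat \<Rightarrow> (nat \<Rightarrow> 'a) \<Rightarrow> 'a measure" +
  fixes n :: nat
  assumes n: "0 < n"
begin

abbreviation kern :: "(nat \<Rightarrow> 'a) \<Rightarrow> nat \<Rightarrow> 'a measure" where
  "kern x k \<equiv> \<kappa> k (restrict x {0..<k})"

text \<open>
  For the chosen disintegration \<open>\<kappa>\<close> of a law, its integral under that law is \<open>alpha_n\<close>.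
\<close>

definition cost :: "(nat \<Rightarrow> 'a) \<Rightarrow> ereal" where "cost x = (\<Sum>k<n. \<alpha> (kern x k))"

definition kernel_mean :: "('a \<Rightarrow> real) \<Rightarrow> (nat \<Rightarrow> 'a) \<Rightarrow> real" where
  "kernel_mean f x = (\<Sum>k<n. \<integral>y. f y \<partial>kern x k) / real n"

definition mean_near :: "'a measure \<Rightarrow> (nat \<Rightarrow> 'a) \<Rightarrow> bool" where
  "mean_near \<mu> x \<longleftrightarrow> (\<forall>f\<in>\<Phi> \<mu>. \<bar>kernel_mean f x - (\<integral>y. f y \<partial>\<mu>)\<bar> < e \<mu> / 2)"

text \<open>
  The least \<open>r \<mu>\<close> over the halved neighbourhoods that contain the averaged kernels. The index \<open>None\<close>
  supplies the default value \<open>B\<close> and keeps the set nonempty. Membership is expressed by the means of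
  the kernels alone, which makes the envelope measurable and meaningful even where some kernel has
  infinite rate.
\<close>

definition envelope :: "(nat \<Rightarrow> 'a) \<Rightarrow> real" where
  "envelope x = Min ((\<lambda>\<mu>. case \<mu> of None \<Rightarrow> B | Some \<mu> \<Rightarrow> if mean_near \<mu> x then r \<mu> else B) ` insert None (Some ` J))"

lemma envelope_eq: "envelope x = Min (insert B ((\<lambda>\<mu>. if mean_near \<mu> x then r \<mu> else B) ` J))"
  unfolding envelope_def by (simp add: image_image)

lemma envelope_le: "envelope x \<le> B" "\<mu> \<in> J \<Longrightarrow> mean_near \<mu> x \<Longrightarrow> envelope x \<le> r \<mu>"
  unfolding envelope_eq by (rule Min_le; use J in force)+

lemma envelope_ge: "floor_value \<le> envelope x"
  unfolding envelope_eq using J floor_value_le by (subst Min_ge_iff) auto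

lemma envelope_cases: "envelope x = B \<or> (\<exists>\<mu>\<in>J. mean_near \<mu> x \<and> envelope x = r \<mu>)"
proof -
  have "envelope x \<in> insert B ((\<lambda>\<mu>. if mean_near \<mu> x then r \<mu> else B) ` J)"
    unfolding envelope_eq using J by (intro Min_in) auto
  then show ?thesis by (auto split: if_splits)
qed

lemma kern_in_probs: "x \<in> space (powE n) \<Longrightarrow> k < n \<Longrightarrow> kern x k \<in> probs"
  by (intro kernel_in_probs restrict_in_space) auto

lemma F_empirical_le_B: "F (empirical n x) \<le> ereal B"
  by (rule F_le[OF empirical_in_probs_psi[OF n]])

text \<open>
  When the empirical measure is within half a radius of the averaged kernels, it lies in the full
  neighbourhood whose halved version contains the averaged kernels.
\<close>

lemma F_empirical_le_envelope:
  assumes dev: "\<And>f. f \<in> tests \<Longrightarrow> \<bar>deviation n f x\<bar> < tolerance"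
  shows "F (empirical n x) \<le> ereal (envelope x)"
  using envelope_cases[of x]
proof
  assume "envelope x = B" then show ?thesis using F_empirical_le_B by simp
next
  assume "\<exists>\<mu>\<in>J. mean_near \<mu> x \<and> envelope x = r \<mu>"
  then obtain \<mu> where \<mu>: "\<mu> \<in> J" "mean_near \<mu> x" "envelope x = r \<mu>" by auto
  have "\<bar>(\<integral>y. f y \<partial>empirical n x) - (\<integral>y. f y \<partial>\<mu>)\<bar> < e \<mu>" if f: "f \<in> \<Phi> \<mu>" for f
  proof -
    have ft: "f \<in> tests" using f \<mu>(1) by (auto simp: tests_def)
    have "(\<integral>y. f y \<partial>empirical n x) = kernel_mean f x + deviation n f x"
      unfolding deviation_def kernel_mean_def
      by (subst integral_empirical[OF n borel_measurable_continuous_onI[OF tests(2)[OF ft]]]) simp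
    moreover have "\<bar>deviation n f x\<bar> < e \<mu> / 2" using dev[OF ft] tolerance_le[OF \<mu>(1)] by linarith
    moreover have "\<bar>kernel_mean f x - (\<integral>y. f y \<partial>\<mu>)\<bar> < e \<mu> / 2" using \<mu>(2) f by (auto simp: mean_near_def)
    ultimately show ?thesis by linarith
  qed
  then show ?thesis using nhd[OF \<mu>(1) empirical_in_probs_psi[OF n]] \<mu>(3) by simp
qed

lemma cost_cases:
  assumes x: "x \<in> space (powE n)"
  obtains "cost x = \<infinity>" | a where "\<And>k. k < n \<Longrightarrow> \<alpha> (kern x k) = ereal (a k)" "cost x = ereal (\<Sum>k<n. a k)"
proof (cases "\<exists>k<n. \<alpha> (kern x k) = \<infinity>")
  case True
  then have "cost x = \<infinity>" unfolding cost_def by (auto simp: sum_Pinfty)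
  then show thesis by (rule that(1))
next
  case False
  define a where "a k = real_of_ereal (\<alpha> (kern x k))" for k
  have a: "\<alpha> (kern x k) = ereal (a k)" if "k < n" for k
    using not_minus_inf[OF kern_in_probs[OF x that]] False that unfolding a_def by (cases "\<alpha> (kern x k)") auto
  have "cost x = (\<Sum>k<n. ereal (a k))" unfolding cost_def using a by (intro sum.cong) auto
  then show thesis using that(2)[OF a] by simp
qed

text \<open>
  By convexity the averaged kernels have rate at most the average rate. If that average lies in the
  covered sublevel set, a neighbourhood containing it bounds the envelope and the rate together;
  otherwise the rate exceeds \<open>B - c\<close>.
\<close>

lemma envelope_le_cost:
  assumes x: "x \<in> space (powE n)" shows "ereal (real n * (envelope x - c)) \<le> cost x"
proof (cases rule: cost_cases[OF x])
  case (2 a)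
  let ?M = "avg n (kern x)"
  have MP: "?M \<in> probs" using kern_in_probs[OF x] n by (intro avg_in_probs) auto
  have \<alpha>M: "\<alpha> ?M \<le> ereal ((\<Sum>k<n. a k) / real n)"
    using kern_in_probs[OF x] 2(1) n by (intro avg_le) auto
  have kpsi: "kern x k \<in> probs_psi \<psi>" if "k < n" for k
    using finite_rate_in_probs_psi[OF kern_in_probs[OF x that], of "a k"] 2(1)[OF that] by simp
  have Mint: "(\<integral>y. f y \<partial>?M) = kernel_mean f x" if f: "continuous_on UNIV f \<and> (\<forall>y. \<bar>f y\<bar> \<le> 1 + \<psi> y)" for f
  proof -
    have "(\<integral>y. f y \<partial>?M) = (\<Sum>k<n. (1 / real n) * (\<integral>y. f y \<partial>kern x k))"
    proof (rule integral_weighted_sum(2))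
      show "f \<in> borel_measurable borel" using f borel_measurable_continuous_onI by blast
      show "sets (kern x k) = sets borel" if "k \<in> {..<n}" for k
        using kern_in_probs[OF x] that by (simp add: probs_iff)
      show "integrable (kern x k) f" if "k \<in> {..<n}" for k
        using dominated_integrable kpsi that f by blast
    qed auto
    then show ?thesis by (simp add: kernel_mean_def sum_divide_distrib)
  qed
  have "ereal (envelope x - c) \<le> \<alpha> ?M"
  proof (cases "\<alpha> ?M \<le> ereal (B - c)")
    case True
    then obtain \<mu> where \<mu>: "\<mu> \<in> J" "\<And>f. f \<in> \<Phi> \<mu> \<Longrightarrow> \<bar>(\<integral>y. f y \<partial>?M) - (\<integral>y. f y \<partial>\<mu>)\<bar> < e \<mu> / 2"
      using cover[OF MP] by blast
    have "mean_near \<mu> x"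
      unfolding mean_near_def using \<mu>(2) Mint[OF \<Phi>_test[OF \<mu>(1)]] by simp
    then have "envelope x \<le> r \<mu>" using envelope_le(2)[OF \<mu>(1)] by blast
    moreover have "ereal (r \<mu> - c) \<le> \<alpha> ?M"
    proof -
      have "?M \<in> probs_psi \<psi>" by (rule finite_rate_in_probs_psi[OF MP True])
      moreover have "\<bar>(\<integral>y. f y \<partial>?M) - (\<integral>y. f y \<partial>\<mu>)\<bar> < e \<mu>" if "f \<in> \<Phi> \<mu>" for f
        using \<mu>(2)[OF that] e_pos[OF \<mu>(1)] by linarith
      ultimately show ?thesis using nhd[OF \<mu>(1)] by blast
    qed
    ultimately show ?thesis by (meson diff_right_mono ereal_less_eq(3) order_trans)
  next
    case False
    then show ?thesis using envelope_le(1)[of x] by (meson diff_right_mono ereal_less_eq(3) linear order_trans)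
  qed
  then have "ereal (envelope x - c) \<le> ereal ((\<Sum>k<n. a k) / real n)" using \<alpha>M by (rule order_trans)
  then have "real n * (envelope x - c) \<le> (\<Sum>k<n. a k)" using n by (simp add: pos_le_divide_eq mult.commute)
  then show ?thesis by (simp add: 2(2))
qed simp

definition excess_mass :: "nat \<Rightarrow> (nat \<Rightarrow> 'a) \<Rightarrow> ennreal" where
  "excess_mass R x = (\<Sum>k<n. excess_integral R (kern x k))"

lemma measurable_excess_mass [measurable]: "excess_mass R \<in> borel_measurable (powE n)"
proof -
  have em: "(\<lambda>y. ennreal (excess R y)) \<in> borel_measurable borel" by measurable
  show ?thesis unfolding excess_mass_def[abs_def]
    using measurable_nn_integral_kernel[OF _ em] by (intro borel_measurable_sum) auto
qed

text \<open>
  The linear growth estimate summed over the kernels: a second measurable lower bound for the cost.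
\<close>

lemma excess_mass_le_cost:
  assumes a0: "\<And>\<nu>. \<nu> \<in> probs \<Longrightarrow> ereal a0 \<le> \<alpha> \<nu>" and \<delta>: "0 < \<delta>"
    and R: "\<And>\<kappa> a. \<kappa> \<in> probs \<Longrightarrow> \<alpha> \<kappa> \<le> ereal a \<Longrightarrow> excess_integral R \<kappa> \<le> ennreal (\<delta> * (1 + a - a0))"
    and x: "x \<in> space (powE n)"
  shows "enn2ereal (ennreal (1 / \<delta>) * excess_mass R x) + ereal (real n * (a0 - 1)) \<le> cost x"
proof (cases rule: cost_cases[OF x])
  case (2 a)
  have nn: "0 \<le> 1 + a k - a0" if "k < n" for k
    using a0[OF kern_in_probs[OF x that]] 2(1)[OF that] by simp
  have "excess_mass R x \<le> (\<Sum>k<n. ennreal (\<delta> * (1 + a k - a0)))"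
    unfolding excess_mass_def using kern_in_probs[OF x] 2(1) by (intro sum_mono R) auto
  also have "\<dots> = ennreal (\<Sum>k<n. \<delta> * (1 + a k - a0))"
    using nn \<delta> by (intro sum_ennreal) auto
  finally have "ennreal (1 / \<delta>) * excess_mass R x \<le> ennreal (1 / \<delta>) * ennreal (\<Sum>k<n. \<delta> * (1 + a k - a0))"
    by (rule mult_left_mono) simp
  also have "\<dots> = ennreal (1 / \<delta> * (\<Sum>k<n. \<delta> * (1 + a k - a0)))"
    using \<delta> nn by (intro ennreal_mult[symmetric] sum_nonneg mult_nonneg_nonneg) auto
  also have "1 / \<delta> * (\<Sum>k<n. \<delta> * (1 + a k - a0)) = (\<Sum>k<n. a k) - real n * (a0 - 1)"
    using \<delta> by (simp add: sum_distrib_left[symmetric] sum.distrib sum_subtractf algebra_simps)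
  finally have "enn2ereal (ennreal (1 / \<delta>) * excess_mass R x) \<le> enn2ereal (ennreal ((\<Sum>k<n. a k) - real n * (a0 - 1)))"
    by (simp add: less_eq_ennreal.rep_eq)
  also have "\<dots> = ereal ((\<Sum>k<n. a k) - real n * (a0 - 1))"
  proof (rule enn2ereal_ennreal)
    have "(\<Sum>k<n. a k) - real n * (a0 - 1) = (\<Sum>k<n. 1 + a k - a0)"
      by (simp add: sum.distrib sum_subtractf algebra_simps)
    then show "0 \<le> (\<Sum>k<n. a k) - real n * (a0 - 1)" using sum_nonneg[of "{..<n}" "\<lambda>k. 1 + a k - a0"] nn by simp
  qed
  finally have "enn2ereal (ennreal (1 / \<delta>) * excess_mass R x) + ereal (real n * (a0 - 1)) \<le>
      ereal ((\<Sum>k<n. a k) - real n * (a0 - 1)) + ereal (real n * (a0 - 1))"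
    by (rule add_right_mono)
  then show ?thesis by (simp add: 2(2))
qed simp

lemma measurable_envelope [measurable]: "envelope \<in> borel_measurable (powE n)"
proof -
  have mm: "kernel_mean f \<in> borel_measurable (powE n)" if "f \<in> tests" for f
    unfolding kernel_mean_def[abs_def] using measurable_integral_kernel[OF _ borel_measurable_continuous_onI[OF tests(2)[OF that]]]
    by (intro borel_measurable_divide borel_measurable_sum) auto
  have sm: "{x \<in> space (powE n). mean_near \<mu> x} \<in> sets (powE n)" if \<mu>: "\<mu> \<in> J" for \<mu>
    unfolding mean_near_def
  proof (rule sets.sets_Collect_finite_All)
    fix f assume "f \<in> \<Phi> \<mu>"
    then have [measurable]: "kernel_mean f \<in> borel_measurable (powE n)" using mm \<mu> by (auto simp: tests_def)
    show "{x \<in> space (powE n). \<bar>kernel_mean f x - (\<integral>y. f y \<partial>\<mu>)\<bar> < e \<mu> / 2} \<in> sets (powE n)" by measurable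
  qed (rule \<Phi>_finite[OF \<mu>])
  show ?thesis unfolding envelope_def[abs_def]
  proof (rule borel_measurable_Min)
    fix i assume "i \<in> insert None (Some ` J)"
    then show "(\<lambda>x. case i of None \<Rightarrow> B | Some \<mu> \<Rightarrow> if mean_near \<mu> x then r \<mu> else B) \<in> borel_measurable (powE n)"
      using sm by (auto intro!: measurable_If)
  qed (use J in auto)
qed

lemma integrable_envelope: "integrable (law n) envelope"
proof -
  interpret L: prob_space "law n" by (rule prob_space_law)
  show ?thesis
  proof (rule L.integrable_const_bound[where B = "max \<bar>B\<bar> \<bar>floor_value\<bar>"])
    show "AE x in law n. norm (envelope x) \<le> max \<bar>B\<bar> \<bar>floor_value\<bar>"
    proof (rule AE_I2)
      fix x show "norm (envelope x) \<le> max \<bar>B\<bar> \<bar>floor_value\<bar>" using envelope_le(1)[of x] envelope_ge[of x] by (simp add: abs_le_iff le_max_iff_disj) linarith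
    qed
    show "envelope \<in> borel_measurable (law n)" by measurable
  qed
qed

definition bad :: "(nat \<Rightarrow> 'a) set" where
  "bad = {x \<in> space (powE n). \<exists>f\<in>tests. tolerance \<le> \<bar>deviation n f x\<bar>}"

lemma F_empirical_le:
  assumes "x \<in> space (powE n)"
  shows "F (empirical n x) \<le> ereal (envelope x + (B - floor_value) * indicator bad x)"
proof (cases "x \<in> bad")
  case True
  have "B \<le> envelope x + (B - floor_value)" using envelope_ge[of x] by linarith
  then have "ereal B \<le> ereal (envelope x + (B - floor_value) * indicator bad x)" using True by simp
  with F_empirical_le_B show ?thesis by (rule order_trans)
next
  case False
  then have "F (empirical n x) \<le> ereal (envelope x)"
    using assms by (intro F_empirical_le_envelope) (auto simp: bad_def not_le)
  then show ?thesis using False by simp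
qed

text \<open>
  The cost has two measurable lower bounds. If the one through the excess mass has integral at least
  \<open>n (B - c)\<close>, then the bound \<open>F \<le> B\<close> suffices. Otherwise the mean excess mass is at most \<open>n \<delta> A\<close>, the bad set
  has small probability, and the bound through the envelope applies.
\<close>

lemma gain_le:
  assumes a0: "\<And>\<nu>. \<nu> \<in> probs \<Longrightarrow> ereal a0 \<le> \<alpha> \<nu>" and \<delta>: "0 < \<delta>"
    and R: "\<And>\<kappa> a. \<kappa> \<in> probs \<Longrightarrow> \<alpha> \<kappa> \<le> ereal a \<Longrightarrow> excess_integral R \<kappa> \<le> ennreal (\<delta> * (1 + a - a0))"
    and A: "0 \<le> A" "B - c + 1 - a0 \<le> A" and \<eta>: "0 \<le> \<eta>"
    and small: "(B - floor_value) * (real (card tests) * (9 * (real R + 1)\<^sup>2 / (real n * tolerance\<^sup>2) + 6 * (\<delta> * A) / tolerance)) \<le> \<eta>"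
  shows "eminus (eintegral (law n) (scaled_gain F n)) (eintegral (law n) cost) \<le> ereal (real n * (c + \<eta>))"
proof -
  interpret L: prob_space "law n" by (rule prob_space_law)
  have p1: "measure (law n) (space (powE n)) = 1" using L.prob_space by simp
  let ?V = "\<integral>\<^sup>+x. excess_mass R x \<partial>law n"
  have V1: "enn2ereal (ennreal (1 / \<delta>) * ?V) + ereal (real n * (a0 - 1)) \<le> eintegral (law n) cost"
  proof -
    have "(\<integral>\<^sup>+x. ennreal (1 / \<delta>) * excess_mass R x \<partial>law n) = ennreal (1 / \<delta>) * ?V"
      by (rule nn_integral_cmult) measurable
    then have "enn2ereal (ennreal (1 / \<delta>) * ?V) + ereal (real n * (a0 - 1)) =
        eintegral (law n) (\<lambda>x. enn2ereal (ennreal (1 / \<delta>) * excess_mass R x) + ereal (real n * (a0 - 1)))"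
      using L.eintegral_add_const[of "\<lambda>x. ennreal (1 / \<delta>) * excess_mass R x" "real n * (a0 - 1)"] by simp
    also have "\<dots> \<le> eintegral (law n) cost"
      using excess_mass_le_cost[OF a0 \<delta> R] by (intro eintegral_mono) simp
    finally show ?thesis .
  qed
  let ?G = "\<lambda>x. ereal (real n) * F (empirical n x)"
  show ?thesis
  proof (cases "ereal (real n * (B - c)) \<le> enn2ereal (ennreal (1 / \<delta>) * ?V) + ereal (real n * (a0 - 1))")
    case True
    have "eintegral (law n) ?G \<le> eintegral (law n) (\<lambda>x. ereal (real n * B))"
    proof (rule eintegral_mono)
      fix x show "?G x \<le> ereal (real n * B)"
        using ereal_mult_left_mono[OF F_empirical_le_B[of x], of "ereal (real n)"] by simp
    qed
    also have "\<dots> = ereal (real n * B)"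
      by (subst eintegral_eq_integral) (auto simp: p1)
    finally have "eminus (eintegral (law n) ?G) (eintegral (law n) cost) \<le> eminus (ereal (real n * B)) (ereal (real n * (B - c)))"
      using V1 True by (intro eminus_mono) (auto intro: order_trans)
    also have "\<dots> \<le> ereal (real n * (c + \<eta>))"
      using \<eta> by (simp add: eminus_def algebra_simps)
    finally show ?thesis .
  next
    case False
    have Vfin: "?V \<le> ennreal (real n * (\<delta> * A))"
    proof (cases ?V rule: ennreal_cases)
      case (real v)
      have "ennreal (1 / \<delta>) * ?V = ennreal (1 / \<delta> * v)"
        unfolding real(2) using \<delta> real(1) by (intro ennreal_mult[symmetric]) auto
      moreover have "0 \<le> 1 / \<delta> * v" using \<delta> real(1) by simp
      ultimately have "1 / \<delta> * v + real n * (a0 - 1) < real n * (B - c)"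
        using False by (simp add: enn2ereal_ennreal not_le del: times_divide_eq_left)
      then have "1 / \<delta> * v < real n * (B - c + 1 - a0)" by (simp add: algebra_simps)
      also have "\<dots> \<le> real n * A" using A by (intro mult_left_mono) auto
      finally have "v \<le> real n * (\<delta> * A)" using \<delta> by (simp add: field_simps)
      then show ?thesis unfolding real(2) by (rule ennreal_leI)
    next
      case top
      then have "ennreal (1 / \<delta>) * ?V = top" using \<delta> by (simp add: ennreal_mult_top)
      then show ?thesis using False by simp
    qed
    have \<delta>A: "0 \<le> \<delta> * A" using \<delta> A by simp
    note dev = deviations_prob_le[where \<Phi> = tests and e = tolerance and n = n and \<delta> = "\<delta> * A" and R = R,
        OF tests(1) _ _ tolerance_pos n \<delta>A Vfin[unfolded excess_mass_def]]
    have badM: "bad \<in> sets (law n)"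
      and badP: "measure (law n) bad \<le> real (card tests) * (9 * (real R + 1)\<^sup>2 / (real n * tolerance\<^sup>2) + 6 * (\<delta> * A) / tolerance)"
      unfolding bad_def sets_law by (rule dev; use tests in simp)+
    let ?p = "(B - floor_value) * measure (law n) bad"
    have "eintegral (law n) ?G \<le> eintegral (law n) (\<lambda>x. ereal (real n * (envelope x + (B - floor_value) * indicator bad x)))"
    proof (rule eintegral_mono)
      fix x assume "x \<in> space (law n)"
      then show "?G x \<le> ereal (real n * (envelope x + (B - floor_value) * indicator bad x))"
        using ereal_mult_left_mono[OF F_empirical_le, of x "ereal (real n)"] by simp
    qed
    also have "\<dots> = ereal (real n * ((\<integral>x. envelope x \<partial>law n) + ?p))"
      using integrable_envelope badM by (subst eintegral_eq_integral) (auto simp: L.emeasure_eq_measure)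
    finally have 1: "eintegral (law n) ?G \<le> ereal (real n * ((\<integral>x. envelope x \<partial>law n) + ?p))" .
    have "ereal (real n * ((\<integral>x. envelope x \<partial>law n) - c)) = eintegral (law n) (\<lambda>x. ereal (real n * (envelope x - c)))"
      using integrable_envelope by (subst eintegral_eq_integral) (auto simp: p1)
    also have "\<dots> \<le> eintegral (law n) cost" by (rule eintegral_mono) (simp add: envelope_le_cost)
    finally have 2: "ereal (real n * ((\<integral>x. envelope x \<partial>law n) - c)) \<le> eintegral (law n) cost" .
    have "?p \<le> (B - floor_value) * (real (card tests) * (9 * (real R + 1)\<^sup>2 / (real n * tolerance\<^sup>2) + 6 * (\<delta> * A) / tolerance))"
      using floor_value_le(1) badP by (intro mult_left_mono) auto
    with small have 3: "?p \<le> \<eta>" by linarith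
    have "eminus (eintegral (law n) ?G) (eintegral (law n) cost) \<le>
        eminus (ereal (real n * ((\<integral>x. envelope x \<partial>law n) + ?p))) (ereal (real n * ((\<integral>x. envelope x \<partial>law n) - c)))"
      by (rule eminus_mono[OF 1 2])
    also have "\<dots> = ereal (real n * (c + ?p))"
      by (simp add: eminus_def algebra_simps)
    also have "\<dots> \<le> ereal (real n * (c + \<eta>))"
      using 3 by (simp add: mult_left_mono)
    finally show ?thesis .
  qed
qed

end

lemma (in sublevel_cover) rho_upper_bound:
  assumes \<eta>: "0 < \<eta>"
  shows "\<forall>\<^sub>F n in sequentially. rho \<alpha> n (scaled_gain F n) \<le> ereal (real n * (c + \<eta>))"
proof -
  obtain a0 where a0: "\<And>\<nu>. \<nu> \<in> probs \<Longrightarrow> ereal a0 \<le> \<alpha> \<nu>" by (rule bounded_below) blast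
  define d where "d = tolerance"
  have d: "0 < d" using tolerance_pos by (simp add: d_def)
  define w where "w = (B - floor_value) * real (card tests)"
  have w: "0 \<le> w" using floor_value_le(1) by (simp add: w_def)
  define A where "A = max 1 (B - c + 1 - a0)"
  have A: "1 \<le> A" "B - c + 1 - a0 \<le> A" by (auto simp: A_def)
  \<comment> \<open>Chosen so that \<open>\<delta> * A\<close>, which bounds the excess mass per coordinate,
    fits \<open>deviation_bound_small\<close>.\<close>
  define \<delta> where "\<delta> = \<eta> * d / (12 * A * (w + 1))"
  have \<delta>: "0 < \<delta>" using \<eta> d A w by (simp add: \<delta>_def)
  obtain R where R: "\<And>\<kappa> a. \<kappa> \<in> probs \<Longrightarrow> \<alpha> \<kappa> \<le> ereal a \<Longrightarrow> excess_integral R \<kappa> \<le> ennreal (\<delta> * (1 + a - a0))"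
    by (rule excess_integral_le_rate[OF a0 \<delta>]) (assumption, (rule that; blast))
  obtain N :: nat where N: "w * (18 * (real R + 1)\<^sup>2) / (d\<^sup>2 * \<eta>) \<le> real N" using real_arch_simple by blast
  have small: "w * (9 * (real R + 1)\<^sup>2 / (real n * d\<^sup>2) + 6 * (\<delta> * A) / d) \<le> \<eta>" if "0 < n" "N \<le> n" for n
    using N A d w that by (intro deviation_bound_small[OF w d \<eta>]) (auto simp: \<delta>_def)
  have "rho \<alpha> n (scaled_gain F n) \<le> ereal (real n * (c + \<eta>))" if nN: "0 < n" "N \<le> n" for n
    unfolding rho_def
  proof (rule SUP_least)
    fix \<nu> :: "(nat \<Rightarrow> 'a) measure" assume \<nu>: "\<nu> \<in> space (prob_algebra (powE n))"
    define \<kappa> where "\<kappa> = disintegration n \<nu>"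
    interpret kernel_chain \<kappa> unfolding \<kappa>_def by (rule disintegration_chain(1)[OF \<nu>])
    interpret covered_chain \<alpha> \<psi> F B c J r \<Phi> e \<kappa> n by unfold_locales (rule nN(1))
    have law: "\<nu> = law n" unfolding \<kappa>_def by (rule disintegration_chain(2)[OF \<nu>])
    have "alpha_n \<alpha> n \<nu> = eintegral \<nu> cost"
      by (simp only: alpha_n_def cost_def[abs_def]) (simp only: \<kappa>_def)
    moreover have "eminus (eintegral (law n) (scaled_gain F n)) (eintegral (law n) cost) \<le> ereal (real n * (c + \<eta>))"
    proof (rule gain_le[OF a0 \<delta> R])
      show "0 \<le> A" "B - c + 1 - a0 \<le> A" "0 \<le> \<eta>" using A \<eta> by auto
      show "(B - floor_value) * (real (card tests) * (9 * (real R + 1)\<^sup>2 / (real n * tolerance\<^sup>2) + 6 * (\<delta> * A) / tolerance)) \<le> \<eta>"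
        using small[OF nN] by (simp add: w_def d_def mult.assoc)
    qed
    ultimately show "eminus (eintegral \<nu> (scaled_gain F n)) (alpha_n \<alpha> n \<nu>) \<le> ereal (real n * (c + \<eta>))"
      by (simp only: law)
  qed
  then show ?thesis
    by (intro eventually_sequentiallyI[of "max 1 N"]) auto
qed

context psi_compact_rate
begin

text \<open>
  For any \<open>c\<close> above the supremum a cover of the sublevel set at height \<open>B - c\<close> exists, and the gain
  per coordinate is eventually at most \<open>c + \<eta>\<close>.
\<close>

theorem laplace_upper_bound:
  assumes usc: "upper_semicontinuous_map (psi_weak_topology \<psi>) F"
    and F_fin: "\<And>\<nu>. \<nu> \<in> probs_psi \<psi> \<Longrightarrow> F \<nu> \<noteq> \<infinity>"
    and F_le: "\<And>\<nu>. \<nu> \<in> probs_psi \<psi> \<Longrightarrow> F \<nu> \<le> ereal B"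
  shows "limsup (\<lambda>n. ereal (1 / real n) * rho \<alpha> n (scaled_gain F n))
    \<le> (SUP \<nu>\<in>probs_psi \<psi>. eminus (F \<nu>) (\<alpha> \<nu>))"
proof (rule dense_ge)
  fix y assume "(SUP \<nu>\<in>probs_psi \<psi>. eminus (F \<nu>) (\<alpha> \<nu>)) < y"
  then obtain c where c: "(SUP \<nu>\<in>probs_psi \<psi>. eminus (F \<nu>) (\<alpha> \<nu>)) < ereal c" "ereal c < y"
    using ereal_dense2 by blast
  obtain c' where c': "ereal c < ereal c'" "ereal c' < y" using ereal_dense2[OF c(2)] by blast
  define \<eta> where "\<eta> = c' - c"
  have \<eta>: "0 < \<eta>" using c'(1) by (simp add: \<eta>_def)
  have less: "eminus (F \<nu>) (\<alpha> \<nu>) < ereal c" if "\<nu> \<in> probs_psi \<psi>" for \<nu>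
    by (rule le_less_trans[OF SUP_upper[OF that] c(1)])
  obtain J r \<Phi> e where "sublevel_cover \<alpha> \<psi> F B c J r \<Phi> e"
    by (rule finite_cover_of_sublevel[OF usc F_fin less F_le]) auto
  then interpret sublevel_cover \<alpha> \<psi> F B c J r \<Phi> e .
  have "\<forall>\<^sub>F n in sequentially. ereal (1 / real n) * rho \<alpha> n (scaled_gain F n) \<le> ereal c'"
    using rho_upper_bound[OF \<eta>] eventually_gt_at_top[of 0]
  proof eventually_elim
    case (elim n)
    have "ereal (1 / real n) * rho \<alpha> n (scaled_gain F n) \<le> ereal (1 / real n) * ereal (real n * (c + \<eta>))"
      by (rule ereal_mult_left_mono[OF elim(1)]) simp
    also have "\<dots> = ereal c'" using elim(2) by (simp add: \<eta>_def)
    finally show ?case .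
  qed
  then have "limsup (\<lambda>n. ereal (1 / real n) * rho \<alpha> n (scaled_gain F n)) \<le> ereal c'"
    by (rule Limsup_bounded)
  then show "limsup (\<lambda>n. ereal (1 / real n) * rho \<alpha> n (scaled_gain F n)) \<le> y"
    using c'(2) by simp
qed

end

section \<open>The lower bound\<close>

context psi_growth
begin

lemma product_in_space:
  fixes \<mu> :: "'a measure"
  assumes "\<mu> \<in> probs" shows "PiM {0..<n} (\<lambda>_. \<mu>) \<in> space (prob_algebra (powE n))"
proof -
  have "sets (PiM {0..<n} (\<lambda>_. \<mu>)) = sets (powE n)"
    using assms by (intro sets_PiM_cong) (auto simp: probs_iff)
  moreover have "prob_space (PiM {0..<n} (\<lambda>_. \<mu>))"
    using assms by (intro prob_space_PiM) (simp add: probs_iff)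
  ultimately show ?thesis by (simp add: space_prob_algebra)
qed

lemma AE_product_kernels:
  fixes \<mu> :: "'a measure"
  assumes \<mu>: "\<mu> \<in> probs"
  shows "AE x in PiM {0..<n} (\<lambda>_. \<mu>). \<forall>k<n. disintegration n (PiM {0..<n} (\<lambda>_. \<mu>)) k (restrict x {0..<k}) = \<mu>"
proof -
  let ?P = "PiM {0..<n} (\<lambda>_. \<mu>)"
  note prodP = product_in_space[OF \<mu>, of n]
  interpret kernel_chain "disintegration n ?P" by (rule disintegration_chain(1)[OF prodP])
  have law: "law n = ?P" by (rule disintegration_chain(2)[OF prodP, symmetric])
  have "AE x in ?P. disintegration n ?P k (restrict x {0..<k}) = \<mu>" if "k < n" for k
    using kernels_of_product_law[OF \<mu> law that] unfolding law .
  then have "AE x in ?P. \<forall>k\<in>{..<n}. disintegration n ?P k (restrict x {0..<k}) = \<mu>"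
    by (subst AE_ball_countable) auto
  then show ?thesis by (rule eventually_mono) auto
qed

lemma alpha_n_product:
  fixes \<mu> :: "'a measure"
  assumes \<mu>: "\<mu> \<in> probs" and a: "\<alpha> \<mu> = ereal a"
  shows "alpha_n \<alpha> n (PiM {0..<n} (\<lambda>_. \<mu>)) = ereal (real n * a)"
proof -
  let ?P = "PiM {0..<n} (\<lambda>_. \<mu>)"
  interpret P: prob_space ?P using product_in_space[OF \<mu>, of n] by (simp add: space_prob_algebra)
  have "AE x in ?P. (\<Sum>k<n. \<alpha> (disintegration n ?P k (restrict x {0..<k}))) = ereal (real n * a)"
    using AE_product_kernels[OF \<mu>, of n]
  proof eventually_elim
    case (elim x)
    then have "(\<Sum>k<n. \<alpha> (disintegration n ?P k (restrict x {0..<k}))) = (\<Sum>k<n. ereal a)"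
      using a by (intro sum.cong) auto
    then show ?case by simp
  qed
  then have "alpha_n \<alpha> n ?P = eintegral ?P (\<lambda>x. ereal (real n * a))"
    unfolding alpha_n_def by (rule eintegral_cong_AE)
  also have "\<dots> = ereal (real n * a)" by (subst eintegral_eq_integral) (auto simp: P.prob_space)
  finally show ?thesis .
qed

text \<open>
  For the product law the averaged kernels are almost surely \<open>\<mu>\<close>, so the deviation estimate compares
  the empirical measure with \<open>\<mu>\<close> itself. The exceptional set is defined by the coordinates alone, so
  that its complement gives the estimate at every point.
\<close>

lemma law_of_large_numbers:
  assumes \<mu>: "\<mu> \<in> probs_psi \<psi>" and \<Phi>: "finite \<Phi>"
    and \<Phi>C: "\<And>f. f \<in> \<Phi> \<Longrightarrow> continuous_on UNIV f" "\<And>f x. f \<in> \<Phi> \<Longrightarrow> \<bar>f x\<bar> \<le> 1 + \<psi> x"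
    and e: "0 < e" and \<eta>: "0 < \<eta>"
  shows "\<forall>\<^sub>F n in sequentially. \<exists>X \<in> sets (powE n). measure (PiM {0..<n} (\<lambda>_. \<mu>)) X \<le> \<eta> \<and>
    (\<forall>x \<in> space (powE n) - X. integrals_close \<Phi> e (empirical n x) \<mu>)"
proof -
  have \<mu>P: "\<mu> \<in> probs" using \<mu> probs_psi_subset by blast
  define w where "w = real (card \<Phi>)"
  define \<delta> where "\<delta> = \<eta> * e / (12 * (w + 1))"
  have w: "0 \<le> w" by (simp add: w_def)
  have \<delta>: "0 < \<delta>" using \<eta> e w by (simp add: \<delta>_def)
  have "\<forall>\<^sub>F R in sequentially. (\<integral>x. excess R x \<partial>\<mu>) < \<delta>"
    using integral_excess_tendsto_0[OF \<mu>] \<delta> by (rule order_tendstoD)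
  then obtain R where R: "(\<integral>x. excess R x \<partial>\<mu>) < \<delta>" using eventually_sequentially by auto
  obtain N :: nat where N: "w * (18 * (real R + 1)\<^sup>2) / (e\<^sup>2 * \<eta>) \<le> real N" using real_arch_simple by blast
  have small: "w * (9 * (real R + 1)\<^sup>2 / (real n * e\<^sup>2) + 6 * \<delta> / e) \<le> \<eta>" if "0 < n" "N \<le> n" for n
    using N that by (intro deviation_bound_small[OF w e \<eta> \<delta>_def]) auto
  have "\<exists>X \<in> sets (powE n). measure (PiM {0..<n} (\<lambda>_. \<mu>)) X \<le> \<eta> \<and>
    (\<forall>x \<in> space (powE n) - X. integrals_close \<Phi> e (empirical n x) \<mu>)"
    if n: "0 < n" "N \<le> n" for n
  proof -
    let ?P = "PiM {0..<n} (\<lambda>_. \<mu>)"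
    note prodP = product_in_space[OF \<mu>P, of n]
    define \<kappa> where "\<kappa> = disintegration n ?P"
    interpret kernel_chain \<kappa> unfolding \<kappa>_def by (rule disintegration_chain(1)[OF prodP])
    interpret psi_chain \<kappa> \<psi> by unfold_locales
    have law: "law n = ?P" unfolding \<kappa>_def by (rule disintegration_chain(2)[OF prodP, symmetric])
    interpret L: prob_space "law n" by (rule prob_space_law)
    have ae: "AE x in law n. \<forall>k<n. \<kappa> k (restrict x {0..<k}) = \<mu>"
      unfolding law unfolding \<kappa>_def by (rule AE_product_kernels[OF \<mu>P])
    have "(\<integral>\<^sup>+x. (\<Sum>k<n. excess_integral R (\<kappa> k (restrict x {0..<k}))) \<partial>law n) =
        (\<integral>\<^sup>+x. (\<Sum>k<n. excess_integral R \<mu>) \<partial>law n)"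
      using ae by (intro nn_integral_cong_AE) (auto elim!: eventually_mono intro!: sum.cong)
    also have "\<dots> = (\<Sum>k<n. excess_integral R \<mu>)"
      using L.emeasure_space_1 by simp
    also have "excess_integral R \<mu> = ennreal (\<integral>y. excess R y \<partial>\<mu>)"
      by (intro nn_integral_eq_integral dominated_integrable[OF \<mu> excess_cont excess_le]) (simp add: excess_nonneg)
    also have "(\<Sum>k<n. ennreal (\<integral>y. excess R y \<partial>\<mu>)) = ennreal (real n * (\<integral>y. excess R y \<partial>\<mu>))"
      by (subst sum_ennreal) (auto simp: excess_nonneg)
    also have "\<dots> \<le> ennreal (real n * \<delta>)"
      using R by (intro ennreal_leI mult_left_mono) auto
    finally have V: "(\<integral>\<^sup>+x. (\<Sum>k<n. excess_integral R (\<kappa> k (restrict x {0..<k}))) \<partial>law n) \<le> ennreal (real n * \<delta>)" .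
    note dev = deviations_prob_le[where \<Phi> = \<Phi> and e = e and n = n and \<delta> = \<delta> and R = R,
        OF \<Phi> _ _ e n(1) less_imp_le[OF \<delta>] V]
    define Y where "Y = {x \<in> space (powE n). \<exists>f\<in>\<Phi>. e \<le> \<bar>deviation n f x\<bar>}"
    define X where "X = {x \<in> space (powE n). \<exists>f\<in>\<Phi>. e \<le> \<bar>(\<Sum>k<n. f (x k)) / real n - (\<integral>y. f y \<partial>\<mu>)\<bar>}"
    have fm: "f \<in> borel_measurable borel" if "f \<in> \<Phi>" for f
      by (rule borel_measurable_continuous_onI[OF \<Phi>C(1)[OF that]])
    have Ys: "Y \<in> sets (law n)" and Yp: "measure (law n) Y \<le> w * (9 * (real R + 1)\<^sup>2 / (real n * e\<^sup>2) + 6 * \<delta> / e)"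
      unfolding Y_def w_def sets_law by (rule dev; use \<Phi>C in simp)+
    have Xs: "X \<in> sets (powE n)" unfolding X_def
    proof (rule sets.sets_Collect_finite_Ex)
      fix f assume f: "f \<in> \<Phi>"
      have [measurable]: "(\<lambda>x. \<Sum>k<n. f (x k)) \<in> borel_measurable (powE n)"
        using measurable_coordinate[OF _ fm[OF f]] by (intro borel_measurable_sum) auto
      show "{x \<in> space (powE n). e \<le> \<bar>(\<Sum>k<n. f (x k)) / real n - (\<integral>y. f y \<partial>\<mu>)\<bar>} \<in> sets (powE n)" by measurable
    qed (rule \<Phi>)
    have "emeasure (law n) X = emeasure (law n) Y"
    proof (rule emeasure_eq_AE)
      show "AE x in law n. x \<in> X \<longleftrightarrow> x \<in> Y"
        using ae
      proof eventually_elim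
        case (elim x)
        then have "(\<Sum>k<n. \<integral>y. f y \<partial>\<kappa> k (restrict x {0..<k})) = real n * (\<integral>y. f y \<partial>\<mu>)" for f :: "'a \<Rightarrow> real"
          by simp
        then show ?case using n(1) by (simp add: X_def Y_def deviation_def)
      qed
    qed (use Xs Ys in auto)
    then have "measure ?P X \<le> \<eta>"
      using Yp small[OF n] by (simp add: law[symmetric] measure_def)
    moreover have "\<bar>(\<integral>y. f y \<partial>empirical n x) - (\<integral>y. f y \<partial>\<mu>)\<bar> < e" if "x \<in> space (powE n) - X" "f \<in> \<Phi>" for x f
      using that integral_empirical[OF n(1) fm[OF that(2)], of x] by (auto simp: X_def not_le)
    ultimately show ?thesis using Xs by blast
  qed
  then show ?thesis
    by (intro eventually_sequentiallyI[of "max 1 N"]) auto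
qed

text \<open>
  The product law of \<open>\<mu>\<close> costs \<open>n \<alpha>(\<mu>)\<close>, and by the law of large numbers it gains at least
  \<open>n (c - w \<eta>)\<close> for any \<open>c < F(\<mu>)\<close>, where \<open>w\<close> bounds the loss on the exceptional set.
\<close>

theorem laplace_lower_bound:
  assumes lsc: "lower_semicontinuous_map (psi_weak_topology \<psi>) F"
    and F_ge: "\<And>\<nu>. \<nu> \<in> probs_psi \<psi> \<Longrightarrow> ereal b \<le> F \<nu>"
    and \<alpha>: "\<And>\<nu>. \<nu> \<in> probs \<Longrightarrow> \<alpha> \<nu> \<noteq> -\<infinity>"
  shows "(SUP \<nu>\<in>probs_psi \<psi>. eminus (F \<nu>) (\<alpha> \<nu>))
    \<le> liminf (\<lambda>n. ereal (1 / real n) * rho \<alpha> n (scaled_gain F n))"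
proof (rule SUP_least)
  let ?L = "liminf (\<lambda>n. ereal (1 / real n) * rho \<alpha> n (scaled_gain F n))"
  fix \<mu> assume \<mu>: "\<mu> \<in> probs_psi \<psi>"
  then have \<mu>P: "\<mu> \<in> probs" using probs_psi_subset by blast
  show "eminus (F \<mu>) (\<alpha> \<mu>) \<le> ?L"
  proof (cases "\<alpha> \<mu>")
    case PInf
    then show ?thesis by (cases "F \<mu>") (auto simp: eminus_def)
  next
    case MInf
    then show ?thesis using \<alpha>[OF \<mu>P] by simp
  next
    case (real a)
    show ?thesis
    proof (rule dense_le)
      fix y assume y: "y < eminus (F \<mu>) (\<alpha> \<mu>)"
      then obtain z where z: "y < ereal z" "ereal z < eminus (F \<mu>) (\<alpha> \<mu>)" using ereal_dense2 by blast
      obtain z' where z': "y < ereal z'" "ereal z' < ereal z" using ereal_dense2[OF z(1)] by blast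
      define c where "c = z + a"
      have c: "ereal c < F \<mu>" using z(2) real by (cases "F \<mu>") (auto simp: eminus_def c_def)
      define w where "w = max 0 (c - b)"
      define \<eta> where "\<eta> = (z - z') / (w + 1)"
      have w: "0 \<le> w" by (simp add: w_def)
      have \<eta>: "0 < \<eta>" using z'(2) w by (simp add: \<eta>_def)
      have w\<eta>: "w * \<eta> \<le> z - z'"
      proof -
        have "w * \<eta> \<le> (w + 1) * \<eta>" using \<eta> by (intro mult_right_mono) auto
        also have "\<dots> = z - z'" using w by (simp add: \<eta>_def)
        finally show ?thesis .
      qed
      let ?C = "{f. continuous_on UNIV f \<and> (\<forall>x. \<bar>f x\<bar> \<le> 1 + \<psi> x)}"
      have W: "openin (integral_topology (probs_psi \<psi>) ?C) {\<nu> \<in> probs_psi \<psi>. ereal c < F \<nu>}"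
        using lsc unfolding lower_semicontinuous_map_def topspace_psi unfolding psi_weak_topology_def by blast
      have "\<mu> \<in> {\<nu> \<in> probs_psi \<psi>. ereal c < F \<nu>}" using \<mu> c by simp
      from integral_topology_nhd_basis[OF W this]
      obtain \<Phi> and e :: real where \<Phi>: "finite \<Phi>" "\<Phi> \<subseteq> ?C" "0 < e"
        "\<And>\<nu>. \<nu> \<in> probs_psi \<psi> \<Longrightarrow> (integrals_close \<Phi> e \<nu> \<mu>) \<Longrightarrow> \<nu> \<in> {\<nu> \<in> probs_psi \<psi>. ereal c < F \<nu>}"
        by blast
      have "\<forall>\<^sub>F n in sequentially. \<exists>X \<in> sets (powE n). measure (PiM {0..<n} (\<lambda>_. \<mu>)) X \<le> \<eta> \<and>
          (\<forall>x \<in> space (powE n) - X. integrals_close \<Phi> e (empirical n x) \<mu>)"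
        using \<Phi>(2) by (intro law_of_large_numbers[OF \<mu> \<Phi>(1) _ _ \<Phi>(3) \<eta>]) auto
      then have "\<forall>\<^sub>F n in sequentially. ereal z' \<le> ereal (1 / real n) * rho \<alpha> n (scaled_gain F n)"
        using eventually_gt_at_top[of 0]
      proof eventually_elim
        case (elim n)
        let ?P = "PiM {0..<n} (\<lambda>_. \<mu>)"
        let ?G = "\<lambda>x. ereal (real n) * F (empirical n x)"
        have P: "?P \<in> space (prob_algebra (powE n))" by (rule product_in_space[OF \<mu>P])
        then interpret P: prob_space ?P by (simp add: space_prob_algebra)
        have sP: "sets ?P = sets (powE n)" using P by (simp add: space_prob_algebra)
        obtain X where X: "X \<in> sets (powE n)" "measure ?P X \<le> \<eta>"
          "\<And>x f. x \<in> space (powE n) - X \<Longrightarrow> f \<in> \<Phi> \<Longrightarrow> \<bar>(\<integral>y. f y \<partial>empirical n x) - (\<integral>y. f y \<partial>\<mu>)\<bar> < e"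
          using elim(1) by blast
        have F: "ereal (c - w * indicator X x) \<le> F (empirical n x)" if "x \<in> space ?P" for x
        proof (cases "x \<in> X")
          case True
          have "c - w \<le> b" by (simp add: w_def)
          then have "ereal (c - w * indicator X x) \<le> ereal b" using True by simp
          then show ?thesis using F_ge[OF empirical_in_probs_psi[OF elim(2)]] by (rule order_trans)
        next
          case False
          then have "empirical n x \<in> {\<nu> \<in> probs_psi \<psi>. ereal c < F \<nu>}"
            using X(3)[of x] that sets_eq_imp_space_eq[OF sP] by (intro \<Phi>(4) empirical_in_probs_psi[OF elim(2)]) auto
          then show ?thesis using False by (simp add: less_imp_le)
        qed
        have "ereal (real n * (c - w * measure ?P X)) = eintegral ?P (\<lambda>x. ereal (real n * (c - w * indicator X x)))"
          using X(1) sP by (subst eintegral_eq_integral) (auto simp: P.prob_space P.emeasure_eq_measure)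
        also have "\<dots> \<le> eintegral ?P ?G"
        proof (rule eintegral_mono)
          fix x assume "x \<in> space ?P"
          then show "ereal (real n * (c - w * indicator X x)) \<le> ?G x"
            using ereal_mult_left_mono[OF F, of x "ereal (real n)"] by simp
        qed
        finally have 1: "ereal (real n * (c - w * measure ?P X)) \<le> eintegral ?P ?G" .
        have "w * measure ?P X \<le> w * \<eta>" using w X(2) by (rule mult_left_mono[rotated])
        then have "z' \<le> c - w * measure ?P X - a" using w\<eta> by (simp add: c_def)
        then have "real n * z' \<le> real n * (c - w * measure ?P X - a)" by (rule mult_left_mono) simp
        then have "ereal (real n * z') \<le> eminus (ereal (real n * (c - w * measure ?P X))) (ereal (real n * a))"
          by (simp add: eminus_def right_diff_distrib)
        also have "\<dots> \<le> eminus (eintegral ?P ?G) (alpha_n \<alpha> n ?P)"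
          unfolding alpha_n_product[of \<mu> \<alpha>, OF \<mu>P real] by (rule eminus_mono[OF 1 order_refl])
        also have "\<dots> \<le> rho \<alpha> n ?G"
          unfolding rho_def by (rule SUP_upper[OF P])
        finally have "ereal (1 / real n) * ereal (real n * z') \<le> ereal (1 / real n) * rho \<alpha> n ?G"
          by (rule ereal_mult_left_mono) simp
        then show ?case using elim(2) by simp
      qed
      then have "ereal z' \<le> ?L" by (rule Liminf_bounded)
      then show "y \<le> ?L" using z'(1) by simp
    qed
  qed
qed

end

theorem theorem2p4:
  fixes \<alpha> :: "'a::polish_space measure \<Rightarrow> ereal"
    and \<psi> :: "'a \<Rightarrow> real"
  assumes alpha_range: "\<forall>\<nu>\<in>probs. \<alpha> \<nu> \<noteq> -\<infinity>"
    and alpha_proper: "\<exists>\<nu>\<in>probs. \<alpha> \<nu> \<noteq> \<infinity>"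
    and alpha_convex: "convex_on_probs \<alpha>"
    and alpha_sublevel: "\<forall>c::real. compactin weak_topology {\<nu> \<in> probs. \<alpha> \<nu> \<le> ereal c}"
    and psi_cont: "continuous_on UNIV \<psi>"
    and psi_nonneg: "\<forall>x. 0 \<le> \<psi> x"
  shows
    "(\<forall>F :: 'a measure \<Rightarrow> ereal.
        (\<forall>\<nu>\<in>probs_psi \<psi>. F \<nu> \<noteq> -\<infinity>) \<longrightarrow>
        lower_semicontinuous_map (psi_weak_topology \<psi>) F \<longrightarrow>
        (\<exists>b::real. \<forall>\<nu>\<in>probs_psi \<psi>. ereal b \<le> F \<nu>) \<longrightarrow>
        liminf (\<lambda>n. ereal (1 / real n) * rho \<alpha> n (\<lambda>x. ereal (real n) * F (empirical n x)))
          \<ge> (SUP \<nu>\<in>probs_psi \<psi>. eminus (F \<nu>) (\<alpha> \<nu>)))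
     \<and>
     ((\<forall>c::real. precompact_in (psi_weak_topology \<psi>) {\<nu> \<in> probs. \<alpha> \<nu> \<le> ereal c}) \<longrightarrow>
      (\<forall>F :: 'a measure \<Rightarrow> ereal.
        (\<forall>\<nu>\<in>probs_psi \<psi>. F \<nu> \<noteq> \<infinity>) \<longrightarrow>
        upper_semicontinuous_map (psi_weak_topology \<psi>) F \<longrightarrow>
        (\<exists>b::real. \<forall>\<nu>\<in>probs_psi \<psi>. F \<nu> \<le> ereal b) \<longrightarrow>
        limsup (\<lambda>n. ereal (1 / real n) * rho \<alpha> n (\<lambda>x. ereal (real n) * F (empirical n x)))
          \<le> (SUP \<nu>\<in>probs_psi \<psi>. eminus (F \<nu>) (\<alpha> \<nu>))))"
proof (intro conjI allI impI)
  interpret psi_growth \<psi> using psi_cont psi_nonneg by unfold_locales auto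
  fix F :: "'a measure \<Rightarrow> ereal"
  assume lsc: "lower_semicontinuous_map (psi_weak_topology \<psi>) F"
    and "\<exists>b::real. \<forall>\<nu>\<in>probs_psi \<psi>. ereal b \<le> F \<nu>"
  then obtain b :: real where "\<And>\<nu>. \<nu> \<in> probs_psi \<psi> \<Longrightarrow> ereal b \<le> F \<nu>" by blast
  then show "(SUP \<nu>\<in>probs_psi \<psi>. eminus (F \<nu>) (\<alpha> \<nu>))
      \<le> liminf (\<lambda>n. ereal (1 / real n) * rho \<alpha> n (\<lambda>x. ereal (real n) * F (empirical n x)))"
    using alpha_range by (intro laplace_lower_bound[OF lsc]) auto
next
  fix F :: "'a measure \<Rightarrow> ereal"
  assume pc: "\<forall>c::real. precompact_in (psi_weak_topology \<psi>) {\<nu> \<in> probs. \<alpha> \<nu> \<le> ereal c}"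
    and fin: "\<forall>\<nu>\<in>probs_psi \<psi>. F \<nu> \<noteq> \<infinity>"
    and usc: "upper_semicontinuous_map (psi_weak_topology \<psi>) F"
    and "\<exists>b::real. \<forall>\<nu>\<in>probs_psi \<psi>. F \<nu> \<le> ereal b"
  then obtain b :: real where b: "\<And>\<nu>. \<nu> \<in> probs_psi \<psi> \<Longrightarrow> F \<nu> \<le> ereal b" by blast
  interpret psi_compact_rate \<alpha> \<psi>
    using assms pc by unfold_locales auto
  show "limsup (\<lambda>n. ereal (1 / real n) * rho \<alpha> n (\<lambda>x. ereal (real n) * F (empirical n x)))
      \<le> (SUP \<nu>\<in>probs_psi \<psi>. eminus (F \<nu>) (\<alpha> \<nu>))"
    using fin by (intro laplace_upper_bound[OF usc _ b]) auto
qed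

end
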